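(* Let $X_{mn}=(x_{ij})$ be a generic $m\times n$ matrix (its entries are $mn$ distinct indeterminates), let $I_{mn}\subset\mathbb{K}[x_{ij}]$ be the ideal generated by its $2\times2$ minors, so that the secant ideal $I_{mn}^{\{r\}}$ is the ideal of $(r+1)\times(r+1)$ minors of $X_{mn}$. For all integers $r,s\ge1$, the $s$-th symbolic power of $I_{mn}^{\{r\}}$ is generated by products of minors: $$\left(I_{mn}^{\{r\}}\right)^{(s)}=\Big\langle\prod_{i=1}^{l}f_i\ \Big|\ f_i\in\mathcal{M}_{r+1}(X_{mn}),\ \sum_{i=1}^{l}(\deg f_i-r)=s\Big\rangle,$$ and these products of minors form a Gröbner basis for $\left(I_{mn}^{\{r\}}\right)^{(s)}$ with respect to any diagonal term order.
   Context: $\mathbb{K}$ is an algebraically closed field and $R=\mathbb{K}[\mathbf{x}]$ is the polynomial ring in the entries of the matrix. For a matrix $X$, $\mathcal{M}_r(X)$ is the set of all $t\times t$ minors of $X$ for all $t\ge r$. In the generating set $l\ge1$ is arbitrary. A diagonal term order is any term order that selects the product of the main diagonal entries of any square submatrix of $X_{mn}$ as the leading monomial of the corresponding minor. Symbolic power: $I^{(r)}=(R_I^{-1}I^r)\cap R$, where $R_I$ is the complement of the union of the minimal primes of $I$. Join and secant ideals: $I\ast J=\big(I(\mathbf{y})+J(\mathbf{z})+\langle x_a-y_a-z_a\mid a\rangle\big)\cap\mathbb{K}[\mathbf{x}]$ ($a$ running over the indices of the variables), where $I(\mathbf{y})$ is $I$ with $y_a$ substituted for $x_a$; the $r$-th secant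 ideal is the $r$-fold join $I^{\{r\}}=I\ast\cdots\ast I$ (so $I^{\{1\}}=I$). *)

theory Defs
  imports
    "HOL-Library.Poly_Mapping"
    "HOL-Library.Product_Lexorder"
    "HOL-Computational_Algebra.Polynomial"
    "HOL-Computational_Algebra.Fraction_Field"
    "Jordan_Normal_Form.Determinant"
begin

text \<open>
  The polynomial ring with one indeterminate for each element of \<open>'v\<close>. An exponent vector
  (monomial) is an element of \<open>'v \<Rightarrow>\<^sub>0 nat\<close>; multiplication of monomials is addition of
  exponent vectors. The instance of \<open>idom\<close> for this type wants a linear order on \<open>'v\<close>, which is
  the only purpose of the lexicographic order on pairs.
\<close>

type_synonym ('v, 'k) mpoly = "('v \<Rightarrow>\<^sub>0 nat) \<Rightarrow>\<^sub>0 'k"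

definition var :: "'v \<Rightarrow> ('v, 'k::comm_ring_1) mpoly" where
  "var v = Poly_Mapping.single (Poly_Mapping.single v 1) 1"

text \<open>The convention for the zero polynomial, degree \<open>0\<close>, plays no role for minors of a
  generic matrix.\<close>

definition total_degree :: "('v, 'k::zero) mpoly \<Rightarrow> nat" where
  "total_degree p =
     Max (insert 0 ((\<lambda>t. \<Sum>v\<in>Poly_Mapping.keys t. Poly_Mapping.lookup t v) ` Poly_Mapping.keys p))"

definition poly_subst ::
    "('v \<Rightarrow> ('w, 'k) mpoly) \<Rightarrow> ('v, 'k::comm_ring_1) mpoly \<Rightarrow> ('w, 'k) mpoly" where
  "poly_subst \<sigma> p =
     (\<Sum>t\<in>Poly_Mapping.keys p. Poly_Mapping.single 0 (Poly_Mapping.lookup p t) *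
        (\<Prod>v\<in>Poly_Mapping.keys t. \<sigma> v ^ Poly_Mapping.lookup t v))"

definition rename_vars :: "('v \<Rightarrow> 'w) \<Rightarrow> ('v, 'k::comm_ring_1) mpoly \<Rightarrow> ('w, 'k) mpoly" where
  "rename_vars h = poly_subst (\<lambda>v. var (h v))"


section \<open>Ideals of a commutative ring\<close>

text \<open>A commutative ring is a module over itself: ideals are the submodules
  \<open>ring_module.subspace\<close>, and \<open>ring_module.span B\<close> is the ideal generated by \<open>B\<close>.\<close>

global_interpretation ring_module: Modules.module "(*) :: 'a::comm_ring_1 \<Rightarrow> 'a \<Rightarrow> 'a"
  by unfold_locales (simp_all add: algebra_simps)

abbreviation is_ideal :: "'a::comm_ring_1 set \<Rightarrow> bool" where
  "is_ideal \<equiv> ring_module.subspace"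

abbreviation ideal_gen :: "'a::comm_ring_1 set \<Rightarrow> 'a set" where
  "ideal_gen \<equiv> ring_module.span"

definition is_prime_ideal :: "'a::comm_ring_1 set \<Rightarrow> bool" where
  "is_prime_ideal P \<longleftrightarrow>
     is_ideal P \<and> P \<noteq> UNIV \<and> (\<forall>a b. a * b \<in> P \<longrightarrow> a \<in> P \<or> b \<in> P)"

definition minimal_primes :: "'a::comm_ring_1 set \<Rightarrow> 'a set set" where
  "minimal_primes I =
     {P. is_prime_ideal P \<and> I \<subseteq> P \<and> (\<forall>Q. is_prime_ideal Q \<and> I \<subseteq> Q \<and> Q \<subseteq> P \<longrightarrow> Q = P)}"

definition ideal_power :: "'a::comm_ring_1 set \<Rightarrow> nat \<Rightarrow> 'a set" where
  "ideal_power I s = ideal_gen {(\<Prod>i<s. f i) | f. \<forall>i<s. f i \<in> I}"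

text \<open>
  The localization of a domain at the complement of the minimal primes of a proper ideal is
  formed inside the fraction field, into which the domain is embedded by \<open>\<lambda>f. Fract f 1\<close>.
\<close>

definition symbolic_power :: "'a::idom set \<Rightarrow> nat \<Rightarrow> 'a set" where
  "symbolic_power I s =
     {f. Fract f 1 \<in> {Fract a u | a u. a \<in> ideal_power I s \<and> u \<in> - \<Union>(minimal_primes I)}}"


section \<open>Joins and secant ideals\<close>

text \<open>The variables \<open>x\<^sub>a\<close>, \<open>y\<^sub>a\<close>, \<open>z\<^sub>a\<close> of the ring in which the join is an elimination ideal.\<close>

datatype 'v jvar = XV 'v | YV 'v | ZV 'v

definition join_ideal ::
    "('v, 'k::comm_ring_1) mpoly set \<Rightarrow> ('v, 'k) mpoly set \<Rightarrow> ('v, 'k) mpoly set" where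
  "join_ideal I J =
     {p. rename_vars XV p \<in> ideal_gen
           (rename_vars YV ` I \<union> rename_vars ZV ` J \<union>
            {var (XV a) - var (YV a) - var (ZV a) | a. True})}"

text \<open>The \<open>r\<close>-fold join of \<open>I\<close>, which is meaningful for \<open>r \<ge> 1\<close> only.\<close>

definition secant_ideal :: "('v, 'k::comm_ring_1) mpoly set \<Rightarrow> nat \<Rightarrow> ('v, 'k) mpoly set" where
  "secant_ideal I r = (join_ideal I ^^ (r - 1)) I"


section \<open>Term orders and Groebner bases\<close>

text \<open>\<open>(t, u) \<in> ord\<close> means that \<open>t\<close> is at most \<open>u\<close>.\<close>

definition term_order :: "('v \<Rightarrow>\<^sub>0 nat) rel \<Rightarrow> bool" where
  "term_order ord \<longleftrightarrow>
     linear_order ord \<and> (\<forall>t. (0, t) \<in> ord) \<and>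
     (\<forall>t u w. (t, u) \<in> ord \<longrightarrow> (t + w, u + w) \<in> ord)"

definition leading_monomial ::
    "('v \<Rightarrow>\<^sub>0 nat) rel \<Rightarrow> ('v, 'k::zero) mpoly \<Rightarrow> ('v \<Rightarrow>\<^sub>0 nat)" where
  "leading_monomial ord p =
     (THE t. t \<in> Poly_Mapping.keys p \<and> (\<forall>u\<in>Poly_Mapping.keys p. (u, t) \<in> ord))"

definition initial_ideal ::
    "('v \<Rightarrow>\<^sub>0 nat) rel \<Rightarrow> ('v, 'k::comm_ring_1) mpoly set \<Rightarrow> ('v, 'k) mpoly set" where
  "initial_ideal ord F = ideal_gen {Poly_Mapping.single (leading_monomial ord f) 1 | f. f \<in> F \<and> f \<noteq> 0}"

definition is_groebner_basis ::
    "('v \<Rightarrow>\<^sub>0 nat) rel \<Rightarrow> ('v, 'k::comm_ring_1) mpoly set \<Rightarrow> ('v, 'k) mpoly set \<Rightarrow> bool" where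
  "is_groebner_basis ord G I \<longleftrightarrow>
     finite G \<and> G \<subseteq> I \<and> initial_ideal ord G = initial_ideal ord I"


section \<open>Minors\<close>

text \<open>
  The rows and columns of a matrix are indexed by linearly ordered types. The \<open>t \<times> t\<close>
  submatrices are given by increasing sequences of \<open>t\<close> row indices and of \<open>t\<close> column indices.
\<close>

definition minor ::
    "('m \<Rightarrow> 'n \<Rightarrow> 'a::comm_ring_1) \<Rightarrow> nat \<Rightarrow> (nat \<Rightarrow> 'm) \<Rightarrow> (nat \<Rightarrow> 'n) \<Rightarrow> 'a" where
  "minor X t a b = det (mat t t (\<lambda>(i, j). X (a i) (b j)))"

definition minors ::
    "nat \<Rightarrow> ('m::linorder \<Rightarrow> 'n::linorder \<Rightarrow> 'a::comm_ring_1) \<Rightarrow> 'a set" where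
  "minors t X = {minor X t a b | a b. strict_mono_on {..<t} a \<and> strict_mono_on {..<t} b}"

text \<open>The set \<open>\<M>\<^sub>r(X)\<close>.\<close>

definition minors_from ::
    "nat \<Rightarrow> ('m::linorder \<Rightarrow> 'n::linorder \<Rightarrow> 'a::comm_ring_1) \<Rightarrow> 'a set" where
  "minors_from r X = (\<Union>t\<in>{r..}. minors t X)"

definition generic_matrix :: "'m \<Rightarrow> 'n \<Rightarrow> ('m \<times> 'n, 'k::comm_ring_1) mpoly" where
  "generic_matrix i j = var (i, j)"

text \<open>For \<open>X\<close> the generic matrix; the sum of exponent vectors is the product of the main diagonal
  entries of the submatrix.\<close>

definition diagonal_term_order ::
    "('m::linorder \<Rightarrow> 'n::linorder \<Rightarrow> ('m \<times> 'n, 'k::comm_ring_1) mpoly) \<Rightarrow>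
     ('m \<times> 'n \<Rightarrow>\<^sub>0 nat) rel \<Rightarrow> bool" where
  "diagonal_term_order X ord \<longleftrightarrow>
     term_order ord \<and>
     (\<forall>t a b. strict_mono_on {..<t} a \<and> strict_mono_on {..<t} b \<longrightarrow>
        leading_monomial ord (minor X t a b) = (\<Sum>i<t. Poly_Mapping.single (a i, b i) 1))"

definition minor_products ::
    "nat \<Rightarrow> nat \<Rightarrow> ('m::linorder \<Rightarrow> 'n::linorder \<Rightarrow> ('v, 'k::comm_ring_1) mpoly) \<Rightarrow>
     ('v, 'k) mpoly set" where
  "minor_products r s X =
     {(\<Prod>i<l. f i) | (l::nat) f. l \<ge> 1 \<and> (\<forall>i<l. f i \<in> minors_from (r + 1) X) \<and>
        (\<Sum>i<l. int (total_degree (f i)) - int r) = int s}"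

end

(* Let phi_r(f) be the value of f at the matrix U V + eps Z, where U V is the generic matrix of rank
r. The polynomials f such that eps^s divides phi_r(f) form an ideal V(r,s), and V(r,1) is prime,
being the ideal of the matrices of rank at most r. Products of minors lie in V(r,s). Conversely,
sets F_1, ..., F_r of cells without chains single out a monomial of phi_r(f) that only comes from
the leading monomial t of f in a diagonal term order (among all tables with given margins, the
one supported on a set without chains is least). Hence t has degree at least s outside of the
union of the F_k, and the Greene-Kleitman theorem turns this into chains of cells inside t, that
is, into a product of minors whose leading monomial divides t. So the products of minors are a
Groebner basis of V(r,s).

The symbolic power of the prime ideal V(r,1) is V(r,s): phi_r detects the order of vanishing, and
by Sylvester's identity, a power of an r x r minor, which is not in V(r,1), multiplies every
(r+k) x (r+k) minor into the k-th power of V(r,1). The join of V(1,1) and V(k,1) is V(k+1,1): in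
p(y + z), expanded in monomials in y modulo V(1,1), the coefficients belong to V(k,1). *)
theory Submission
  imports Defs
    "HOL-Library.Option_ord"
    "HOL-Combinatorics.Cycles"
    "HOL-Library.FuncSet"
begin

section \<open>Chains and antichains: a Greene-Kleitman duality\<close>

fun path_gain :: "('a \<Rightarrow> 'a \<Rightarrow> int) \<Rightarrow> 'a list \<Rightarrow> int" where
  "path_gain g (x # y # zs) = g x y + path_gain g (y # zs)"
| "path_gain g _ = 0"

lemma path_gain_append: "path_gain g (as @ y # bs) = path_gain g (as @ [y]) + path_gain g (y # bs)"
proof (induction as)
  case (Cons a as)
  then show ?case by (cases as) auto
qed simp

lemma path_gain_snoc: "xs \<noteq> [] \<Longrightarrow> path_gain g (xs @ [y]) = path_gain g xs + g (last xs) y"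
proof (induction xs)
  case (Cons a as)
  then show ?case by (cases as) auto
qed simp

lemma path_gain_conv_zip: "path_gain g (x # xs) = sum_list (map2 g (x # xs) xs)"
  by (induction xs arbitrary: x) auto

lemma path_gain_closed:
  assumes "distinct (x # xs)"
  shows "path_gain g (x # xs @ [x]) = (\<Sum>y\<in>set (x # xs). g y (cycle_of_list (x # xs) y))"
proof -
  let ?c = "x # xs"
  have rot: "map (cycle_of_list ?c) ?c = rotate1 ?c"
    using cyclic_rotation[of ?c 1] assms by (simp add: rotate_def)
  have z: "zip ?c (xs @ [x]) = zip (?c @ [x]) (xs @ [x])"
    using zip_append1[of ?c "[x]" "xs @ [x]"] by simp
  have "(\<Sum>y\<in>set ?c. g y (cycle_of_list ?c y)) = sum_list (map (\<lambda>y. g y (cycle_of_list ?c y)) ?c)"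
    using assms by (rule sum_list_distinct_conv_sum_set[symmetric])
  also have "map (\<lambda>y. g y (cycle_of_list ?c y)) ?c = map2 g ?c (map (cycle_of_list ?c) ?c)"
    by (simp only: zip_map2 zip_same_conv_map map_map o_def prod.case)
  also have "\<dots> = map2 g (?c @ [x]) (xs @ [x])"
    by (simp only: rot rotate1.simps z)
  also have "sum_list \<dots> = path_gain g (x # xs @ [x])"
    by (simp only: path_gain_conv_zip append_Cons)
  finally show ?thesis by simp
qed

lemma optimal_cycle_gain:
  fixes w :: "'a \<Rightarrow> 'a \<Rightarrow> int"
  assumes fin: "finite N" and perm: "\<sigma> permutes N"
    and opt: "\<And>\<tau>. \<tau> permutes N \<Longrightarrow> (\<Sum>x\<in>N. w x (\<tau> x)) \<le> (\<Sum>x\<in>N. w x (\<sigma> x))"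
    and dist: "distinct (y # ys)" and sub: "set (y # ys) \<subseteq> N"
  shows "path_gain (\<lambda>a b. w a (\<sigma> b) - w a (\<sigma> a)) (y # ys @ [y]) \<le> 0"
proof -
  let ?c = "y # ys"
  let ?p = "cycle_of_list ?c"
  have p: "?p permutes set ?c" using dist by (intro cycle_permutes)
  have "?p permutes N" using p sub by (rule permutes_subset)
  then have "\<sigma> \<circ> ?p permutes N" using perm by (rule permutes_compose)
  from opt[OF this] have "(\<Sum>x\<in>N. w x (\<sigma> (?p x)) - w x (\<sigma> x)) \<le> 0"
    by (simp add: sum_subtractf)
  also have "(\<Sum>x\<in>N. w x (\<sigma> (?p x)) - w x (\<sigma> x)) = (\<Sum>x\<in>set ?c. w x (\<sigma> (?p x)) - w x (\<sigma> x))"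
    using fin sub by (intro sum.mono_neutral_right) (auto simp: permutes_not_in[OF p])
  also have "\<dots> = path_gain (\<lambda>a b. w a (\<sigma> b) - w a (\<sigma> a)) (y # ys @ [y])"
    by (rule path_gain_closed[OF dist, symmetric])
  finally show ?thesis .
qed

text \<open>The dual variables are the potentials of the exchange graph of an optimal permutation, which
  has no cycle of positive gain.\<close>

lemma assignment_duality:
  fixes w :: "'a \<Rightarrow> 'a \<Rightarrow> int"
  assumes fin: "finite N"
  obtains \<sigma> \<alpha> \<beta> where "\<sigma> permutes N" "\<And>x y. x \<in> N \<Longrightarrow> y \<in> N \<Longrightarrow> w x y \<le> \<alpha> x + \<beta> y"
    "\<And>x. x \<in> N \<Longrightarrow> w x (\<sigma> x) = \<alpha> x + \<beta> (\<sigma> x)"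
proof -
  let ?W = "\<lambda>\<tau>. \<Sum>x\<in>N. w x (\<tau> x)"
  have "finite {\<tau>. \<tau> permutes N}" using fin by (rule finite_permutations)
  moreover have "id \<in> {\<tau>. \<tau> permutes N}" by (simp add: permutes_id)
  ultimately obtain \<sigma> where "is_arg_min (\<lambda>\<tau>. - ?W \<tau>) (\<lambda>\<tau>. \<tau> \<in> {\<tau>. \<tau> permutes N}) \<sigma>"
    using ex_is_arg_min_if_finite[of "{\<tau>. \<tau> permutes N}" "\<lambda>\<tau>. - ?W \<tau>"] by blast
  then have perm: "\<sigma> permutes N" and opt: "\<And>\<tau>. \<tau> permutes N \<Longrightarrow> ?W \<tau> \<le> ?W \<sigma>"
    by (auto simp: is_arg_min_def not_less)
  define g where "g = (\<lambda>a b. w a (\<sigma> b) - w a (\<sigma> a))"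
  define L where "L y = {xs. distinct xs \<and> set xs \<subseteq> N \<and> xs \<noteq> [] \<and> last xs = y}" for y
  define pot where "pot y = Max (path_gain g ` L y)" for y
  have finL: "finite (L y)" for y
  proof (rule finite_subset)
    show "L y \<subseteq> {xs. set xs \<subseteq> N \<and> length xs \<le> card N}"
      unfolding L_def using fin by (auto simp: distinct_card[symmetric] intro: card_mono)
    show "finite {xs. set xs \<subseteq> N \<and> length xs \<le> card N}"
      using fin by (rule finite_lists_length_le)
  qed
  have le_pot: "path_gain g xs \<le> pot y" if "xs \<in> L y" for xs y
    unfolding pot_def using finL that by (intro Max_ge) auto
  have step: "pot x + g x y \<le> pot y" if x: "x \<in> N" and y: "y \<in> N" for x y
  proof -
    have "[x] \<in> L x" using x by (simp add: L_def)
    then have "pot x \<in> path_gain g ` L x"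
      unfolding pot_def using finL by (intro Max_in) auto
    then obtain xs where xs: "xs \<in> L x" and px: "pot x = path_gain g xs" by auto
    then have nonempty: "xs \<noteq> []" and lst: "last xs = x" and dist: "distinct xs" and sub: "set xs \<subseteq> N"
      by (auto simp: L_def)
    have ext: "pot x + g x y = path_gain g (xs @ [y])"
      using path_gain_snoc[OF nonempty, of g y] lst px by simp
    show ?thesis
    proof (cases "y \<in> set xs")
      case False
      then have "xs @ [y] \<in> L y" using dist sub y by (auto simp: L_def)
      then show ?thesis using le_pot ext by simp
    next
      case True
      then obtain as bs where split: "xs = as @ y # bs" by (meson split_list)
      have "as @ [y] \<in> L y" using dist sub y by (auto simp: L_def split)
      then have "path_gain g (as @ [y]) \<le> pot y" by (rule le_pot)
      moreover have "path_gain g (y # bs @ [y]) \<le> 0"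
        unfolding g_def using fin perm opt
        by (rule optimal_cycle_gain) (use dist sub in \<open>auto simp: split\<close>)
      moreover have "path_gain g (xs @ [y]) = path_gain g (as @ [y]) + path_gain g (y # bs @ [y])"
        using path_gain_append[of g as y "bs @ [y]"] by (simp add: split)
      ultimately show ?thesis using ext by simp
    qed
  qed
  define \<alpha> where "\<alpha> x = w x (\<sigma> x) - pot x" for x
  define \<beta> where "\<beta> y = pot (inv_into UNIV \<sigma> y)" for y
  show thesis
  proof (rule that[of \<sigma> \<alpha> \<beta>])
    show "\<sigma> permutes N" by fact
    show "w x (\<sigma> x) = \<alpha> x + \<beta> (\<sigma> x)" for x
      by (simp add: \<alpha>_def \<beta>_def permutes_inverses(2)[OF perm])
    show "w x y \<le> \<alpha> x + \<beta> y" if "x \<in> N" "y \<in> N" for x y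
    proof -
      have "inv_into UNIV \<sigma> y \<in> N" using permutes_in_image[OF permutes_inv[OF perm]] that by simp
      from step[OF that(1) this] show ?thesis
        by (simp add: \<alpha>_def \<beta>_def g_def permutes_inverses(1)[OF perm])
    qed
  qed
qed

lemma chain_decomposition:
  fixes f :: "'p \<Rightarrow> 'p option" and R :: "'p \<Rightarrow> 'p \<Rightarrow> bool"
  assumes "finite S" and "transp R" "irreflp R"
    and "\<And>p q. p \<in> S \<Longrightarrow> f p = Some q \<Longrightarrow> q \<in> S \<and> R p q"
    and "\<And>p p' q. p \<in> S \<Longrightarrow> p' \<in> S \<Longrightarrow> f p = Some q \<Longrightarrow> f p' = Some q \<Longrightarrow> p = p'"
  shows "\<exists>cs. distinct (concat cs) \<and> set (concat cs) = S \<and>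
    (\<forall>c\<in>set cs. c \<noteq> [] \<and> successively (\<lambda>x y. f x = Some y) c) \<and> length cs = card {p\<in>S. f p = None}"
  using assms(1,4,5)
proof (induction "card S" arbitrary: S)
  case 0
  then show ?case by (intro exI[of _ "[]"]) auto
next
  case (Suc n)
  have as: "asymp_on S R"
    using assms(2,3) unfolding transp_def irreflp_def by (intro asymp_onI) blast
  have tr: "transp_on S R" using assms(2) by (rule transp_on_subset) simp
  have ne: "S \<noteq> {}" using Suc.hyps(2) by auto
  obtain m where m: "m \<in> S" and min: "\<And>x. x \<in> S \<Longrightarrow> x \<noteq> m \<Longrightarrow> \<not> R x m"
    using Finite_Set.bex_min_element[OF Suc.prems(1) as tr ne] by blast
  have "\<not> R m m" using assms(3) by (rule irreflpD)
  with min have min': "\<And>x. x \<in> S \<Longrightarrow> \<not> R x m" by blast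
  let ?S = "S - {m}"
  have nom: "f p \<noteq> Some m" if "p \<in> S" for p using Suc.prems(2)[OF that] min'[OF that] by blast
  have "\<exists>cs. distinct (concat cs) \<and> set (concat cs) = ?S \<and>
    (\<forall>c\<in>set cs. c \<noteq> [] \<and> successively (\<lambda>x y. f x = Some y) c) \<and> length cs = card {p\<in>?S. f p = None}"
  proof (rule Suc.hyps(1))
    show "n = card ?S" using Suc.hyps(2) m Suc.prems(1) by simp
    show "finite ?S" using Suc.prems(1) by simp
    show "q \<in> ?S \<and> R p q" if "p \<in> ?S" "f p = Some q" for p q
      using Suc.prems(2)[of p q] nom[of p] that by auto
    show "p = p'" if "p \<in> ?S" "p' \<in> ?S" "f p = Some q" "f p' = Some q" for p p' q
      using Suc.prems(3)[of p p' q] that by auto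
  qed
  then obtain cs where cs: "distinct (concat cs)" "set (concat cs) = ?S"
    "\<And>c. c\<in>set cs \<Longrightarrow> c \<noteq> [] \<and> successively (\<lambda>x y. f x = Some y) c" "length cs = card {p\<in>?S. f p = None}"
    by blast
  show ?case
  proof (cases "f m")
    case None
    then have "{p\<in>S. f p = None} = insert m {p\<in>?S. f p = None}" using m by auto
    then have "card {p\<in>S. f p = None} = Suc (card {p\<in>?S. f p = None})" using Suc.prems(1) by simp
    then show ?thesis using cs m
      by (intro exI[of _ "[m] # cs"]) auto
  next
    case (Some q)
    then have q: "q \<in> ?S" using Suc.prems(2)[OF m] nom[OF m] by auto
    then obtain c where c: "c \<in> set cs" "q \<in> set c" using cs(2) by auto
    have sc: "successively (\<lambda>x y. f x = Some y) c" using cs(3) c by blast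
    obtain us vs where c_eq: "c = us @ q # vs" using c(2) by (meson split_list)
    have "us = []"
    proof (rule ccontr)
      assume "us \<noteq> []"
      then have "f (last us) = Some q" using sc by (simp add: c_eq successively_append_iff)
      moreover have "last us \<in> set c" using \<open>us \<noteq> []\<close> by (simp add: c_eq)
      moreover have "set c \<subseteq> set (concat cs)" using c(1) by (metis UN_upper set_concat)
      ultimately show False using Suc.prems(3)[of "last us" m q] Some m cs(2) by blast
    qed
    then have hd: "c = q # vs" using c_eq by simp
    obtain A B where AB: "cs = A @ c # B" using c(1) by (meson split_list)
    have card: "{p\<in>S. f p = None} = {p\<in>?S. f p = None}" using Some by auto
    have s1: "distinct (concat (A @ (m # c) # B))" using cs(1,2) by (auto simp: AB)
    have s2: "set (concat (A @ (m # c) # B)) = S" using cs(2) m by (auto simp: AB)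
    have s3: "c' \<noteq> [] \<and> successively (\<lambda>x y. f x = Some y) c'" if "c' \<in> set (A @ (m # c) # B)" for c'
      using cs(3)[of c'] that sc Some by (auto simp: AB hd)
    have s4: "length (A @ (m # c) # B) = card {p\<in>S. f p = None}" using cs(4) by (simp add: AB card)
    show ?thesis using s1 s2 s3 s4 by blast
  qed
qed


text \<open>The nodes \<open>Inr d\<close> of the assignment problem close the chains up to cycles: a chain of
  length \<open>l\<close>, entered from one of them at cost \<open>r\<close>, contributes \<open>l - r\<close>.\<close>

lemma greene_kleitman:
  fixes P :: "'p set" and R :: "'p \<Rightarrow> 'p \<Rightarrow> bool" and r :: nat
  assumes fin: "finite P" and tr: "transp R" and irr: "irreflp R"
  obtains lev :: "'p \<Rightarrow> nat" and cs :: "'p list list" where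
    "\<And>p. lev p \<le> r"
    "\<And>p q. p \<in> P \<Longrightarrow> q \<in> P \<Longrightarrow> R p q \<Longrightarrow> lev p = lev q \<Longrightarrow> lev p = r"
    "distinct (concat cs)" "set (concat cs) \<subseteq> P" "\<And>c. c \<in> set cs \<Longrightarrow> sorted_wrt R c"
    "int (card {p\<in>P. lev p = r}) \<le> (\<Sum>c\<leftarrow>cs. int (length c) - int r)"
proof -
  define D :: "nat set" where "D = {..card P}"
  define N where "N = Inl ` P \<union> Inr ` D"
  define w :: "'p + nat \<Rightarrow> 'p + nat \<Rightarrow> int" where
    "w x y = (case x of
       Inl p \<Rightarrow> (case y of Inl q \<Rightarrow> if p = q then 0 else if R p q then 1 else - int (card P) - 1 | Inr _ \<Rightarrow> 1)
     | Inr _ \<Rightarrow> (case y of Inl q \<Rightarrow> - int r | Inr _ \<Rightarrow> 0))" for x y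
  have finD: "finite D" and D0: "0 \<in> D" by (auto simp: D_def)
  have finN: "finite N" using fin finD by (simp add: N_def)
  obtain \<sigma> \<alpha>0 \<beta>0 where perm: "\<sigma> permutes N"
    and feas0: "\<And>x y. x \<in> N \<Longrightarrow> y \<in> N \<Longrightarrow> w x y \<le> \<alpha>0 x + \<beta>0 y"
    and tight0: "\<And>x. x \<in> N \<Longrightarrow> w x (\<sigma> x) = \<alpha>0 x + \<beta>0 (\<sigma> x)"
    using assignment_duality[OF finN, of w] by blast
  have \<sigma>N: "\<sigma> x \<in> N" if "x \<in> N" for x using permutes_in_image[OF perm] that by simp
  have sumN: "sum h N = (\<Sum>p\<in>P. h (Inl p)) + (\<Sum>d\<in>D. h (Inr d))" for h :: "'p + nat \<Rightarrow> int"
    unfolding N_def using fin finD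
    by (subst sum.union_disjoint) (auto simp: sum.reindex inj_on_def)
  have row: "\<alpha>0 (Inr d) \<le> \<alpha>0 (Inr e)" if "d \<in> D" "e \<in> D" for d e
  proof -
    have "w (Inr e) (\<sigma> (Inr d)) \<le> \<alpha>0 (Inr e) + \<beta>0 (\<sigma> (Inr d))"
      using that by (intro feas0 \<sigma>N) (auto simp: N_def)
    moreover have "w (Inr d) (\<sigma> (Inr d)) = \<alpha>0 (Inr d) + \<beta>0 (\<sigma> (Inr d))"
      using that by (intro tight0) (auto simp: N_def)
    moreover have "w (Inr e) z = w (Inr d) z" for z by (simp add: w_def)
    ultimately show ?thesis by simp
  qed
  have col: "\<beta>0 (Inr d) \<le> \<beta>0 (Inr e)" if "d \<in> D" "e \<in> D" for d e
  proof -
    have "Inr d \<in> \<sigma> ` N" using permutes_image[OF perm] that by (auto simp: N_def)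
    then obtain x where x: "x \<in> N" "\<sigma> x = Inr d" by (metis imageE)
    have "w x (Inr e) \<le> \<alpha>0 x + \<beta>0 (Inr e)"
      using that x by (intro feas0) (auto simp: N_def)
    moreover have "w x (Inr d) = \<alpha>0 x + \<beta>0 (Inr d)" using tight0[OF x(1)] x(2) by simp
    moreover have "w x (Inr e) = w x (Inr d)" by (simp add: w_def split: sum.splits)
    ultimately show ?thesis by simp
  qed
  have "\<exists>d\<in>D. \<exists>e\<in>D. \<sigma> (Inr d) = Inr e"
  proof (rule ccontr)
    assume a: "\<not> ?thesis"
    have "\<sigma> ` Inr ` D \<subseteq> Inl ` P"
    proof
      fix y assume "y \<in> \<sigma> ` Inr ` D"
      then obtain d where d: "d \<in> D" "y = \<sigma> (Inr d)" by auto
      then have "y \<in> N" using \<sigma>N by (auto simp: N_def)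
      then show "y \<in> Inl ` P" using a d by (auto simp: N_def)
    qed
    then have "card (\<sigma> ` Inr ` D) \<le> card (Inl ` P :: ('p + nat) set)" using fin by (intro card_mono) auto
    moreover have "card (\<sigma> ` Inr ` D) = card D"
      by (subst image_image, rule card_image) (auto intro!: inj_onI dest: injD[OF permutes_inj[OF perm]])
    moreover have "card (Inl ` P :: ('p + nat) set) = card P" by (rule card_image) simp
    ultimately show False by (simp add: D_def)
  qed
  then obtain d0 e0 where de: "d0 \<in> D" "e0 \<in> D" "\<sigma> (Inr d0) = Inr e0" by blast
  have "\<alpha>0 (Inr d0) + \<beta>0 (Inr e0) = 0"
    using tight0[of "Inr d0"] de by (simp add: N_def w_def)
  then have ab: "\<alpha>0 (Inr d) + \<beta>0 (Inr e) = 0" if "d \<in> D" "e \<in> D" for d e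
    using row[OF that(1) de(1)] row[OF de(1) that(1)] col[OF that(2) de(2)] col[OF de(2) that(2)] by simp
  define \<alpha> where "\<alpha> p = \<alpha>0 (Inl p) - \<alpha>0 (Inr 0)" for p
  define \<beta> where "\<beta> p = \<beta>0 (Inl p) + \<alpha>0 (Inr 0)" for p
  have f1: "1 \<le> \<alpha> p" if "p \<in> P" for p
    using feas0[of "Inl p" "Inr 0"] ab[OF D0 D0] that D0 by (simp add: w_def N_def \<alpha>_def)
  have f2: "- int r \<le> \<beta> p" if "p \<in> P" for p
    using feas0[of "Inr 0" "Inl p"] that D0 by (simp add: w_def N_def \<beta>_def)
  have f3: "1 \<le> \<alpha> p + \<beta> q" if "p \<in> P" "q \<in> P" "R p q" for p q
    using feas0[of "Inl p" "Inl q"] that irr by (auto simp: w_def N_def \<alpha>_def \<beta>_def irreflp_def split: if_splits)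
  have f4: "0 \<le> \<alpha> p + \<beta> p" if "p \<in> P" for p
    using feas0[of "Inl p" "Inl p"] that by (simp add: w_def N_def \<alpha>_def \<beta>_def)
  let ?T = "\<Sum>x\<in>N. w x (\<sigma> x)"
  have total: "?T = (\<Sum>p\<in>P. \<alpha> p + \<beta> p)"
  proof -
    have "?T = (\<Sum>x\<in>N. \<alpha>0 x) + (\<Sum>x\<in>N. \<beta>0 (\<sigma> x))" by (simp add: tight0 sum.distrib)
    also have "(\<Sum>x\<in>N. \<beta>0 (\<sigma> x)) = (\<Sum>x\<in>N. \<beta>0 x)"
      using sum.permute[OF perm, of \<beta>0] by (simp add: o_def)
    also have "(\<Sum>x\<in>N. \<alpha>0 x) + (\<Sum>x\<in>N. \<beta>0 x) =
        (\<Sum>p\<in>P. \<alpha>0 (Inl p) + \<beta>0 (Inl p)) + (\<Sum>d\<in>D. \<alpha>0 (Inr d) + \<beta>0 (Inr d))"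
      by (simp add: sumN sum.distrib)
    also have "(\<Sum>d\<in>D. \<alpha>0 (Inr d) + \<beta>0 (Inr d)) = 0" by (rule sum.neutral) (simp add: ab)
    finally show ?thesis by (simp add: \<alpha>_def \<beta>_def)
  qed
  have nonneg: "0 \<le> ?T" unfolding total by (intro sum_nonneg f4)
  have edge: "R p q" if "p \<in> P" "q \<in> P" "\<sigma> (Inl p) = Inl q" "p \<noteq> q" for p q
  proof (rule ccontr)
    assume a: "\<not> R p q"
    have "(\<Sum>p'\<in>P - {p}. w (Inl p') (\<sigma> (Inl p'))) \<le> (\<Sum>p'\<in>P - {p}. 1)"
      by (intro sum_mono) (auto simp: w_def split: sum.splits)
    also have "\<dots> \<le> int (card P)" using fin by simp (meson card_Diff1_le of_nat_mono)
    finally have "(\<Sum>p'\<in>P. w (Inl p') (\<sigma> (Inl p'))) \<le> -1"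
      using a that sum.remove[OF fin that(1), of "\<lambda>p'. w (Inl p') (\<sigma> (Inl p'))"] by (simp add: w_def)
    moreover have "(\<Sum>d\<in>D. w (Inr d) (\<sigma> (Inr d))) \<le> 0"
      by (intro sum_nonpos) (auto simp: w_def split: sum.splits)
    ultimately show False using nonneg by (simp add: sumN)
  qed
  define S where "S = {p\<in>P. \<sigma> (Inl p) \<noteq> Inl p}"
  define f where "f p = (case \<sigma> (Inl p) of Inl q \<Rightarrow> Some q | Inr _ \<Rightarrow> None)" for p
  have \<sigma>inj: "x = y" if "\<sigma> x = \<sigma> y" for x y using permutes_inj[OF perm] that by (auto dest: injD)
  have fS: "q \<in> S \<and> R p q" if p: "p \<in> S" and fp: "f p = Some q" for p q
  proof -
    have \<sigma>p: "\<sigma> (Inl p) = Inl q" using fp by (auto simp: f_def split: sum.splits)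
    have "Inl q \<in> N" using \<sigma>N[of "Inl p"] p \<sigma>p by (auto simp: N_def S_def)
    then have q: "q \<in> P" by (auto simp: N_def)
    have "p \<noteq> q" using p \<sigma>p by (auto simp: S_def)
    then have "\<sigma> (Inl q) \<noteq> Inl q" using \<sigma>p \<sigma>inj by (metis sum.inject(1))
    then show ?thesis using q edge[of p q] p \<sigma>p \<open>p \<noteq> q\<close> by (auto simp: S_def)
  qed
  have finj: "p = p'" if "f p = Some q" "f p' = Some q" for p p' q
  proof -
    have "\<sigma> (Inl p) = \<sigma> (Inl p')" using that by (auto simp: f_def split: sum.splits)
    then show ?thesis using \<sigma>inj by blast
  qed
  have finS: "finite S" using fin by (simp add: S_def)
  obtain cs where cs: "distinct (concat cs)" "set (concat cs) = S"
    and suc: "\<And>c. c\<in>set cs \<Longrightarrow> c \<noteq> [] \<and> successively (\<lambda>x y. f x = Some y) c"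
    and len: "length cs = card {p\<in>S. f p = None}"
    using chain_decomposition[OF finS tr irr, of f] fS finj by blast
  have sorted: "sorted_wrt R c" if c: "c \<in> set cs" for c
  proof -
    have "set c \<subseteq> S" using c cs(2) by auto
    then have "successively R c"
      using successively_mono[of "\<lambda>x y. f x = Some y" c R] suc[OF c] fS by blast
    then show ?thesis using tr by (simp add: successively_conv_sorted_wrt)
  qed
  let ?A = "{p\<in>P. \<sigma> (Inl p) \<in> range Inr}" and ?B = "{d\<in>D. \<sigma> (Inr d) \<in> range Inl}"
  have cardAB: "card ?A = card ?B"
  proof -
    have "\<sigma> ` Inl ` P = Inl ` P - \<sigma> ` Inr ` ?B \<union> \<sigma> ` Inl ` ?A" (is "?L = ?U")
    proof (rule subset_antisym; rule subsetI)
      fix y assume "y \<in> ?L"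
      then obtain p where p: "p \<in> P" "y = \<sigma> (Inl p)" by auto
      have "y \<in> N" using p \<sigma>N by (auto simp: N_def)
      moreover have "y \<notin> \<sigma> ` Inr ` ?B" using p \<sigma>inj by auto
      ultimately show "y \<in> ?U" using p by (auto simp: N_def)
    next
      fix y assume y: "y \<in> ?U"
      show "y \<in> ?L"
      proof (cases "y \<in> \<sigma> ` Inl ` ?A")
        case False
        then have yP: "y \<in> Inl ` P" "y \<notin> \<sigma> ` Inr ` ?B" using y by auto
        then have "y \<in> N" by (auto simp: N_def)
        then obtain x where x: "x \<in> N" "y = \<sigma> x" using permutes_image[OF perm] by (metis imageE)
        show ?thesis using x yP by (fastforce simp: N_def)
      qed auto
    qed
    then have "card ?L = card (Inl ` P - \<sigma> ` Inr ` ?B) + card (\<sigma> ` Inl ` ?A)"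
      using fin by (subst card_Un_disjoint[symmetric]) auto
    moreover have "card (Inl ` P - \<sigma> ` Inr ` ?B) = card (Inl ` P :: ('p + nat) set) - card (\<sigma> ` Inr ` ?B)"
    proof (rule card_Diff_subset)
      show "finite (\<sigma> ` Inr ` ?B)" using finD by simp
      show "\<sigma> ` Inr ` ?B \<subseteq> Inl ` P"
      proof
        fix y assume "y \<in> \<sigma> ` Inr ` ?B"
        then obtain d where d: "d \<in> ?B" "y = \<sigma> (Inr d)" by auto
        then have "y \<in> N" using \<sigma>N by (auto simp: N_def)
        then show "y \<in> Inl ` P" using d by (auto simp: N_def)
      qed
    qed
    moreover have "card (\<sigma> ` Inr ` ?B) \<le> card (Inl ` P :: ('p + nat) set)"
    proof (rule card_mono)
      show "finite (Inl ` P :: ('p + nat) set)" using fin by simp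
      show "\<sigma> ` Inr ` ?B \<subseteq> Inl ` P"
      proof
        fix y assume "y \<in> \<sigma> ` Inr ` ?B"
        then obtain d where d: "d \<in> ?B" "y = \<sigma> (Inr d)" by auto
        then have "y \<in> N" using \<sigma>N by (auto simp: N_def)
        then show "y \<in> Inl ` P" using d by (auto simp: N_def)
      qed
    qed
    moreover have "card ?L = card P" "card (\<sigma> ` Inl ` ?A) = card ?A" "card (\<sigma> ` Inr ` ?B) = card ?B"
      "card (Inl ` P :: ('p + nat) set) = card P"
      by (subst image_image, intro card_image inj_onI, blast dest: \<sigma>inj)+ (simp add: card_image)
    ultimately show ?thesis by simp
  qed
  have "?T = int (card S) - int r * int (card ?B)"
  proof -
    have "(\<Sum>p\<in>P. w (Inl p) (\<sigma> (Inl p))) = (\<Sum>p\<in>P. if p \<in> S then 1 else 0)"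
    proof (rule sum.cong)
      fix p assume p: "p \<in> P"
      show "w (Inl p) (\<sigma> (Inl p)) = (if p \<in> S then 1 else 0)"
      proof (cases "\<sigma> (Inl p)")
        case (Inl q)
        then show ?thesis using fS[of p q] p by (auto simp: w_def S_def f_def)
      qed (use p in \<open>simp add: w_def S_def\<close>)
    qed simp
    also have "\<dots> = int (card S)"
      using fin by (subst sum.inter_filter[symmetric]) (auto simp: S_def)
    finally have 1: "(\<Sum>p\<in>P. w (Inl p) (\<sigma> (Inl p))) = int (card S)" .
    have "(\<Sum>d\<in>D. w (Inr d) (\<sigma> (Inr d))) = (\<Sum>d\<in>D. if \<sigma> (Inr d) \<in> range Inl then - int r else 0)"
      by (intro sum.cong) (auto simp: w_def split: sum.splits)
    also have "\<dots> = - (int r * int (card ?B))"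
      using finD by (subst sum.inter_filter[symmetric]) auto
    finally show ?thesis using 1 by (simp add: sumN)
  qed
  also have "card S = sum_list (map length cs)"
    using cs by (metis distinct_card length_concat)
  also have "card ?B = length cs"
  proof -
    have "(p \<in> S \<and> f p = None) \<longleftrightarrow> (p \<in> P \<and> \<sigma> (Inl p) \<in> range Inr)" for p
      by (cases "\<sigma> (Inl p)") (auto simp: S_def f_def)
    then have "{p\<in>S. f p = None} = ?A" by simp
    then show ?thesis using len cardAB by simp
  qed
  also have "int (sum_list (map length cs)) - int r * int (length cs) = (\<Sum>c\<leftarrow>cs. int (length c) - int r)"
    by (induction cs) (auto simp: algebra_simps)
  finally have T_cs: "?T = (\<Sum>c\<leftarrow>cs. int (length c) - int r)" .
  define lev where "lev p = (if p \<in> P \<and> \<alpha> p + \<beta> p = 0 then nat (\<alpha> p - 1) else r)" for p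
  have lev1: "int (lev p) = \<alpha> p - 1 \<and> lev p < r" if "p \<in> P" "\<alpha> p + \<beta> p = 0" for p
    using f1[OF that(1)] f2[OF that(1)] that by (simp add: lev_def)
  show thesis
  proof (rule that[of lev cs])
    show "lev p \<le> r" for p using lev1[of p] by (cases "p \<in> P \<and> \<alpha> p + \<beta> p = 0") (auto simp: lev_def)
    show "lev p = r" if pq: "p \<in> P" "q \<in> P" "R p q" "lev p = lev q" for p q
    proof (rule ccontr)
      assume "lev p \<noteq> r"
      then have z: "\<alpha> p + \<beta> p = 0" "\<alpha> q + \<beta> q = 0" using pq by (auto simp: lev_def split: if_splits)
      then have "\<alpha> p = \<alpha> q" using lev1[OF pq(1) z(1)] lev1[OF pq(2) z(2)] pq(4) by simp
      then show False using f3[OF pq(1-3)] z by simp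
    qed
    show "distinct (concat cs)" "set (concat cs) \<subseteq> P" using cs by (auto simp: S_def)
    show "sorted_wrt R c" if "c \<in> set cs" for c using sorted that .
    have "int (card {p\<in>P. lev p = r}) = (\<Sum>p\<in>P. if lev p = r then 1 else 0)"
      using fin by (subst sum.inter_filter[symmetric]) auto
    also have "\<dots> \<le> (\<Sum>p\<in>P. \<alpha> p + \<beta> p)"
    proof (rule sum_mono)
      fix p assume p: "p \<in> P"
      show "(if lev p = r then 1 else 0) \<le> \<alpha> p + \<beta> p"
        using f4[OF p] lev1[OF p] by (cases "\<alpha> p + \<beta> p = 0") auto
    qed
    finally show "int (card {p\<in>P. lev p = r}) \<le> (\<Sum>c\<leftarrow>cs. int (length c) - int r)"
      using total T_cs by simp
  qed
qed

section \<open>Evaluation homomorphisms\<close>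

definition ring_map :: "('a::comm_ring_1 \<Rightarrow> 'b::comm_ring_1) \<Rightarrow> bool" where
  "ring_map h \<longleftrightarrow> h 1 = 1 \<and> (\<forall>a b. h (a + b) = h a + h b) \<and> (\<forall>a b. h (a * b) = h a * h b)"

lemma ring_mapI:
  "h 1 = 1 \<Longrightarrow> (\<And>a b. h (a + b) = h a + h b) \<Longrightarrow> (\<And>a b. h (a * b) = h a * h b) \<Longrightarrow> ring_map h"
  by (simp add: ring_map_def)

lemma ring_map_1: "ring_map h \<Longrightarrow> h 1 = 1"
  and ring_map_add: "ring_map h \<Longrightarrow> h (a + b) = h a + h b"
  and ring_map_mult: "ring_map h \<Longrightarrow> h (a * b) = h a * h b"
  by (simp_all add: ring_map_def)

lemma ring_map_0: "ring_map h \<Longrightarrow> h 0 = 0"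
  using ring_map_add[of h 0 0] by simp

lemma ring_map_uminus: "ring_map h \<Longrightarrow> h (- a) = - h a"
  using ring_map_add[of h a "- a"] ring_map_0[of h] by (simp add: eq_neg_iff_add_eq_0 add.commute)

lemma ring_map_diff: "ring_map h \<Longrightarrow> h (a - b) = h a - h b"
  using ring_map_add[of h a "- b"] ring_map_uminus[of h b] by simp

lemma ring_map_sum: "ring_map h \<Longrightarrow> h (sum f A) = (\<Sum>x\<in>A. h (f x))"
  by (induction A rule: infinite_finite_induct) (simp_all add: ring_map_0 ring_map_add)

lemma ring_map_prod: "ring_map h \<Longrightarrow> h (prod f A) = (\<Prod>x\<in>A. h (f x))"
  by (induction A rule: infinite_finite_induct) (simp_all add: ring_map_1 ring_map_mult)

lemma ring_map_power: "ring_map h \<Longrightarrow> h (a ^ n) = h a ^ n"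
  by (induction n) (simp_all add: ring_map_1 ring_map_mult)

lemma ring_map_comp: "ring_map g \<Longrightarrow> ring_map h \<Longrightarrow> ring_map (\<lambda>x. g (h x))"
  by (simp add: ring_map_def)

lemma ring_map_signof: "ring_map h \<Longrightarrow> h (signof p) = signof p"
  by (simp add: sign_def ring_map_1 ring_map_uminus)

lemma minor_expand:
  "minor X t a b = (\<Sum>p\<in>{p. p permutes {0..<t}}. signof p * (\<Prod>i<t. X (a i) (b (p i))))"
proof -
  have "minor X t a b = (\<Sum>p\<in>{p. p permutes {0..<t}}.
      signof p * (\<Prod>i = 0..<t. mat t t (\<lambda>(i, j). X (a i) (b j)) $$ (i, p i)))"
    unfolding minor_def by (rule det_def') simp
  also have "\<dots> = (\<Sum>p\<in>{p. p permutes {0..<t}}. signof p * (\<Prod>i<t. X (a i) (b (p i))))"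
  proof (rule sum.cong)
    fix p assume p: "p \<in> {p. p permutes {0..<t}}"
    have "(\<Prod>i = 0..<t. mat t t (\<lambda>(i, j). X (a i) (b j)) $$ (i, p i)) = (\<Prod>i<t. X (a i) (b (p i)))"
    proof (rule prod.cong)
      fix i assume "i \<in> {..<t}"
      then show "mat t t (\<lambda>(i, j). X (a i) (b j)) $$ (i, p i) = X (a i) (b (p i))"
        using permutes_in_image[of p "{0..<t}" i] p by simp
    qed (simp add: atLeast0LessThan)
    then show "signof p * (\<Prod>i = 0..<t. mat t t (\<lambda>(i, j). X (a i) (b j)) $$ (i, p i)) =
      signof p * (\<Prod>i<t. X (a i) (b (p i)))" by (rule arg_cong)
  qed simp
  finally show ?thesis .
qed

lemma ring_map_minor: "ring_map h \<Longrightarrow> h (minor X t a b) = minor (\<lambda>i j. h (X i j)) t a b"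
  by (simp add: minor_expand ring_map_sum ring_map_mult ring_map_signof ring_map_prod)

lemma minor_cong:
  "(\<And>i. i < t \<Longrightarrow> a i = a' i) \<Longrightarrow> (\<And>i. i < t \<Longrightarrow> b i = b' i) \<Longrightarrow> minor X t a b = minor X t a' b'"
  unfolding minor_def by (intro arg_cong[where f = det] eq_matI) auto

lemma mpoly_keys_nonempty: "p \<noteq> 0 \<Longrightarrow> Poly_Mapping.keys p \<noteq> {}"
  using poly_mapping_eqI[of p 0] by (auto simp: in_keys_iff)

lemma poly_mapping_sum_singles:
  "p = (\<Sum>t\<in>Poly_Mapping.keys p. Poly_Mapping.single t (Poly_Mapping.lookup p t))"
  by (rule poly_mapping_eqI)
     (simp add: lookup_sum lookup_single when_def in_keys_iff sum.delta)

lemma prod_single: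
  "(\<Prod>x\<in>A. Poly_Mapping.single (f x) (1::'k::comm_ring_1)) =
    Poly_Mapping.single (\<Sum>x\<in>A. f x :: 'v::comm_monoid_add) 1"
  by (induction A rule: infinite_finite_induct) (simp_all add: mult_single)

definition mono_eval :: "('v \<Rightarrow> 'a::comm_ring_1) \<Rightarrow> ('v \<Rightarrow>\<^sub>0 nat) \<Rightarrow> 'a" where
  "mono_eval \<sigma> t = (\<Prod>v\<in>Poly_Mapping.keys t. \<sigma> v ^ Poly_Mapping.lookup t v)"

definition poly_eval ::
    "('k::comm_ring_1 \<Rightarrow> 'a::comm_ring_1) \<Rightarrow> ('v \<Rightarrow> 'a) \<Rightarrow> ('v, 'k) mpoly \<Rightarrow> 'a" where
  "poly_eval h \<sigma> p = (\<Sum>t\<in>Poly_Mapping.keys p. h (Poly_Mapping.lookup p t) * mono_eval \<sigma> t)"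

lemma mono_eval_superset:
  "finite S \<Longrightarrow> Poly_Mapping.keys t \<subseteq> S \<Longrightarrow> mono_eval \<sigma> t = (\<Prod>v\<in>S. \<sigma> v ^ Poly_Mapping.lookup t v)"
  unfolding mono_eval_def by (intro prod.mono_neutral_left) (auto simp: in_keys_iff)

lemma mono_eval_add: "mono_eval \<sigma> (t + u) = mono_eval \<sigma> t * mono_eval \<sigma> u"
proof -
  let ?S = "Poly_Mapping.keys t \<union> Poly_Mapping.keys u"
  have "mono_eval \<sigma> (t + u) = (\<Prod>v\<in>?S. \<sigma> v ^ Poly_Mapping.lookup (t + u) v)"
    by (intro mono_eval_superset) (auto simp: keys_add)
  also have "\<dots> = (\<Prod>v\<in>?S. \<sigma> v ^ Poly_Mapping.lookup t v) * (\<Prod>v\<in>?S. \<sigma> v ^ Poly_Mapping.lookup u v)"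
    by (simp add: lookup_add power_add prod.distrib)
  also have "\<dots> = mono_eval \<sigma> t * mono_eval \<sigma> u"
    by (subst (1 2) mono_eval_superset[of ?S]) auto
  finally show ?thesis .
qed

lemma mono_eval_0 [simp]: "mono_eval \<sigma> 0 = 1"
  by (simp add: mono_eval_def)

lemma mono_eval_single: "mono_eval \<sigma> (Poly_Mapping.single v n) = \<sigma> v ^ n"
  by (subst mono_eval_superset[of "{v}"]) auto

lemma mono_eval_sum: "mono_eval \<sigma> (sum f A) = (\<Prod>x\<in>A. mono_eval \<sigma> (f x))"
  by (induction A rule: infinite_finite_induct) (simp_all add: mono_eval_add)

lemma poly_eval_superset:
  assumes "ring_map h" "finite S" "Poly_Mapping.keys p \<subseteq> S"
  shows "poly_eval h \<sigma> p = (\<Sum>t\<in>S. h (Poly_Mapping.lookup p t) * mono_eval \<sigma> t)"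
  unfolding poly_eval_def using assms
  by (intro sum.mono_neutral_left) (auto simp: in_keys_iff ring_map_0)

lemma poly_eval_single:
  assumes "ring_map h"
  shows "poly_eval h \<sigma> (Poly_Mapping.single t a) = h a * mono_eval \<sigma> t"
  by (subst poly_eval_superset[OF assms, of "{t}"]) auto

lemma poly_eval_add:
  assumes "ring_map h"
  shows "poly_eval h \<sigma> (p + q) = poly_eval h \<sigma> p + poly_eval h \<sigma> q"
proof -
  let ?S = "Poly_Mapping.keys p \<union> Poly_Mapping.keys q"
  have "poly_eval h \<sigma> (p + q) = (\<Sum>t\<in>?S. h (Poly_Mapping.lookup (p + q) t) * mono_eval \<sigma> t)"
    by (intro poly_eval_superset[OF assms]) (auto simp: keys_add)
  also have "\<dots> = (\<Sum>t\<in>?S. h (Poly_Mapping.lookup p t) * mono_eval \<sigma> t) +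
     (\<Sum>t\<in>?S. h (Poly_Mapping.lookup q t) * mono_eval \<sigma> t)"
    by (simp add: lookup_add ring_map_add[OF assms] algebra_simps sum.distrib)
  also have "\<dots> = poly_eval h \<sigma> p + poly_eval h \<sigma> q"
    by (subst (1 2) poly_eval_superset[OF assms, of ?S]) auto
  finally show ?thesis .
qed

lemma poly_eval_0 [simp]: "poly_eval h \<sigma> 0 = 0"
  by (simp add: poly_eval_def)

lemma poly_eval_sum:
  "ring_map h \<Longrightarrow> poly_eval h \<sigma> (sum f A) = (\<Sum>x\<in>A. poly_eval h \<sigma> (f x))"
  by (induction A rule: infinite_finite_induct) (simp_all add: poly_eval_add)

lemma mpoly_mult_expand:
  fixes p q :: "('v, 'k::comm_ring_1) mpoly"
  shows "p * q = (\<Sum>t\<in>Poly_Mapping.keys p. \<Sum>u\<in>Poly_Mapping.keys q.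
    Poly_Mapping.single (t + u) (Poly_Mapping.lookup p t * Poly_Mapping.lookup q u))"
proof -
  have "p * q = (\<Sum>t\<in>Poly_Mapping.keys p. Poly_Mapping.single t (Poly_Mapping.lookup p t)) *
      (\<Sum>u\<in>Poly_Mapping.keys q. Poly_Mapping.single u (Poly_Mapping.lookup q u))"
    by (rule arg_cong2[where f = "(*)"]; rule poly_mapping_sum_singles)
  then show ?thesis by (simp only: sum_product mult_single)
qed

lemma poly_eval_mult:
  assumes "ring_map h"
  shows "poly_eval h \<sigma> (p * q) = poly_eval h \<sigma> p * poly_eval h \<sigma> q"
proof -
  have "poly_eval h \<sigma> (p * q) = (\<Sum>t\<in>Poly_Mapping.keys p. \<Sum>u\<in>Poly_Mapping.keys q.
     (h (Poly_Mapping.lookup p t) * mono_eval \<sigma> t) * (h (Poly_Mapping.lookup q u) * mono_eval \<sigma> u))"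
    by (simp only: mpoly_mult_expand[of p q] poly_eval_sum[OF assms] poly_eval_single[OF assms]
        ring_map_mult[OF assms] mono_eval_add ac_simps)
  then show ?thesis by (simp only: poly_eval_def sum_product)
qed

lemma ring_map_poly_eval:
  assumes "ring_map h"
  shows "ring_map (poly_eval h \<sigma>)"
proof (rule ring_mapI)
  have "poly_eval h \<sigma> (Poly_Mapping.single 0 1) = 1"
    by (simp only: poly_eval_single[OF assms] mono_eval_0 ring_map_1[OF assms] mult_1)
  then show "poly_eval h \<sigma> 1 = 1" by simp
qed (rule poly_eval_add[OF assms], rule poly_eval_mult[OF assms])

lemma poly_eval_const: "ring_map h \<Longrightarrow> poly_eval h \<sigma> (Poly_Mapping.single 0 a) = h a"
  by (simp add: poly_eval_single)

lemma poly_eval_var: "ring_map h \<Longrightarrow> poly_eval h \<sigma> (var v) = \<sigma> v"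
  by (simp add: var_def poly_eval_single mono_eval_single ring_map_1)

lemma ring_map_const: "ring_map (Poly_Mapping.single 0 :: 'k::comm_ring_1 \<Rightarrow> ('v, 'k) mpoly)"
  by (rule ring_mapI) (simp_all add: single_add mult_single)

lemma single_eq_const_mult_mono_eval:
  fixes a :: "'k::comm_ring_1"
  shows "Poly_Mapping.single t a = Poly_Mapping.single 0 a * mono_eval (var :: 'v \<Rightarrow> ('v, 'k) mpoly) t"
proof -
  have pow: "var v ^ n = Poly_Mapping.single (Poly_Mapping.single v n) (1::'k)" for v :: 'v and n
  proof (induction n)
    case (Suc n)
    then show ?case by (simp add: var_def mult_single single_add[symmetric])
  qed simp
  have "mono_eval (var :: 'v \<Rightarrow> ('v, 'k) mpoly) t =
      (\<Prod>v\<in>Poly_Mapping.keys t. Poly_Mapping.single (Poly_Mapping.single v (Poly_Mapping.lookup t v)) 1)"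
    by (simp add: mono_eval_def pow)
  also have "\<dots> = Poly_Mapping.single (\<Sum>v\<in>Poly_Mapping.keys t. Poly_Mapping.single v (Poly_Mapping.lookup t v)) 1"
    by (rule prod_single)
  also have "\<dots> = Poly_Mapping.single t 1" by (simp only: poly_mapping_sum_singles[symmetric])
  finally show ?thesis by (simp add: mult_single)
qed

lemma poly_eval_unique:
  fixes g :: "('v, 'k::comm_ring_1) mpoly \<Rightarrow> 'a::comm_ring_1"
  assumes g: "ring_map g"
  shows "g p = poly_eval (\<lambda>a. g (Poly_Mapping.single 0 a)) (\<lambda>v. g (var v)) p"
proof -
  have mono: "g (mono_eval var t) = mono_eval (\<lambda>v. g (var v)) t" for t
    by (simp add: mono_eval_def ring_map_prod[OF g] ring_map_power[OF g])
  have "g p = (\<Sum>t\<in>Poly_Mapping.keys p. g (Poly_Mapping.single t (Poly_Mapping.lookup p t)))"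
    by (subst poly_mapping_sum_singles) (rule ring_map_sum[OF g])
  also have "\<dots> = (\<Sum>t\<in>Poly_Mapping.keys p.
      g (Poly_Mapping.single 0 (Poly_Mapping.lookup p t)) * mono_eval (\<lambda>v. g (var v)) t)"
    by (intro sum.cong refl) (subst single_eq_const_mult_mono_eval, simp only: ring_map_mult[OF g] mono)
  finally show ?thesis by (simp only: poly_eval_def)
qed

lemma ring_map_eqI:
  fixes g g' :: "('v, 'k::comm_ring_1) mpoly \<Rightarrow> 'a::comm_ring_1"
  assumes "ring_map g" "ring_map g'"
    and "\<And>a. g (Poly_Mapping.single 0 a) = g' (Poly_Mapping.single 0 a)" "\<And>v. g (var v) = g' (var v)"
  shows "g p = g' p"
  using poly_eval_unique[OF assms(1), of p] poly_eval_unique[OF assms(2), of p] assms(3,4) by simp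

lemma poly_subst_eq_poly_eval: "poly_subst \<sigma> p = poly_eval (Poly_Mapping.single 0) \<sigma> p"
  by (simp add: poly_subst_def poly_eval_def mono_eval_def)

section \<open>Degrees of monomials\<close>

definition mdeg :: "('v \<Rightarrow>\<^sub>0 nat) \<Rightarrow> nat" where
  "mdeg t = (\<Sum>v\<in>Poly_Mapping.keys t. Poly_Mapping.lookup t v)"

lemma mdeg_superset:
  "finite S \<Longrightarrow> Poly_Mapping.keys t \<subseteq> S \<Longrightarrow> mdeg t = (\<Sum>v\<in>S. Poly_Mapping.lookup t v)"
  unfolding mdeg_def by (intro sum.mono_neutral_left) (auto simp: in_keys_iff)

lemma mdeg_add: "mdeg (t + u) = mdeg t + mdeg u"
proof -
  let ?S = "Poly_Mapping.keys t \<union> Poly_Mapping.keys u"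
  have "mdeg (t + u) = (\<Sum>v\<in>?S. Poly_Mapping.lookup (t + u) v)"
    by (intro mdeg_superset) (auto simp: keys_add)
  also have "\<dots> = (\<Sum>v\<in>?S. Poly_Mapping.lookup t v) + (\<Sum>v\<in>?S. Poly_Mapping.lookup u v)"
    by (simp add: lookup_add sum.distrib)
  also have "\<dots> = mdeg t + mdeg u" by (subst (1 2) mdeg_superset[of ?S]) auto
  finally show ?thesis .
qed

lemma mdeg_0 [simp]: "mdeg 0 = 0"
  by (simp add: mdeg_def)

lemma mdeg_single [simp]: "mdeg (Poly_Mapping.single v n) = n"
  by (subst mdeg_superset[of "{v}"]) auto

lemma mdeg_sum: "mdeg (sum f A) = (\<Sum>x\<in>A. mdeg (f x))"
  by (induction A rule: infinite_finite_induct) (simp_all add: mdeg_add)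

lemma finite_mdeg_le: "finite {t :: 'v::finite \<Rightarrow>\<^sub>0 nat. mdeg t \<le> d}"
proof (rule inj_on_finite)
  show "inj_on Poly_Mapping.lookup {t :: 'v \<Rightarrow>\<^sub>0 nat. mdeg t \<le> d}"
    by (auto intro: inj_onI poly_mapping_eqI)
  show "Poly_Mapping.lookup ` {t :: 'v \<Rightarrow>\<^sub>0 nat. mdeg t \<le> d} \<subseteq> PiE UNIV (\<lambda>_. {..d})"
  proof
    fix f assume "f \<in> Poly_Mapping.lookup ` {t :: 'v \<Rightarrow>\<^sub>0 nat. mdeg t \<le> d}"
    then obtain t where t: "f = Poly_Mapping.lookup t" "mdeg t \<le> d" by auto
    have "f v \<le> d" for v
    proof -
      have "f v \<le> (\<Sum>v\<in>UNIV. Poly_Mapping.lookup t v)" unfolding t(1) by (rule member_le_sum) auto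
      then show ?thesis using t(2) mdeg_superset[of UNIV t] by simp
    qed
    then show "f \<in> PiE UNIV (\<lambda>_. {..d})" by auto
  qed
  show "finite (PiE (UNIV :: 'v set) (\<lambda>_. {..d}))" by (intro finite_PiE) auto
qed

section \<open>Leading monomials\<close>

lemma term_order_refl: "term_order ord \<Longrightarrow> (t, t) \<in> ord"
  and term_order_antisym: "term_order ord \<Longrightarrow> (t, u) \<in> ord \<Longrightarrow> (u, t) \<in> ord \<Longrightarrow> t = u"
  and term_order_trans: "term_order ord \<Longrightarrow> (t, u) \<in> ord \<Longrightarrow> (u, w) \<in> ord \<Longrightarrow> (t, w) \<in> ord"
  and term_order_add: "term_order ord \<Longrightarrow> (t, u) \<in> ord \<Longrightarrow> (t + w, u + w) \<in> ord"
  unfolding term_order_def linear_order_on_def partial_order_on_def preorder_on_def refl_on_def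
  by (auto dest: antisymD transD simp: total_on_def)

lemma term_order_total: "term_order ord \<Longrightarrow> (t, u) \<in> ord \<or> (u, t) \<in> ord"
  unfolding term_order_def linear_order_on_def total_on_def
  by (cases "t = u") (auto simp: partial_order_on_def preorder_on_def refl_on_def)

lemma term_order_add_mono:
  assumes "term_order ord" "(t, u) \<in> ord" "(t', u') \<in> ord"
  shows "(t + t', u + u') \<in> ord"
  using term_order_trans[OF assms(1) term_order_add[OF assms(1,2), of t']
      term_order_add[OF assms(1,3), of u, unfolded add.commute[of _ u]]] by simp

lemma term_order_add_eq:
  assumes "term_order ord" "(t, u) \<in> ord" "(t', u') \<in> ord" "t + t' = u + u'"
  shows "t = u \<and> t' = u'"
proof -
  have "(u + t', t + t') \<in> ord"
    using term_order_add[OF assms(1,3), of u] assms(4) by (simp add: add.commute)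
  moreover have "(t + t', u + t') \<in> ord" by (rule term_order_add[OF assms(1,2)])
  ultimately have "t + t' = u + t'" by (metis term_order_antisym[OF assms(1)])
  then show ?thesis using assms(4) by simp
qed

lemma term_order_sum_mono:
  assumes "term_order ord" "\<And>x. x \<in> A \<Longrightarrow> (f x, g x) \<in> ord"
  shows "(sum f A, sum g A) \<in> ord"
  using assms(2)
  by (induction A rule: infinite_finite_induct)
     (auto intro: term_order_refl[OF assms(1)] term_order_add_mono[OF assms(1)])

lemma term_order_sum_eq:
  assumes ord: "term_order ord" and "finite A" "\<And>x. x \<in> A \<Longrightarrow> (f x, g x) \<in> ord" "sum f A = sum g A"
  shows "\<forall>x\<in>A. f x = g x"
  using assms(2-)
proof (induction A rule: finite_induct)
  case (insert x A)
  have "(sum f A, sum g A) \<in> ord" by (rule term_order_sum_mono[OF ord]) (simp add: insert.prems(1))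
  moreover have "(f x, g x) \<in> ord" by (simp add: insert.prems(1))
  moreover have "f x + sum f A = g x + sum g A" using insert.prems(2) insert.hyps by simp
  ultimately have "f x = g x \<and> sum f A = sum g A" by (intro term_order_add_eq[OF ord])
  moreover have "\<forall>x\<in>A. f x = g x"
    by (rule insert.IH) (use insert.prems(1) calculation in simp_all)
  ultimately show ?case by simp
qed simp

lemma finite_term_order_max:
  assumes "term_order ord" "finite S" "S \<noteq> {}"
  shows "\<exists>t\<in>S. \<forall>u\<in>S. (u, t) \<in> ord"
  using assms(2,3)
proof (induction S rule: finite_ne_induct)
  case (singleton x)
  then show ?case using term_order_refl[OF assms(1)] by auto
next
  case (insert x S)
  then obtain t where t: "t \<in> S" "\<forall>u\<in>S. (u, t) \<in> ord" by blast
  show ?case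
  proof (cases "(x, t) \<in> ord")
    case False
    then have "(t, x) \<in> ord" using term_order_total[OF assms(1), of t x] by simp
    then have "(u, x) \<in> ord" if "u \<in> S" for u
      using term_order_trans[OF assms(1), of u t x] t(2) that by simp
    then show ?thesis using term_order_refl[OF assms(1), of x] by auto
  qed (use t in auto)
qed

lemma leading_monomialI:
  assumes "term_order ord" "t \<in> Poly_Mapping.keys p" "\<And>u. u \<in> Poly_Mapping.keys p \<Longrightarrow> (u, t) \<in> ord"
  shows "leading_monomial ord p = t"
  unfolding leading_monomial_def
  by (rule the_equality) (use assms in \<open>auto intro: term_order_antisym\<close>)

lemma
  assumes "term_order ord" "p \<noteq> 0"
  shows leading_monomial_in_keys: "leading_monomial ord p \<in> Poly_Mapping.keys p"
    and leading_monomial_max: "u \<in> Poly_Mapping.keys p \<Longrightarrow> (u, leading_monomial ord p) \<in> ord"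
proof -
  obtain t where t: "t \<in> Poly_Mapping.keys p" "\<forall>u\<in>Poly_Mapping.keys p. (u, t) \<in> ord"
    using finite_term_order_max[OF assms(1) finite_keys mpoly_keys_nonempty[OF assms(2)]] by blast
  then have "leading_monomial ord p = t" by (intro leading_monomialI[OF assms(1)]) auto
  with t show "leading_monomial ord p \<in> Poly_Mapping.keys p"
    and "u \<in> Poly_Mapping.keys p \<Longrightarrow> (u, leading_monomial ord p) \<in> ord" by auto
qed

lemma
  fixes p q :: "('v, 'k::idom) mpoly"
  assumes ord: "term_order ord" and p: "p \<noteq> 0" and q: "q \<noteq> 0"
  shows lookup_mult_leading_monomials:
      "Poly_Mapping.lookup (p * q) (leading_monomial ord p + leading_monomial ord q) =
       Poly_Mapping.lookup p (leading_monomial ord p) * Poly_Mapping.lookup q (leading_monomial ord q)"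
    and leading_monomial_mult: "leading_monomial ord (p * q) = leading_monomial ord p + leading_monomial ord q"
    and mpoly_mult_nonzero: "p * q \<noteq> 0"
proof -
  let ?t = "leading_monomial ord p" and ?u = "leading_monomial ord q"
  have t: "?t \<in> Poly_Mapping.keys p" and u: "?u \<in> Poly_Mapping.keys q"
    using leading_monomial_in_keys[OF ord] p q by auto
  have only: "t + u = ?t + ?u \<longleftrightarrow> t = ?t \<and> u = ?u" if "t \<in> Poly_Mapping.keys p" "u \<in> Poly_Mapping.keys q" for t u
    using term_order_add_eq[OF ord leading_monomial_max[OF ord p that(1)] leading_monomial_max[OF ord q that(2)]]
    by blast
  have "Poly_Mapping.lookup (p * q) (?t + ?u) = (\<Sum>t\<in>Poly_Mapping.keys p. \<Sum>u\<in>Poly_Mapping.keys q.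
      if t = ?t \<and> u = ?u then Poly_Mapping.lookup p t * Poly_Mapping.lookup q u else 0)"
    by (subst mpoly_mult_expand, simp only: lookup_sum lookup_single when_def)
       (intro sum.cong refl, simp only: only)
  also have "\<dots> = (\<Sum>t\<in>Poly_Mapping.keys p. if t = ?t then
      Poly_Mapping.lookup p t * Poly_Mapping.lookup q ?u else 0)"
  proof (rule sum.cong)
    fix t assume "t \<in> Poly_Mapping.keys p"
    show "(\<Sum>u\<in>Poly_Mapping.keys q. if t = ?t \<and> u = ?u then Poly_Mapping.lookup p t * Poly_Mapping.lookup q u else 0) =
      (if t = ?t then Poly_Mapping.lookup p t * Poly_Mapping.lookup q ?u else 0)"
      using u by (cases "t = ?t") (simp_all add: sum.delta)
  qed simp
  also have "\<dots> = Poly_Mapping.lookup p ?t * Poly_Mapping.lookup q ?u" using t by (simp add: sum.delta)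
  finally show *: "Poly_Mapping.lookup (p * q) (?t + ?u) = Poly_Mapping.lookup p ?t * Poly_Mapping.lookup q ?u" .
  then have in_keys: "?t + ?u \<in> Poly_Mapping.keys (p * q)" using t u by (simp add: in_keys_iff)
  then show "p * q \<noteq> 0" by (metis empty_iff keys_zero)
  show "leading_monomial ord (p * q) = ?t + ?u"
  proof (rule leading_monomialI[OF ord in_keys])
    fix w assume "w \<in> Poly_Mapping.keys (p * q)"
    then obtain t u where "w = t + u" "t \<in> Poly_Mapping.keys p" "u \<in> Poly_Mapping.keys q"
      using keys_mult[of p q] by blast
    then show "(w, ?t + ?u) \<in> ord"
      using leading_monomial_max[OF ord p, of t] leading_monomial_max[OF ord q, of u] term_order_add_mono[OF ord] by simp
  qed
qed

lemma leading_monomial_1: "term_order ord \<Longrightarrow> leading_monomial ord (1 :: ('v, 'k::comm_ring_1) mpoly) = 0"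
  by (rule leading_monomialI) (auto intro: term_order_refl)

lemma
  fixes f :: "'i \<Rightarrow> ('v, 'k::idom) mpoly"
  assumes "term_order ord" "finite A" "\<And>x. x \<in> A \<Longrightarrow> f x \<noteq> 0"
  shows mpoly_prod_nonzero: "prod f A \<noteq> 0"
    and leading_monomial_prod: "leading_monomial ord (prod f A) = (\<Sum>x\<in>A. leading_monomial ord (f x))"
proof -
  have "prod f A \<noteq> 0 \<and> leading_monomial ord (prod f A) = (\<Sum>x\<in>A. leading_monomial ord (f x))"
    using assms(2,3)
  proof (induction A rule: finite_induct)
    case (insert x A)
    then show ?case
      using mpoly_mult_nonzero[OF assms(1), of "f x" "prod f A"] leading_monomial_mult[OF assms(1), of "f x" "prod f A"]
      by simp
  qed (simp add: leading_monomial_1[OF assms(1)])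
  then show "prod f A \<noteq> 0" "leading_monomial ord (prod f A) = (\<Sum>x\<in>A. leading_monomial ord (f x))" by auto
qed

section \<open>Minors of the generic matrix\<close>

definition diag_mono :: "nat \<Rightarrow> (nat \<Rightarrow> 'm) \<Rightarrow> (nat \<Rightarrow> 'n) \<Rightarrow> ('m \<times> 'n \<Rightarrow>\<^sub>0 nat)" where
  "diag_mono t a b = (\<Sum>i<t. Poly_Mapping.single (a i, b i) 1)"

lemma minor_2: "minor X 2 a b = X (a 0) (b 0) * X (a 1) (b 1) - X (a 0) (b 1) * X (a 1) (b 0)"
proof -
  have "{0..<2::nat} = {0, 1}" by auto
  then have "{p. p permutes {0..<2::nat}} = {p. p permutes {0, 1}}" by (simp only:)
  also have "\<dots> = {id, Transposition.transpose 0 1}" by (auto simp: permutes_doubleton_iff)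
  finally have perms: "{p. p permutes {0..<2::nat}} = {id, Transposition.transpose 0 1}" .
  have neq: "id \<noteq> Transposition.transpose 0 (1::nat)"
    by (metis id_apply transpose_apply_first zero_neq_one)
  have two: "{..<2::nat} = {0, 1}" by auto
  have "minor X 2 a b = (\<Sum>p\<in>{id, Transposition.transpose 0 1}. signof p * (\<Prod>i\<in>{0, 1}. X (a i) (b (p i))))"
    by (simp only: minor_expand perms two)
  also have "\<dots> = X (a 0) (b 0) * X (a 1) (b 1) - X (a 0) (b 1) * X (a 1) (b 0)"
    using neq by (simp add: sign_swap_id)
  finally show ?thesis .
qed

lemma minor_generic:
  "minor (generic_matrix :: 'm \<Rightarrow> 'n \<Rightarrow> ('m \<times> 'n, 'k::comm_ring_1) mpoly) t a b =
    (\<Sum>p\<in>{p. p permutes {0..<t}}. Poly_Mapping.single (diag_mono t a (\<lambda>i. b (p i))) (signof p))"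
proof -
  have "signof p * (\<Prod>i<t. generic_matrix (a i) (b (p i)) :: ('m \<times> 'n, 'k) mpoly) =
      Poly_Mapping.single (diag_mono t a (\<lambda>i. b (p i))) (signof p)" for p
  proof -
    have "(\<Prod>i<t. generic_matrix (a i) (b (p i)) :: ('m \<times> 'n, 'k) mpoly) =
        Poly_Mapping.single (diag_mono t a (\<lambda>i. b (p i))) 1"
      by (simp only: generic_matrix_def var_def diag_mono_def prod_single)
    moreover have "(signof p :: ('m \<times> 'n, 'k) mpoly) = Poly_Mapping.single 0 (signof p)"
      by (rule ring_map_signof[OF ring_map_const, symmetric])
    ultimately show ?thesis by (simp only: mult_single add_0 mult_1_right)
  qed
  then show ?thesis by (simp only: minor_expand)
qed

lemma mdeg_diag_mono: "mdeg (diag_mono t a b) = t"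
  by (simp add: diag_mono_def mdeg_sum)

lemma lookup_diag_mono:
  "Poly_Mapping.lookup (diag_mono t a b) c = card {i. i < t \<and> (a i, b i) = c}"
proof -
  have "{i. i < t \<and> (a i, b i) = c} = {..<t} \<inter> {i. (a i, b i) = c}" by auto
  then show ?thesis
    by (simp add: diag_mono_def lookup_sum lookup_single when_def sum.If_cases)
qed

lemma keys_minor_generic:
  "Poly_Mapping.keys (minor (generic_matrix :: 'm \<Rightarrow> 'n \<Rightarrow> ('m \<times> 'n, 'k::comm_ring_1) mpoly) t a b) \<subseteq>
    {diag_mono t a (\<lambda>i. b (p i)) | p. p permutes {0..<t}}"
proof -
  have "Poly_Mapping.keys (\<Sum>p\<in>A. Poly_Mapping.single (f p) (c p)) \<subseteq> f ` A" for f :: "(nat \<Rightarrow> nat) \<Rightarrow> 'm \<times> 'n \<Rightarrow>\<^sub>0 nat"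
    and c :: "(nat \<Rightarrow> nat) \<Rightarrow> 'k" and A
  proof
    fix u assume "u \<in> Poly_Mapping.keys (\<Sum>p\<in>A. Poly_Mapping.single (f p) (c p))"
    then have "(\<Sum>p\<in>A. c p when f p = u) \<noteq> 0" by (simp add: in_keys_iff lookup_sum lookup_single)
    then obtain p where "p \<in> A" "(c p when f p = u) \<noteq> 0" by (meson sum.neutral)
    then show "u \<in> f ` A" by (auto simp: when_def split: if_splits)
  qed
  from this[of "\<lambda>p. diag_mono t a (\<lambda>i. b (p i))" "\<lambda>p. signof p" "{p. p permutes {0..<t}}"]
  show ?thesis unfolding minor_generic by blast
qed

lemma mdeg_keys_minor_generic:
  assumes "u \<in> Poly_Mapping.keys (minor (generic_matrix :: 'm \<Rightarrow> 'n \<Rightarrow> ('m \<times> 'n, 'k::comm_ring_1) mpoly) t a b)"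
  shows "mdeg u = t"
  using subsetD[OF keys_minor_generic assms] by (auto simp: mdeg_diag_mono)

lemma lookup_diag_mono_off:
  assumes "inj_on a {..<t}" "inj_on b {..<t}" "p permutes {0..<t}" "i < t" "p i \<noteq> i"
  shows "Poly_Mapping.lookup (diag_mono t a (\<lambda>l. b (p l))) (a i, b i) = 0"
    and "Poly_Mapping.lookup (diag_mono t a b) (a i, b i) > 0"
proof -
  have "p i < t" using permutes_in_image[OF assms(3), of i] assms(4) by simp
  then have "b (p i) \<noteq> b i" using assms(2,4,5) by (auto dest: inj_onD)
  then have "{l. l < t \<and> (a l, b (p l)) = (a i, b i)} = {}"
    using assms(1,4) by (auto dest: inj_onD)
  then show "Poly_Mapping.lookup (diag_mono t a (\<lambda>l. b (p l))) (a i, b i) = 0"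
    by (simp only: lookup_diag_mono card.empty)
  have "i \<in> {l. l < t \<and> (a l, b l) = (a i, b i)}" using assms(4) by simp
  then have "0 < card {l. l < t \<and> (a l, b l) = (a i, b i)}" by (subst card_gt_0_iff) auto
  then show "Poly_Mapping.lookup (diag_mono t a b) (a i, b i) > 0" by (simp only: lookup_diag_mono)
qed

lemma lookup_minor_generic_diag:
  assumes "inj_on a {..<t}" "inj_on b {..<t}"
  shows "Poly_Mapping.lookup (minor (generic_matrix :: 'm \<Rightarrow> 'n \<Rightarrow> ('m \<times> 'n, 'k::comm_ring_1) mpoly) t a b)
    (diag_mono t a b) = 1"
proof -
  have "diag_mono t a (\<lambda>i. b (p i)) = diag_mono t a b \<longleftrightarrow> p = id" if p: "p permutes {0..<t}" for p
  proof
    assume eq: "diag_mono t a (\<lambda>i. b (p i)) = diag_mono t a b"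
    have "p i = i" for i
    proof (cases "i < t")
      case True
      then show ?thesis using lookup_diag_mono_off[OF assms p True] eq by (cases "p i = i") auto
    next
      case False
      then show ?thesis using permutes_not_in[OF p, of i] by simp
    qed
    then show "p = id" by auto
  qed auto
  then have "Poly_Mapping.lookup (minor (generic_matrix :: 'm \<Rightarrow> 'n \<Rightarrow> ('m \<times> 'n, 'k) mpoly) t a b)
      (diag_mono t a b) = (\<Sum>p\<in>{p. p permutes {0..<t}}. if p = id then signof p else 0)"
    by (simp only: minor_generic lookup_sum lookup_single when_def) (rule sum.cong, simp_all)
  also have "\<dots> = 1" by (subst sum.delta) (simp_all add: finite_permutations permutes_id)
  finally show ?thesis .
qed

lemma minor_generic_nonzero:
  assumes "inj_on a {..<t}" "inj_on b {..<t}"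
  shows "minor (generic_matrix :: 'm \<Rightarrow> 'n \<Rightarrow> ('m \<times> 'n, 'k::comm_ring_1) mpoly) t a b \<noteq> 0"
  using lookup_minor_generic_diag[OF assms, where 'k = 'k] by fastforce

lemma total_degree_minor_generic:
  assumes "inj_on a {..<t}" "inj_on b {..<t}"
  shows "total_degree (minor (generic_matrix :: 'm \<Rightarrow> 'n \<Rightarrow> ('m \<times> 'n, 'k::comm_ring_1) mpoly) t a b) = t"
proof -
  let ?K = "Poly_Mapping.keys (minor (generic_matrix :: 'm \<Rightarrow> 'n \<Rightarrow> ('m \<times> 'n, 'k) mpoly) t a b)"
  have "mdeg ` ?K = {t}"
    using mdeg_keys_minor_generic mpoly_keys_nonempty[OF minor_generic_nonzero[OF assms]] by blast
  then show ?thesis by (simp add: total_degree_def mdeg_def[abs_def])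
qed

lemma
  assumes "diagonal_term_order (generic_matrix :: 'm::linorder \<Rightarrow> 'n::linorder \<Rightarrow> ('m \<times> 'n, 'k::comm_ring_1) mpoly) ord"
  shows diagonal_term_order_imp_term_order: "term_order ord"
    and leading_monomial_minor: "strict_mono_on {..<t} a \<Longrightarrow> strict_mono_on {..<t} b \<Longrightarrow>
      leading_monomial ord (minor (generic_matrix :: 'm \<Rightarrow> 'n \<Rightarrow> ('m \<times> 'n, 'k) mpoly) t a b) = diag_mono t a b"
  using assms by (auto simp: diagonal_term_order_def diag_mono_def)

lemma diagonal_term_order_swap:
  fixes i i' :: "'m::linorder" and j j' :: "'n::linorder"
  assumes diag: "diagonal_term_order (generic_matrix :: 'm \<Rightarrow> 'n \<Rightarrow> ('m \<times> 'n, 'k::comm_ring_1) mpoly) ord"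
    and "i < i'" "j < j'"
  shows "(Poly_Mapping.single (i, j') 1 + Poly_Mapping.single (i', j) 1,
    Poly_Mapping.single (i, j) 1 + Poly_Mapping.single (i', j') 1) \<in> ord"
    (is "(?B, ?A) \<in> ord")
proof -
  define a where "a n = (if n = 0 then i else i')" for n :: nat
  define b where "b n = (if n = 0 then j else j')" for n :: nat
  have mono: "strict_mono_on {..<2} a" "strict_mono_on {..<2} b"
    using assms(2,3) by (auto simp: strict_mono_on_def a_def b_def)
  let ?M = "minor (generic_matrix :: 'm \<Rightarrow> 'n \<Rightarrow> ('m \<times> 'n, 'k) mpoly) 2 a b"
  have M: "?M = Poly_Mapping.single ?A 1 - Poly_Mapping.single ?B 1"
    by (simp add: minor_2 generic_matrix_def var_def mult_single a_def b_def)
  have "Poly_Mapping.lookup ?A (i, j) \<noteq> Poly_Mapping.lookup ?B (i, j)"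
    using assms(2,3) by (simp add: lookup_add lookup_single)
  then have "?A \<noteq> ?B" by metis
  then have "?B \<in> Poly_Mapping.keys ?M" unfolding M by (simp add: in_keys_iff lookup_minus lookup_single)
  moreover have "?M \<noteq> 0" using calculation by (metis empty_iff keys_zero)
  moreover have "leading_monomial ord ?M = ?A"
    using leading_monomial_minor[OF diag mono] by (simp add: diag_mono_def numeral_2_eq_2 a_def b_def)
  ultimately show ?thesis
    using leading_monomial_max[OF diagonal_term_order_imp_term_order[OF diag], of ?M ?B] by simp
qed

text \<open>The linear order of \<open>Poly_Mapping\<close> is the lexicographic one with the least variable
  most significant.\<close>

lemma lex_term_order: "term_order {(t, u :: 'v::linorder \<Rightarrow>\<^sub>0 nat). t \<le> u}"
proof -
  have "0 \<le> t" for t :: "'v \<Rightarrow>\<^sub>0 nat"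
  proof (rule leI)
    show "\<not> t < 0" by transfer (simp add: less_fun_def)
  qed
  then show ?thesis
    unfolding term_order_def linear_order_on_def partial_order_on_def preorder_on_def
    by (auto simp: refl_on_def trans_def antisym_def total_on_def intro: add_right_mono)
qed

lemma lex_diagonal_term_order:
  "diagonal_term_order (generic_matrix :: 'm::linorder \<Rightarrow> 'n::linorder \<Rightarrow> ('m \<times> 'n, 'k::comm_ring_1) mpoly)
    {(t, u). t \<le> u}"
  unfolding diagonal_term_order_def
proof (intro conjI allI impI lex_term_order)
  fix t and a :: "nat \<Rightarrow> 'm" and b :: "nat \<Rightarrow> 'n"
  assume mono: "strict_mono_on {..<t} a \<and> strict_mono_on {..<t} b"
  then have inj: "inj_on a {..<t}" "inj_on b {..<t}" by (auto intro: strict_mono_on_imp_inj_on)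
  have less: "diag_mono t a (\<lambda>i. b (p i)) < diag_mono t a b" if p: "p permutes {0..<t}" "p \<noteq> id" for p
  proof -
    obtain i0 where i0: "p i0 \<noteq> i0" using p(2) by (metis eq_id_iff)
    define i where "i = (LEAST i. p i \<noteq> i)"
    have i: "p i \<noteq> i" unfolding i_def using i0 by (rule LeastI)
    have fixed: "p l = l" if "l < i" for l using not_less_Least that unfolding i_def by blast
    have "i < t" using i permutes_not_in[OF p(1), of i] by auto
    then have "p i < t" using permutes_in_image[OF p(1), of i] by simp
    have "i < p i"
    proof (rule ccontr)
      assume "\<not> i < p i"
      then have "p (p i) = p i" using i by (intro fixed) simp
      then show False using i injD[OF permutes_inj[OF p(1)]] by blast
    qed
    then have "b i < b (p i)" using mono \<open>p i < t\<close> \<open>i < t\<close> by (auto simp: strict_mono_on_def)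
    have same: "Poly_Mapping.lookup (diag_mono t a (\<lambda>i. b (p i))) c = Poly_Mapping.lookup (diag_mono t a b) c"
      if c: "c < (a i, b i)" for c
    proof -
      have "(a l, b (p l)) = c \<longleftrightarrow> (a l, b l) = c" if "l < t" for l
      proof (cases "l < i")
        case False
        then have "a i \<le> a l" "l = i \<or> a i < a l"
          using mono \<open>l < t\<close> \<open>i < t\<close> by (auto simp: strict_mono_on_def not_less le_less)
        then show ?thesis using c \<open>b i < b (p i)\<close> by (cases c) (auto simp: less_prod_def')
      qed (simp add: fixed)
      then have "{l. l < t \<and> (a l, b (p l)) = c} = {l. l < t \<and> (a l, b l) = c}" by blast
      then show ?thesis by (simp only: lookup_diag_mono)
    qed
    have "less_fun (Poly_Mapping.lookup (diag_mono t a (\<lambda>i. b (p i)))) (Poly_Mapping.lookup (diag_mono t a b))"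
      unfolding less_fun_def
      using same lookup_diag_mono_off[OF inj p(1) \<open>i < t\<close> i] by (intro exI[of _ "(a i, b i)"]) auto
    then show ?thesis by (simp add: less_poly_mapping.rep_eq)
  qed
  show "leading_monomial {(t, u). t \<le> u} (minor (generic_matrix :: 'm \<Rightarrow> 'n \<Rightarrow> ('m \<times> 'n, 'k) mpoly) t a b) =
      (\<Sum>i<t. Poly_Mapping.single (a i, b i) 1)"
    unfolding diag_mono_def[symmetric]
  proof (rule leading_monomialI[OF lex_term_order])
    show "diag_mono t a b \<in> Poly_Mapping.keys (minor (generic_matrix :: 'm \<Rightarrow> 'n \<Rightarrow> ('m \<times> 'n, 'k) mpoly) t a b)"
      by (simp add: in_keys_iff lookup_minor_generic_diag[OF inj])
    fix u assume "u \<in> Poly_Mapping.keys (minor (generic_matrix :: 'm \<Rightarrow> 'n \<Rightarrow> ('m \<times> 'n, 'k) mpoly) t a b)"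
    then obtain p where p: "p permutes {0..<t}" "u = diag_mono t a (\<lambda>i. b (p i))"
      using keys_minor_generic by blast
    show "(u, diag_mono t a b) \<in> {(t, u). t \<le> u}"
      using less[OF p(1)] p(2) by (cases "p = id") (auto simp: less_imp_le)
  qed
qed

section \<open>Contingency tables\<close>

definition row_margin :: "('m \<times> 'n::finite \<Rightarrow>\<^sub>0 nat) \<Rightarrow> 'm \<Rightarrow> nat" where
  "row_margin t i = (\<Sum>j\<in>UNIV. Poly_Mapping.lookup t (i, j))"

definition col_margin :: "('m::finite \<times> 'n \<Rightarrow>\<^sub>0 nat) \<Rightarrow> 'n \<Rightarrow> nat" where
  "col_margin t j = (\<Sum>i\<in>UNIV. Poly_Mapping.lookup t (i, j))"

lemma margin_add:
  "row_margin (t + u) i = row_margin t i + row_margin u i"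
  "col_margin (t + u) j = col_margin t j + col_margin u j"
  by (simp_all add: row_margin_def col_margin_def lookup_add sum.distrib)

lemma margin_single:
  "row_margin (Poly_Mapping.single (i, j) n) i' = (if i = i' then n else 0)"
  "col_margin (Poly_Mapping.single (i, j) n) j' = (if j = j' then n else 0)"
  by (auto simp: row_margin_def col_margin_def lookup_single when_def sum.delta)

lemma margin_pos:
  "Poly_Mapping.lookup t (i, j) > 0 \<Longrightarrow> row_margin t i > 0"
  "Poly_Mapping.lookup t (i, j) > 0 \<Longrightarrow> col_margin t j > 0"
  unfolding row_margin_def col_margin_def by (subst sum_pos2, auto)+

lemma margin_posE:
  "row_margin t i > 0 \<Longrightarrow> \<exists>j. Poly_Mapping.lookup t (i, j) > 0"
  "col_margin t j > 0 \<Longrightarrow> \<exists>i. Poly_Mapping.lookup t (i, j) > 0"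
  unfolding row_margin_def col_margin_def by (rule ccontr, simp)+

lemma poly_mapping_split_single:
  assumes "Poly_Mapping.lookup t c > (0::nat)"
  obtains t' where "t = t' + Poly_Mapping.single c 1"
proof
  show "t = (t - Poly_Mapping.single c 1) + Poly_Mapping.single c 1"
    using assms by (intro poly_mapping_eqI) (auto simp: lookup_add lookup_minus lookup_single when_def)
qed

definition weak_antichain :: "('m::ord \<times> 'n::ord \<Rightarrow>\<^sub>0 nat) \<Rightarrow> bool" where
  "weak_antichain t \<longleftrightarrow> (\<forall>c\<in>Poly_Mapping.keys t. \<forall>d\<in>Poly_Mapping.keys t. \<not> (fst c < fst d \<and> snd c < snd d))"

text \<open>The table supported on a weak antichain is the least one with its margins: the cell in the
  first nonempty row and the last nonempty column belongs to it, and a swap moves any other table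
  to one containing this cell.\<close>

lemma weak_antichain_minimal:
  fixes t u :: "'m::{finite,linorder} \<times> 'n::{finite,linorder} \<Rightarrow>\<^sub>0 nat"
  assumes diag: "diagonal_term_order (generic_matrix :: 'm \<Rightarrow> 'n \<Rightarrow> ('m \<times> 'n, 'k::comm_ring_1) mpoly) ord"
    and "weak_antichain t" "\<And>i. row_margin t i = row_margin u i" "\<And>j. col_margin t j = col_margin u j"
  shows "(t, u) \<in> ord"
  using assms(2-)
proof (induction "mdeg t" arbitrary: t u rule: less_induct)
  case less
  have ord: "term_order ord" using diag by (rule diagonal_term_order_imp_term_order)
  show ?case
  proof (cases "t = 0")
    case True
    then show ?thesis using ord by (simp add: term_order_def)
  next
    case False
    then obtain c where c: "Poly_Mapping.lookup t c > 0" using poly_mapping_eqI[of t 0] by force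
    define i where "i = Min {i. row_margin t i > 0}"
    define j where "j = Max {j. col_margin t j > 0}"
    have "row_margin t (fst c) > 0" "col_margin t (snd c) > 0"
      using margin_pos[of t "fst c" "snd c"] c by auto
    then have i: "row_margin t i > 0" and j: "col_margin t j > 0"
      unfolding i_def j_def using Min_in[of "{i. row_margin t i > 0}"] Max_in[of "{j. col_margin t j > 0}"] by auto
    have i_min: "i \<le> i'" if "row_margin t i' > 0" for i' unfolding i_def by (rule Min_le) (use that in auto)
    have j_max: "j' \<le> j" if "col_margin t j' > 0" for j' unfolding j_def by (rule Max_ge) (use that in auto)
    have tij: "Poly_Mapping.lookup t (i, j) > 0"
    proof (rule ccontr)
      assume 0: "\<not> ?thesis"
      obtain j1 where j1: "Poly_Mapping.lookup t (i, j1) > 0" using margin_posE(1)[OF i] by blast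
      obtain i2 where i2: "Poly_Mapping.lookup t (i2, j) > 0" using margin_posE(2)[OF j] by blast
      have "j1 < j" using j_max[OF margin_pos(2)[OF j1]] j1 0 by (cases "j1 = j") auto
      moreover have "i < i2" using i_min[OF margin_pos(1)[OF i2]] i2 0 by (cases "i2 = i") auto
      moreover have keys: "(i, j1) \<in> Poly_Mapping.keys t" "(i2, j) \<in> Poly_Mapping.keys t"
        using j1 i2 by (auto simp: in_keys_iff)
      moreover have "\<not> (fst (i, j1) < fst (i2, j) \<and> snd (i, j1) < snd (i2, j))"
        using less.prems(1) keys unfolding weak_antichain_def by blast
      ultimately show False by simp
    qed
    obtain t' where t': "t = t' + Poly_Mapping.single (i, j) 1" using poly_mapping_split_single[OF tij] .
    have IH: "(t', v) \<in> ord"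
      if "\<And>i'. row_margin v i' + (if i = i' then 1 else 0) = row_margin u i'"
        "\<And>j'. col_margin v j' + (if j = j' then 1 else 0) = col_margin u j'" for v
    proof (rule less.hyps)
      show "mdeg t' < mdeg t" by (simp add: t' mdeg_add)
      show "weak_antichain t'"
      proof -
        have "Poly_Mapping.keys t' \<subseteq> Poly_Mapping.keys t" by (auto simp: t' in_keys_iff lookup_add)
        then show ?thesis using less.prems(1) unfolding weak_antichain_def by blast
      qed
      show "row_margin t' i' = row_margin v i'" for i'
        using less.prems(2)[of i'] that(1)[of i'] by (simp add: t' margin_add margin_single split: if_splits)
      show "col_margin t' j' = col_margin v j'" for j'
        using less.prems(3)[of j'] that(2)[of j'] by (simp add: t' margin_add margin_single split: if_splits)
    qed
    show ?thesis
    proof (cases "Poly_Mapping.lookup u (i, j) > 0")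
      case True
      then obtain u' where u': "u = u' + Poly_Mapping.single (i, j) 1" by (rule poly_mapping_split_single)
      have "(t', u') \<in> ord" by (rule IH) (simp_all add: u' margin_add margin_single)
      then show ?thesis unfolding t' u' by (rule term_order_add[OF ord])
    next
      case False
      have iu: "row_margin u i > 0" using i less.prems(2)[of i] by simp
      have ju: "col_margin u j > 0" using j less.prems(3)[of j] by simp
      obtain j1 where j1: "Poly_Mapping.lookup u (i, j1) > 0" using margin_posE(1)[OF iu] by blast
      obtain i2 where i2: "Poly_Mapping.lookup u (i2, j) > 0" using margin_posE(2)[OF ju] by blast
      have "col_margin t j1 > 0" "row_margin t i2 > 0"
        using margin_pos(2)[OF j1] margin_pos(1)[OF i2] less.prems by auto
      then have lt: "j1 < j" "i < i2"
        using j_max[of j1] i_min[of i2] j1 i2 False by (cases "j1 = j"; cases "i2 = i"; auto)+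
      obtain u1 where u1: "u = u1 + Poly_Mapping.single (i, j1) 1" using poly_mapping_split_single[OF j1] .
      have "Poly_Mapping.lookup u1 (i2, j) > 0" using i2 lt by (auto simp: u1 lookup_add lookup_single when_def split: if_splits)
      then obtain u2 where u2: "u1 = u2 + Poly_Mapping.single (i2, j) 1" by (rule poly_mapping_split_single)
      let ?v = "u2 + Poly_Mapping.single (i2, j1) 1"
      have "(t', ?v) \<in> ord" by (rule IH) (simp_all add: u1 u2 margin_add margin_single)
      then have 1: "(t, ?v + Poly_Mapping.single (i, j) 1) \<in> ord" unfolding t' by (rule term_order_add[OF ord])
      have "(Poly_Mapping.single (i, j) 1 + Poly_Mapping.single (i2, j1) 1 + u2,
          Poly_Mapping.single (i, j1) 1 + Poly_Mapping.single (i2, j) 1 + u2) \<in> ord"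
        using diagonal_term_order_swap[OF diag lt(2,1)] by (rule term_order_add[OF ord])
      then have "(?v + Poly_Mapping.single (i, j) 1, u) \<in> ord" by (simp add: u1 u2 ac_simps)
      then show ?thesis using 1 term_order_trans[OF ord] by blast
    qed
  qed
qed

section \<open>Jets along matrices of rank at most r\<close>

text \<open>The jet of \<open>f\<close> is \<open>f (U V + \<epsilon> Z)\<close> for generic matrices \<open>U\<close>, \<open>V\<close>, \<open>Z\<close> such that \<open>U V\<close> is a sum of
  \<open>r\<close> products of a column by a row. The variables \<open>U\<^sub>i\<^sub>k\<close>, \<open>V\<^sub>k\<^sub>j\<close>, \<open>Z\<^sub>i\<^sub>j\<close> are indexed by
  \<open>(Some i, None, k)\<close>, \<open>(None, Some j, k)\<close>, \<open>(Some i, Some j, 0)\<close>.\<close>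

definition level_mono :: "nat \<Rightarrow> nat \<Rightarrow> 'm \<times> 'n \<Rightarrow> ('m option \<times> 'n option \<times> nat \<Rightarrow>\<^sub>0 nat)" where
  "level_mono r k c = (if k < r
     then Poly_Mapping.single (Some (fst c), None, k) 1 + Poly_Mapping.single (None, Some (snd c), k) 1
     else Poly_Mapping.single (Some (fst c), Some (snd c), 0) 1)"

definition jet_var :: "nat \<Rightarrow> 'm \<times> 'n \<Rightarrow> ('m option \<times> 'n option \<times> nat, 'k::comm_ring_1) mpoly poly" where
  "jet_var r c = (\<Sum>k\<le>r. Polynomial.monom (Poly_Mapping.single (level_mono r k c) 1) (if k = r then 1 else 0))"

definition jet :: "nat \<Rightarrow> ('m \<times> 'n, 'k::comm_ring_1) mpoly \<Rightarrow>
    ('m option \<times> 'n option \<times> nat, 'k) mpoly poly" where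
  "jet r = poly_eval (\<lambda>a. [:Poly_Mapping.single 0 a:]) (jet_var r)"

definition vanishing_ideal :: "nat \<Rightarrow> nat \<Rightarrow> ('m \<times> 'n, 'k::comm_ring_1) mpoly set" where
  "vanishing_ideal r s = {f. [:0, 1:] ^ s dvd jet r f}"

lemma ring_map_pCons_const:
  "ring_map (\<lambda>a::'k::comm_ring_1. [:Poly_Mapping.single 0 a :: ('v, 'k) mpoly:])"
  by (rule ring_mapI) (simp_all add: single_add mult_single one_pCons mult.commute)

lemma ring_map_jet: "ring_map (jet r)"
  unfolding jet_def by (rule ring_map_poly_eval[OF ring_map_pCons_const])

definition copies :: "('v \<Rightarrow>\<^sub>0 nat) \<Rightarrow> ('v \<times> nat) set" where
  "copies u = Sigma (Poly_Mapping.keys u) (\<lambda>c. {..<Poly_Mapping.lookup u c})"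

lemma finite_copies: "finite (copies u)"
  unfolding copies_def by auto

lemma in_copies_iff: "x \<in> copies u \<longleftrightarrow> snd x < Poly_Mapping.lookup u (fst x)"
  by (cases x) (auto simp: copies_def in_keys_iff)

lemma mono_eval_copies: "mono_eval \<sigma> u = (\<Prod>x\<in>copies u. \<sigma> (fst x))"
proof -
  have "(\<Prod>x\<in>copies u. \<sigma> (fst x)) = (\<Prod>c\<in>Poly_Mapping.keys u. \<Prod>n<Poly_Mapping.lookup u c. \<sigma> c)"
    unfolding copies_def by (subst prod.Sigma) (auto simp: case_prod_beta)
  then show ?thesis by (simp add: mono_eval_def)
qed

lemma sum_copies:
  fixes g :: "'v \<Rightarrow> nat"
  shows "(\<Sum>x\<in>copies u. g (fst x)) = (\<Sum>c\<in>Poly_Mapping.keys u. Poly_Mapping.lookup u c * g c)"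
proof -
  have "(\<Sum>x\<in>copies u. g (fst x)) = (\<Sum>c\<in>Poly_Mapping.keys u. \<Sum>n<Poly_Mapping.lookup u c. g c)"
    unfolding copies_def by (subst sum.Sigma) (auto simp: case_prod_beta)
  then show ?thesis by simp
qed

lemma sum_copies_single: "(\<Sum>x\<in>copies u. Poly_Mapping.single (fst x) 1) = u"
proof (rule poly_mapping_eqI)
  fix c
  have "Poly_Mapping.lookup (\<Sum>x\<in>copies u. Poly_Mapping.single (fst x) (1::nat)) c =
      (\<Sum>x\<in>copies u. if fst x = c then 1 else 0)"
    by (simp only: lookup_sum lookup_single when_def)
  also have "\<dots> = (\<Sum>d\<in>Poly_Mapping.keys u. Poly_Mapping.lookup u d * (if d = c then 1 else 0))"
    by (rule sum_copies[of "\<lambda>d. if d = c then 1 else 0"])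
  also have "\<dots> = (\<Sum>d\<in>Poly_Mapping.keys u. if d = c then Poly_Mapping.lookup u d else 0)"
    by (rule sum.cong) auto
  also have "\<dots> = Poly_Mapping.lookup u c" by (subst sum.delta) (auto simp: in_keys_iff)
  finally show "Poly_Mapping.lookup (\<Sum>x\<in>copies u. Poly_Mapping.single (fst x) (1::nat)) c = Poly_Mapping.lookup u c" .
qed

definition coloring_mono :: "nat \<Rightarrow> ('m \<times> 'n \<Rightarrow>\<^sub>0 nat) \<Rightarrow> (('m \<times> 'n) \<times> nat \<Rightarrow> nat) \<Rightarrow>
    ('m option \<times> 'n option \<times> nat \<Rightarrow>\<^sub>0 nat)" where
  "coloring_mono r u \<kappa> = (\<Sum>x\<in>copies u. level_mono r (\<kappa> x) (fst x))"

definition coloring_order :: "nat \<Rightarrow> ('m \<times> 'n \<Rightarrow>\<^sub>0 nat) \<Rightarrow> (('m \<times> 'n) \<times> nat \<Rightarrow> nat) \<Rightarrow> nat" where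
  "coloring_order r u \<kappa> = (\<Sum>x\<in>copies u. if \<kappa> x = r then 1 else 0)"

definition color_part :: "('v \<Rightarrow>\<^sub>0 nat) \<Rightarrow> ('v \<times> nat \<Rightarrow> nat) \<Rightarrow> nat \<Rightarrow> ('v \<Rightarrow>\<^sub>0 nat)" where
  "color_part u \<kappa> k = (\<Sum>x\<in>{x\<in>copies u. \<kappa> x = k}. Poly_Mapping.single (fst x) 1)"

lemma prod_monom_single:
  "(\<Prod>x\<in>A. Polynomial.monom (Poly_Mapping.single (f x) (1::'k::comm_ring_1)) (g x)) =
    Polynomial.monom (Poly_Mapping.single (\<Sum>x\<in>A. f x :: 'v::comm_monoid_add) 1) (\<Sum>x\<in>A. g x)"
proof (induction A rule: infinite_finite_induct)
  case (insert x F)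
  then show ?case by (simp add: mult_monom mult_single)
qed (simp_all add: monom_0 one_pCons)

lemma mono_eval_jet_var:
  "mono_eval (jet_var r :: 'm \<times> 'n \<Rightarrow> ('m option \<times> 'n option \<times> nat, 'k::comm_ring_1) mpoly poly) u =
    (\<Sum>\<kappa>\<in>PiE (copies u) (\<lambda>_. {..r}).
      Polynomial.monom (Poly_Mapping.single (coloring_mono r u \<kappa>) 1) (coloring_order r u \<kappa>))"
proof -
  have "mono_eval (jet_var r :: 'm \<times> 'n \<Rightarrow> ('m option \<times> 'n option \<times> nat, 'k) mpoly poly) u =
    (\<Sum>\<kappa>\<in>PiE (copies u) (\<lambda>_. {..r}). \<Prod>x\<in>copies u.
      Polynomial.monom (Poly_Mapping.single (level_mono r (\<kappa> x) (fst x)) 1) (if \<kappa> x = r then 1 else 0))"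
    unfolding mono_eval_copies jet_var_def
    by (rule prod_sum_PiE) (auto simp: finite_copies)
  then show ?thesis
    by (simp only: prod_monom_single coloring_mono_def coloring_order_def)
qed

definition colorings :: "nat \<Rightarrow> ('m \<times> 'n \<Rightarrow>\<^sub>0 nat) \<Rightarrow> ('m option \<times> 'n option \<times> nat \<Rightarrow>\<^sub>0 nat) \<Rightarrow> nat \<Rightarrow>
    (('m \<times> 'n) \<times> nat \<Rightarrow> nat) set" where
  "colorings r u M e = {\<kappa>\<in>PiE (copies u) (\<lambda>_. {..r}). coloring_mono r u \<kappa> = M \<and> coloring_order r u \<kappa> = e}"

lemma lookup_coeff_mono_eval_jet_var:
  "Poly_Mapping.lookup (Polynomial.coeff
     (mono_eval (jet_var r :: 'm \<times> 'n \<Rightarrow> ('m option \<times> 'n option \<times> nat, 'k::comm_ring_1) mpoly poly) u) e) M =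
   of_nat (card (colorings r u M e))"
proof -
  let ?A = "PiE (copies u) (\<lambda>_. {..r})"
  have fin: "finite ?A" by (intro finite_PiE finite_copies) auto
  have "Poly_Mapping.lookup (Polynomial.coeff
      (Polynomial.monom (Poly_Mapping.single (coloring_mono r u \<kappa>) (1::'k)) (coloring_order r u \<kappa>)) e) M =
      (if \<kappa> \<in> {\<kappa>. coloring_mono r u \<kappa> = M \<and> coloring_order r u \<kappa> = e} then 1 else 0)" for \<kappa>
    by (simp add: lookup_single when_def)
  then have "Poly_Mapping.lookup (Polynomial.coeff
     (mono_eval (jet_var r :: 'm \<times> 'n \<Rightarrow> ('m option \<times> 'n option \<times> nat, 'k) mpoly poly) u) e) M =
     (\<Sum>\<kappa>\<in>?A. if \<kappa> \<in> {\<kappa>. coloring_mono r u \<kappa> = M \<and> coloring_order r u \<kappa> = e} then 1 else 0)"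
    by (simp only: mono_eval_jet_var coeff_sum lookup_sum)
  also have "\<dots> = of_nat (card (?A \<inter> {\<kappa>. coloring_mono r u \<kappa> = M \<and> coloring_order r u \<kappa> = e}))"
    using fin by (simp only: sum.inter_restrict[symmetric] sum_constant mult_1_right)
  also have "?A \<inter> {\<kappa>. coloring_mono r u \<kappa> = M \<and> coloring_order r u \<kappa> = e} = colorings r u M e"
    by (auto simp: colorings_def)
  finally show ?thesis .
qed

lemma lookup_const_mult:
  fixes p :: "('v, 'k::comm_ring_1) mpoly"
  shows "Poly_Mapping.lookup (Poly_Mapping.single 0 a * p) t = a * Poly_Mapping.lookup p t"
proof -
  have "Poly_Mapping.single 0 a * p =
      Poly_Mapping.single 0 a * (\<Sum>u\<in>Poly_Mapping.keys p. Poly_Mapping.single u (Poly_Mapping.lookup p u))"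
    by (rule arg_cong[where f = "\<lambda>q. Poly_Mapping.single 0 a * q"]) (rule poly_mapping_sum_singles)
  also have "\<dots> = (\<Sum>u\<in>Poly_Mapping.keys p. Poly_Mapping.single u (a * Poly_Mapping.lookup p u))"
    by (simp only: sum_distrib_left mult_single add_0)
  finally have "Poly_Mapping.lookup (Poly_Mapping.single 0 a * p) t =
      (\<Sum>u\<in>Poly_Mapping.keys p. if u = t then a * Poly_Mapping.lookup p u else 0)"
    by (simp add: lookup_sum lookup_single when_def)
  also have "\<dots> = a * Poly_Mapping.lookup p t" by (subst sum.delta) (auto simp: in_keys_iff)
  finally show ?thesis .
qed

lemma lookup_coeff_jet:
  fixes f :: "('m \<times> 'n, 'k::comm_ring_1) mpoly"
  shows "Poly_Mapping.lookup (Polynomial.coeff (jet r f) e) M =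
    (\<Sum>u\<in>Poly_Mapping.keys f. Poly_Mapping.lookup f u * of_nat (card (colorings r u M e)))"
proof -
  have c: "Polynomial.coeff ([:c:] * q) e = c * Polynomial.coeff q e"
    for c :: "('m option \<times> 'n option \<times> nat, 'k) mpoly" and q by simp
  show ?thesis
    by (simp only: jet_def poly_eval_def coeff_sum lookup_sum c lookup_const_mult lookup_coeff_mono_eval_jet_var)
qed

lemma sum_color_part:
  assumes "\<And>x. x \<in> copies u \<Longrightarrow> \<kappa> x \<le> r"
  shows "(\<Sum>k\<le>r. color_part u \<kappa> k) = u"
proof -
  have "(\<Sum>k\<le>r. color_part u \<kappa> k) = (\<Sum>x\<in>copies u. Poly_Mapping.single (fst x) 1)"
    unfolding color_part_def using assms by (intro sum.group) (auto simp: finite_copies)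
  then show ?thesis by (simp only: sum_copies_single)
qed

lemma margin_sum:
  "row_margin (sum f A) i = (\<Sum>x\<in>A. row_margin (f x) i)"
  "col_margin (sum f A) j = (\<Sum>x\<in>A. col_margin (f x) j)"
proof -
  have "row_margin 0 i = 0" "col_margin 0 j = 0" by (simp_all add: row_margin_def col_margin_def)
  then show "row_margin (sum f A) i = (\<Sum>x\<in>A. row_margin (f x) i)"
    "col_margin (sum f A) j = (\<Sum>x\<in>A. col_margin (f x) j)"
    by (induction A rule: infinite_finite_induct) (simp_all add: margin_add)
qed

lemma lookup_coloring_mono:
  fixes u :: "'m::finite \<times> 'n::finite \<Rightarrow>\<^sub>0 nat"
  shows "k < r \<Longrightarrow> Poly_Mapping.lookup (coloring_mono r u \<kappa>) (Some i, None, k) = row_margin (color_part u \<kappa> k) i"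
    and "k < r \<Longrightarrow> Poly_Mapping.lookup (coloring_mono r u \<kappa>) (None, Some j, k) = col_margin (color_part u \<kappa> k) j"
    and "(\<And>x. x \<in> copies u \<Longrightarrow> \<kappa> x \<le> r) \<Longrightarrow>
      Poly_Mapping.lookup (coloring_mono r u \<kappa>) (Some i, Some j, 0) = Poly_Mapping.lookup (color_part u \<kappa> r) (i, j)"
proof -
  have rm: "row_margin (Poly_Mapping.single c 1) i = (if fst c = i then 1 else 0)" for c :: "'m \<times> 'n"
    by (cases c) (simp add: margin_single)
  have cm: "col_margin (Poly_Mapping.single c 1) j = (if snd c = j then 1 else 0)" for c :: "'m \<times> 'n"
    by (cases c) (simp add: margin_single)
  note fin = finite_copies[of u]
  show "Poly_Mapping.lookup (coloring_mono r u \<kappa>) (Some i, None, k) = row_margin (color_part u \<kappa> k) i" if "k < r"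
    unfolding coloring_mono_def color_part_def margin_sum lookup_sum rm unfolding sum.inter_filter[OF fin]
    using that by (intro sum.cong refl) (auto simp: level_mono_def lookup_add lookup_single when_def)
  show "Poly_Mapping.lookup (coloring_mono r u \<kappa>) (None, Some j, k) = col_margin (color_part u \<kappa> k) j" if "k < r"
    unfolding coloring_mono_def color_part_def margin_sum lookup_sum cm unfolding sum.inter_filter[OF fin]
    using that by (intro sum.cong refl) (auto simp: level_mono_def lookup_add lookup_single when_def)
  show "Poly_Mapping.lookup (coloring_mono r u \<kappa>) (Some i, Some j, 0) = Poly_Mapping.lookup (color_part u \<kappa> r) (i, j)"
    if le: "\<And>x. x \<in> copies u \<Longrightarrow> \<kappa> x \<le> r"
    unfolding coloring_mono_def color_part_def lookup_sum unfolding sum.inter_filter[OF fin]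
  proof (intro sum.cong refl)
    fix x assume "x \<in> copies u"
    from le[OF this] show "Poly_Mapping.lookup (level_mono r (\<kappa> x) (fst x)) (Some i, Some j, 0) =
        (if \<kappa> x = r then Poly_Mapping.lookup (Poly_Mapping.single (fst x) 1) (i, j) else 0)"
      by (cases "fst x") (auto simp: level_mono_def lookup_add lookup_single when_def)
  qed
qed

lemma color_part_pos_iff:
  "Poly_Mapping.lookup (color_part u \<kappa> k) c > 0 \<longleftrightarrow> (\<exists>x\<in>copies u. fst x = c \<and> \<kappa> x = k)"
proof -
  have "Poly_Mapping.lookup (color_part u \<kappa> k) c = (\<Sum>x\<in>{x\<in>copies u. \<kappa> x = k}. if fst x = c then 1 else 0)"
    by (simp only: color_part_def lookup_sum lookup_single when_def)
  also have "\<dots> > 0 \<longleftrightarrow> (\<exists>x\<in>{x\<in>copies u. \<kappa> x = k}. fst x = c)"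
    using finite_copies[of u] by (subst neq0_conv[symmetric], subst sum_eq_0_iff) auto
  finally show ?thesis by blast
qed

lemma coloring_minimal:
  fixes t u :: "'m::{finite,linorder} \<times> 'n::{finite,linorder} \<Rightarrow>\<^sub>0 nat"
  assumes diag: "diagonal_term_order (generic_matrix :: 'm \<Rightarrow> 'n \<Rightarrow> ('m \<times> 'n, 'k::comm_ring_1) mpoly) ord"
    and lev: "\<And>c. lev c \<le> r"
    and anti: "\<And>c d. c \<in> Poly_Mapping.keys t \<Longrightarrow> d \<in> Poly_Mapping.keys t \<Longrightarrow> fst c < fst d \<Longrightarrow> snd c < snd d \<Longrightarrow>
      lev c = lev d \<Longrightarrow> lev c = r"
    and \<kappa>: "\<kappa> \<in> PiE (copies u) (\<lambda>_. {..r})"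
    and same: "coloring_mono r u \<kappa> = coloring_mono r t (\<lambda>x. lev (fst x))"
  shows "(t, u) \<in> ord" and "u = t \<Longrightarrow> \<kappa> = restrict (\<lambda>x. lev (fst x)) (copies t)"
proof -
  let ?lv = "\<lambda>x. lev (fst x)"
  have ord: "term_order ord" using diag by (rule diagonal_term_order_imp_term_order)
  have le: "\<kappa> x \<le> r" if "x \<in> copies u" for x using PiE_mem[OF \<kappa> that] by simp
  have parts: "(color_part t ?lv k, color_part u \<kappa> k) \<in> ord" if k: "k \<le> r" for k
  proof (cases "k = r")
    case True
    have "color_part t ?lv r = color_part u \<kappa> r"
    proof (rule poly_mapping_eqI)
      fix c
      show "Poly_Mapping.lookup (color_part t ?lv r) c = Poly_Mapping.lookup (color_part u \<kappa> r) c"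
        using lookup_coloring_mono(3)[of t ?lv r "fst c" "snd c"]
          lookup_coloring_mono(3)[of u \<kappa> r "fst c" "snd c", OF le] lev same by simp
    qed
    then show ?thesis using True term_order_refl[OF ord] by simp
  next
    case False
    then have k: "k < r" using k by simp
    show ?thesis
    proof (rule weak_antichain_minimal[OF diag])
      show "weak_antichain (color_part t ?lv k)"
        unfolding weak_antichain_def
      proof (intro ballI notI)
        fix c d assume cd: "c \<in> Poly_Mapping.keys (color_part t ?lv k)" "d \<in> Poly_Mapping.keys (color_part t ?lv k)"
          and lt: "fst c < fst d \<and> snd c < snd d"
        have key: "c \<in> Poly_Mapping.keys t \<and> lev c = k" if "c \<in> Poly_Mapping.keys (color_part t ?lv k)" for c
        proof -
          have "Poly_Mapping.lookup (color_part t ?lv k) c > 0" using that by (simp add: in_keys_iff)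
          then show ?thesis unfolding color_part_pos_iff by (auto simp: in_copies_iff in_keys_iff)
        qed
        show False using anti[of c d] key[OF cd(1)] key[OF cd(2)] lt k by simp
      qed
      show "row_margin (color_part t ?lv k) i = row_margin (color_part u \<kappa> k) i" for i
        unfolding lookup_coloring_mono(1)[OF k, symmetric] same ..
      show "col_margin (color_part t ?lv k) j = col_margin (color_part u \<kappa> k) j" for j
        unfolding lookup_coloring_mono(2)[OF k, symmetric] same ..
    qed
  qed
  have t: "(\<Sum>k\<le>r. color_part t ?lv k) = t" by (rule sum_color_part) (rule lev)
  have u: "(\<Sum>k\<le>r. color_part u \<kappa> k) = u" by (rule sum_color_part) (rule le)
  have "((\<Sum>k\<le>r. color_part t ?lv k), (\<Sum>k\<le>r. color_part u \<kappa> k)) \<in> ord"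
    by (rule term_order_sum_mono[OF ord]) (rule parts, simp)
  then show "(t, u) \<in> ord" by (simp only: t u)
  assume ut: "u = t"
  have "\<forall>k\<in>{..r}. color_part t ?lv k = color_part u \<kappa> k"
    by (rule term_order_sum_eq[OF ord]) (use parts t u ut in auto)
  then have eq: "color_part t ?lv k = color_part u \<kappa> k" if "k \<le> r" for k using that by blast
  show "\<kappa> = restrict ?lv (copies t)"
  proof (rule PiE_ext)
    show "\<kappa> \<in> PiE (copies t) (\<lambda>_. {..r})" using \<kappa> ut by simp
    show "restrict ?lv (copies t) \<in> PiE (copies t) (\<lambda>_. {..r})" using lev by auto
    fix x assume x: "x \<in> copies t"
    then have "Poly_Mapping.lookup (color_part u \<kappa> (\<kappa> x)) (fst x) > 0"
      unfolding color_part_pos_iff ut by blast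
    then have "Poly_Mapping.lookup (color_part t ?lv (\<kappa> x)) (fst x) > 0"
      using eq[of "\<kappa> x"] le[of x] x ut by simp
    then show "\<kappa> x = restrict ?lv (copies t) x"
      unfolding color_part_pos_iff using x by auto
  qed
qed

lemma dvd_coeff_zero:
  fixes g :: "'a::comm_ring_1 poly"
  assumes "[:0, 1:] ^ s dvd g" "e < s"
  shows "Polynomial.coeff g e = 0"
proof -
  obtain h where h: "g = [:0, 1:] ^ s * h" using assms(1) by (auto elim: dvdE)
  have "[:0, 1::'a:] ^ s = Polynomial.monom 1 s" by (simp add: monom_altdef)
  then show ?thesis using assms(2) by (simp add: h coeff_monom_mult)
qed

text \<open>The level sets below \<open>r\<close> single out a monomial of \<open>U V + \<epsilon> Z\<close> that arises from only one monomial
  of \<open>f\<close>, the leading one, and there in only one way. So this argument works in any characteristic.\<close>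

theorem vanishing_leading_monomial:
  fixes f :: "('m::{finite,linorder} \<times> 'n::{finite,linorder}, 'k::comm_ring_1) mpoly"
  assumes diag: "diagonal_term_order (generic_matrix :: 'm \<Rightarrow> 'n \<Rightarrow> ('m \<times> 'n, 'k) mpoly) ord"
    and f: "f \<in> vanishing_ideal r s" "f \<noteq> 0"
    and t: "t = leading_monomial ord f"
    and lev: "\<And>c. lev c \<le> r"
    and anti: "\<And>c d. c \<in> Poly_Mapping.keys t \<Longrightarrow> d \<in> Poly_Mapping.keys t \<Longrightarrow> fst c < fst d \<Longrightarrow> snd c < snd d \<Longrightarrow>
      lev c = lev d \<Longrightarrow> lev c = r"
  shows "s \<le> (\<Sum>c\<in>Poly_Mapping.keys t. if lev c = r then Poly_Mapping.lookup t c else 0)"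
proof -
  have ord: "term_order ord" using diag by (rule diagonal_term_order_imp_term_order)
  let ?lv = "\<lambda>x :: ('m \<times> 'n) \<times> nat. lev (fst x)"
  define M where "M = coloring_mono r t ?lv"
  define e where "e = coloring_order r t ?lv"
  have tk: "t \<in> Poly_Mapping.keys f" unfolding t using ord f(2) by (rule leading_monomial_in_keys)
  have others: "colorings r u M e = {}" if u: "u \<in> Poly_Mapping.keys f" "u \<noteq> t" for u
  proof (rule ccontr)
    assume "colorings r u M e \<noteq> {}"
    then obtain \<kappa> where \<kappa>: "\<kappa> \<in> PiE (copies u) (\<lambda>_. {..r})" "coloring_mono r u \<kappa> = coloring_mono r t ?lv"
      by (auto simp: colorings_def M_def)
    have "(t, u) \<in> ord" using diag lev anti \<kappa> by (rule coloring_minimal(1))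
    moreover have "(u, t) \<in> ord" unfolding t using ord f(2) u(1) by (rule leading_monomial_max)
    ultimately show False using u(2) term_order_antisym[OF ord] by blast
  qed
  have restr: "coloring_mono r t (restrict ?lv (copies t)) = M" "coloring_order r t (restrict ?lv (copies t)) = e"
    unfolding M_def e_def coloring_mono_def coloring_order_def by (intro sum.cong refl; simp)+
  have "colorings r t M e = {restrict ?lv (copies t)}"
  proof (rule subset_antisym; rule subsetI)
    fix \<kappa> assume "\<kappa> \<in> colorings r t M e"
    then have \<kappa>: "\<kappa> \<in> PiE (copies t) (\<lambda>_. {..r})" "coloring_mono r t \<kappa> = coloring_mono r t ?lv"
      by (auto simp: colorings_def M_def)
    have "\<kappa> = restrict ?lv (copies t)" using diag lev anti \<kappa> refl by (rule coloring_minimal(2))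
    then show "\<kappa> \<in> {restrict ?lv (copies t)}" by simp
  next
    fix \<kappa> assume "\<kappa> \<in> {restrict ?lv (copies t)}"
    then show "\<kappa> \<in> colorings r t M e" using restr lev by (auto simp: colorings_def)
  qed
  then have "card (colorings r t M e) = 1" by simp
  moreover have "Poly_Mapping.lookup (Polynomial.coeff (jet r f) e) M =
      (\<Sum>u\<in>{t}. Poly_Mapping.lookup f u * of_nat (card (colorings r u M e)))"
    unfolding lookup_coeff_jet using tk others by (intro sum.mono_neutral_right) auto
  ultimately have "Poly_Mapping.lookup (Polynomial.coeff (jet r f) e) M = Poly_Mapping.lookup f t" by simp
  then have "Polynomial.coeff (jet r f) e \<noteq> 0" using tk by (auto simp: in_keys_iff)
  then have "s \<le> e"
    using dvd_coeff_zero[of s "jet r f" e] f(1) by (auto simp: vanishing_ideal_def not_less[symmetric])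
  also have "e = (\<Sum>c\<in>Poly_Mapping.keys t. Poly_Mapping.lookup t c * (if lev c = r then 1 else 0))"
    unfolding e_def coloring_order_def by (rule sum_copies[of "\<lambda>c. if lev c = r then 1 else 0"])
  also have "\<dots> = (\<Sum>c\<in>Poly_Mapping.keys t. if lev c = r then Poly_Mapping.lookup t c else 0)"
    by (rule sum.cong) auto
  finally show ?thesis .
qed

section \<open>Leading monomials of the jet ideals\<close>

definition chains_mono :: "('v \<times> nat) list list \<Rightarrow> ('v \<Rightarrow>\<^sub>0 nat)" where
  "chains_mono cs = (\<Sum>c\<leftarrow>cs. \<Sum>x\<leftarrow>c. Poly_Mapping.single (fst x) 1)"

lemma truncate_chains:
  assumes "int s \<le> (\<Sum>c\<leftarrow>cs. int (length c) - int r)" "\<And>c. c \<in> set cs \<Longrightarrow> sorted_wrt R c"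
  shows "\<exists>cs' w. chains_mono cs = chains_mono cs' + w \<and> (\<forall>c\<in>set cs'. r < length c \<and> sorted_wrt R c) \<and>
    (\<Sum>c\<leftarrow>cs'. int (length c) - int r) = int s"
  using assms
proof (induction cs arbitrary: s)
  case Nil
  then show ?case by (intro exI[of _ "[]"]) (auto simp: chains_mono_def)
next
  case (Cons c cs)
  have mono_Cons: "chains_mono (c # cs) = (\<Sum>x\<leftarrow>c. Poly_Mapping.single (fst x) 1) + chains_mono cs" for c and cs :: "('a \<times> nat) list list"
    by (simp add: chains_mono_def)
  have mono_Nil: "chains_mono [] = (0 :: 'a \<Rightarrow>\<^sub>0 nat)" by (simp add: chains_mono_def)
  consider "length c \<le> r" | "s = 0" | "0 < s" "r + s \<le> length c" | "r < length c" "length c < r + s"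
    by linarith
  then show ?case
  proof cases
    case 1
    then have "int s \<le> (\<Sum>c\<leftarrow>cs. int (length c) - int r)" using Cons.prems(1) by simp
    then obtain cs' w where IH: "chains_mono cs = chains_mono cs' + w"
      "\<forall>c\<in>set cs'. r < length c \<and> sorted_wrt R c" "(\<Sum>c\<leftarrow>cs'. int (length c) - int r) = int s"
      using Cons.IH[of s] Cons.prems(2) by auto
    have "chains_mono (c # cs) = chains_mono cs' + (w + (\<Sum>x\<leftarrow>c. Poly_Mapping.single (fst x) 1))"
      by (simp only: mono_Cons IH(1) ac_simps)
    then show ?thesis using IH by blast
  next
    case 2
    then show ?thesis by (intro exI[of _ "[]"] exI[of _ "chains_mono (c # cs)"]) (simp add: mono_Nil)
  next
    case 3
    let ?d = "take (r + s) c"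
    have "c = ?d @ drop (r + s) c" by simp
    then have "(\<Sum>x\<leftarrow>c. Poly_Mapping.single (fst x) 1) = (\<Sum>x\<leftarrow>?d. Poly_Mapping.single (fst x) 1) +
        (\<Sum>x\<leftarrow>drop (r + s) c. Poly_Mapping.single (fst x) (1::nat))"
      by (metis map_append sum_list_append)
    then have "chains_mono (c # cs) = chains_mono [?d] +
        ((\<Sum>x\<leftarrow>drop (r + s) c. Poly_Mapping.single (fst x) 1) + chains_mono cs)"
      by (simp only: mono_Cons mono_Nil add_0_right add_0_left ac_simps)
    moreover have "\<forall>d\<in>set [?d]. r < length d \<and> sorted_wrt R d"
      using 3 Cons.prems(2)[of c] by (auto intro: sorted_wrt_take)
    moreover have "(\<Sum>d\<leftarrow>[?d]. int (length d) - int r) = int s" using 3 by simp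
    ultimately show ?thesis by blast
  next
    case 4
    then have "int (s - (length c - r)) \<le> (\<Sum>c\<leftarrow>cs. int (length c) - int r)" using Cons.prems(1) by simp
    then obtain cs' w where IH: "chains_mono cs = chains_mono cs' + w"
      "\<forall>c\<in>set cs'. r < length c \<and> sorted_wrt R c" "(\<Sum>c\<leftarrow>cs'. int (length c) - int r) = int (s - (length c - r))"
      using Cons.IH[of "s - (length c - r)"] Cons.prems(2) by auto
    have "chains_mono (c # cs) = chains_mono (c # cs') + w"
      by (simp only: mono_Cons IH(1) ac_simps)
    moreover have "\<forall>d\<in>set (c # cs'). r < length d \<and> sorted_wrt R d" using IH(2) 4 Cons.prems(2)[of c] by simp
    moreover have "(\<Sum>c\<leftarrow>c # cs'. int (length c) - int r) = int s" using IH(3) 4 by simp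
    ultimately show ?thesis by blast
  qed
qed

lemma chains_mono_distinct: "distinct (concat cs) \<Longrightarrow> chains_mono cs = (\<Sum>x\<in>set (concat cs). Poly_Mapping.single (fst x) 1)"
proof -
  assume "distinct (concat cs)"
  then have "(\<Sum>x\<in>set (concat cs). Poly_Mapping.single (fst x) (1::nat)) = (\<Sum>x\<leftarrow>concat cs. Poly_Mapping.single (fst x) 1)"
    by (simp only: sum_list_distinct_conv_sum_set)
  also have "\<dots> = chains_mono cs" unfolding chains_mono_def by (induction cs) simp_all
  finally show ?thesis by simp
qed

lemma minor_products_nonzero_leading:
  fixes r s :: nat
  assumes diag: "diagonal_term_order (generic_matrix :: 'm::linorder \<Rightarrow> 'n::linorder \<Rightarrow> ('m \<times> 'n, 'k::idom) mpoly) ord"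
    and s: "s \<ge> 1"
    and cs: "\<And>c. c \<in> set cs \<Longrightarrow> r < length c \<and>
      sorted_wrt (\<lambda>x y. fst (fst x) < fst (fst y) \<and> snd (fst x) < snd (fst y)) c"
    and sum: "(\<Sum>c\<leftarrow>cs. int (length c) - int r) = int s"
  shows "\<exists>g\<in>minor_products r s (generic_matrix :: 'm \<Rightarrow> 'n \<Rightarrow> ('m \<times> 'n, 'k) mpoly).
    g \<noteq> 0 \<and> leading_monomial ord g = chains_mono cs"
proof -
  let ?X = "generic_matrix :: 'm \<Rightarrow> 'n \<Rightarrow> ('m \<times> 'n, 'k) mpoly"
  define a where "a i k = fst (fst ((cs ! i) ! k))" for i k
  define b where "b i k = snd (fst ((cs ! i) ! k))" for i k
  define f where "f i = minor ?X (length (cs ! i)) (a i) (b i)" for i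
  have ord: "term_order ord" using diag by (rule diagonal_term_order_imp_term_order)
  have mono: "strict_mono_on {..<length (cs ! i)} (a i)" "strict_mono_on {..<length (cs ! i)} (b i)"
    if "i < length cs" for i
    using cs[OF nth_mem[OF that]] unfolding strict_mono_on_def a_def b_def by (auto simp: sorted_wrt_iff_nth_less)
  then have inj: "inj_on (a i) {..<length (cs ! i)}" "inj_on (b i) {..<length (cs ! i)}" if "i < length cs" for i
    using that by (blast intro: strict_mono_on_imp_inj_on)+
  have nonzero: "f i \<noteq> 0" if "i < length cs" for i
    unfolding f_def by (rule minor_generic_nonzero[OF inj[OF that]])
  have lead: "leading_monomial ord (f i) = (\<Sum>x\<leftarrow>cs ! i. Poly_Mapping.single (fst x) 1)" if "i < length cs" for i
    unfolding f_def leading_monomial_minor[OF diag mono[OF that]] diag_mono_def a_def b_def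
    by (simp add: sum_list_sum_nth atLeast0LessThan)
  have "leading_monomial ord (\<Prod>i<length cs. f i) = (\<Sum>i<length cs. leading_monomial ord (f i))"
    by (rule leading_monomial_prod[OF ord]) (use nonzero in auto)
  also have "\<dots> = (\<Sum>i<length cs. \<Sum>x\<leftarrow>cs ! i. Poly_Mapping.single (fst x) 1)"
    by (rule sum.cong) (simp_all only: lead lessThan_iff)
  also have "\<dots> = chains_mono cs" by (simp add: chains_mono_def sum_list_sum_nth atLeast0LessThan)
  finally have L: "leading_monomial ord (\<Prod>i<length cs. f i) = chains_mono cs" .
  have N: "(\<Prod>i<length cs. f i) \<noteq> 0" by (rule mpoly_prod_nonzero[OF ord]) (use nonzero in auto)
  have "f i \<in> minors_from (r + 1) ?X" if "i < length cs" for i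
  proof -
    have "r + 1 \<le> length (cs ! i)" using cs[OF nth_mem[OF that]] by simp
    then show ?thesis using mono[OF that] unfolding minors_from_def minors_def f_def by auto
  qed
  moreover have "length cs \<ge> 1" using sum s by (cases cs) auto
  moreover have "(\<Sum>i<length cs. int (total_degree (f i)) - int r) = int s"
  proof -
    have "(\<Sum>i<length cs. int (total_degree (f i)) - int r) = (\<Sum>i<length cs. int (length (cs ! i)) - int r)"
      by (rule sum.cong) (simp_all add: f_def total_degree_minor_generic inj)
    then show ?thesis using sum by (simp add: sum_list_sum_nth atLeast0LessThan)
  qed
  ultimately have "(\<Prod>i<length cs. f i) \<in> minor_products r s ?X"
    unfolding minor_products_def by blast
  then show ?thesis using L N by blast
qed

text \<open>By \<open>vanishing_leading_monomial\<close>, the copies of cells in a leading monomial cannot be covered up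
  to fewer than \<open>s\<close> of them by \<open>r\<close> antichains, so the duality provides the chains of a product of minors.\<close>

theorem leading_monomial_minor_products:
  fixes f :: "('m::{finite,linorder} \<times> 'n::{finite,linorder}, 'k::idom) mpoly"
  assumes diag: "diagonal_term_order (generic_matrix :: 'm \<Rightarrow> 'n \<Rightarrow> ('m \<times> 'n, 'k) mpoly) ord"
    and s: "s \<ge> 1" and f: "f \<in> vanishing_ideal r s" "f \<noteq> 0"
  obtains g w where "g \<in> minor_products r s (generic_matrix :: 'm \<Rightarrow> 'n \<Rightarrow> ('m \<times> 'n, 'k) mpoly)"
    "g \<noteq> 0" "leading_monomial ord f = leading_monomial ord g + w"
proof -
  define t where "t = leading_monomial ord f"
  define P where "P = copies t"
  define R where "R = (\<lambda>(x :: ('m \<times> 'n) \<times> nat) (y :: ('m \<times> 'n) \<times> nat). fst (fst x) < fst (fst y) \<and> snd (fst x) < snd (fst y))"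
  have fin: "finite P" unfolding P_def by (rule finite_copies)
  have tr: "transp R" and irr: "irreflp R" unfolding R_def by (auto intro!: transpI irreflpI)
  obtain lev cs where lev: "\<And>p. lev p \<le> r"
    and anti: "\<And>p q. p \<in> P \<Longrightarrow> q \<in> P \<Longrightarrow> R p q \<Longrightarrow> lev p = lev q \<Longrightarrow> lev p = r"
    and cs: "distinct (concat cs)" "set (concat cs) \<subseteq> P" "\<And>c. c \<in> set cs \<Longrightarrow> sorted_wrt R c"
    and card: "int (card {p\<in>P. lev p = r}) \<le> (\<Sum>c\<leftarrow>cs. int (length c) - int r)"
    using greene_kleitman[OF fin tr irr, of r] by blast
  define low where "low c n \<longleftrightarrow> (c, n) \<in> P \<and> lev (c, n) < r" for c n
  define lev' where "lev' c = (if \<exists>n. low c n then lev (c, SOME n. low c n) else r)" for c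
  have low: "\<exists>n. (c, n) \<in> P \<and> lev (c, n) = lev' c" if "lev' c \<noteq> r" for c
  proof -
    have ex: "\<exists>n. low c n" using that by (cases "\<exists>n. low c n") (simp_all add: lev'_def)
    then have "low c (SOME n. low c n)" by (rule someI_ex)
    then show ?thesis using ex unfolding lev'_def low_def by auto
  qed
  have "s \<le> (\<Sum>c\<in>Poly_Mapping.keys t. if lev' c = r then Poly_Mapping.lookup t c else 0)"
  proof (rule vanishing_leading_monomial[OF diag f t_def])
    show "lev' c \<le> r" for c using lev by (simp add: lev'_def)
    show "lev' c = r" if cd: "fst c < fst d" "snd c < snd d" "lev' c = lev' d" for c d
    proof (rule ccontr)
      assume "lev' c \<noteq> r"
      then obtain n m where "(c, n) \<in> P" "lev (c, n) = lev' c" "(d, m) \<in> P" "lev (d, m) = lev' d"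
        using low[of c] low[of d] cd(3) by auto
      then show False using anti[of "(c, n)" "(d, m)"] cd \<open>lev' c \<noteq> r\<close> by (simp add: R_def)
    qed
  qed
  also have "\<dots> = (\<Sum>c\<in>Poly_Mapping.keys t. Poly_Mapping.lookup t c * (if lev' c = r then 1 else 0))"
    by (rule sum.cong) auto
  also have "\<dots> = (\<Sum>x\<in>P. if lev' (fst x) = r then 1 else 0)"
    unfolding P_def by (rule sum_copies[symmetric])
  also have "\<dots> = card {x\<in>P. lev' (fst x) = r}" using fin by (simp add: sum.inter_filter[symmetric])
  also have "\<dots> \<le> card {p\<in>P. lev p = r}"
  proof (rule card_mono)
    show "{x\<in>P. lev' (fst x) = r} \<subseteq> {p\<in>P. lev p = r}"
    proof
      fix x assume x: "x \<in> {x\<in>P. lev' (fst x) = r}"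
      have "\<not> lev x < r"
      proof
        assume "lev x < r"
        then have ex: "\<exists>n. low (fst x) n" using x by (intro exI[of _ "snd x"]) (simp add: low_def)
        then have "low (fst x) (SOME n. low (fst x) n)" by (rule someI_ex)
        then show False using x ex unfolding lev'_def low_def by simp
      qed
      then show "x \<in> {p\<in>P. lev p = r}" using x lev[of x] by simp
    qed
  qed (use fin in simp)
  finally have "int s \<le> (\<Sum>c\<leftarrow>cs. int (length c) - int r)" using card by linarith
  then obtain cs' w where cs': "chains_mono cs = chains_mono cs' + w"
      "\<forall>c\<in>set cs'. r < length c \<and> sorted_wrt R c" "(\<Sum>c\<leftarrow>cs'. int (length c) - int r) = int s"
    using truncate_chains[of s r cs R] cs(3) by blast
  obtain g where g: "g \<in> minor_products r s (generic_matrix :: 'm \<Rightarrow> 'n \<Rightarrow> ('m \<times> 'n, 'k) mpoly)"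
    "g \<noteq> 0" "leading_monomial ord g = chains_mono cs'"
    using minor_products_nonzero_leading[OF diag s _ cs'(3)] cs'(2) unfolding R_def by blast
  have "t = (\<Sum>x\<in>P. Poly_Mapping.single (fst x) 1)" unfolding P_def by (rule sum_copies_single[symmetric])
  also have "\<dots> = (\<Sum>x\<in>set (concat cs). Poly_Mapping.single (fst x) 1) + (\<Sum>x\<in>P - set (concat cs). Poly_Mapping.single (fst x) 1)"
    using sum.subset_diff[OF cs(2) fin] by (simp only: add.commute)
  also have "\<dots> = leading_monomial ord g + (w + (\<Sum>x\<in>P - set (concat cs). Poly_Mapping.single (fst x) 1))"
    by (simp only: chains_mono_distinct[OF cs(1), symmetric] cs'(1) g(3) add.assoc)
  finally show thesis using that[OF g(1,2)] unfolding t_def by blast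
qed

section \<open>Minors have high order along matrices of small rank\<close>

lemma uminus_zero_mat: "- 0\<^sub>m n m = (0\<^sub>m n m :: 'a::group_add mat)"
  by (intro eq_matI) auto

text \<open>Multiplying the first \<open>r\<close> columns of the block matrix with blocks \<open>1\<close>, \<open>-V\<close>, \<open>U\<close>, \<open>e Z\<close>, whose
  determinant is that of \<open>U V + e Z\<close>, by \<open>e\<close> makes its last \<open>t\<close> rows divisible by \<open>e\<close>.\<close>

lemma det_low_rank_perturbation:
  fixes e :: "'a::idom"
  assumes U: "U \<in> carrier_mat t r" and V: "V \<in> carrier_mat r t" and Z: "Z \<in> carrier_mat t t"
  shows "\<exists>d. det (U * V + e \<cdot>\<^sub>m Z) * e ^ r = e ^ t * d"
proof -
  let ?B = "four_block_mat (1\<^sub>m r) (- V) U (e \<cdot>\<^sub>m Z)"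
  let ?L = "four_block_mat (1\<^sub>m r) (0\<^sub>m r t) U (1\<^sub>m t)"
  let ?R = "four_block_mat (1\<^sub>m r) (- V) (0\<^sub>m t r) (U * V + e \<cdot>\<^sub>m Z)"
  let ?S = "four_block_mat (e \<cdot>\<^sub>m 1\<^sub>m r) (0\<^sub>m r t) (0\<^sub>m t r) (1\<^sub>m t)"
  let ?T = "four_block_mat (1\<^sub>m r) (0\<^sub>m r t) (0\<^sub>m t r) (e \<cdot>\<^sub>m 1\<^sub>m t)"
  let ?W = "four_block_mat (e \<cdot>\<^sub>m 1\<^sub>m r) (- V) U Z"
  have UV: "U * V \<in> carrier_mat t t" and eZ: "e \<cdot>\<^sub>m Z \<in> carrier_mat t t" and mV: "- V \<in> carrier_mat r t"
    using assms by auto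
  note carr = assms UV eZ mV
  have cancel: "U * - V + (U * V + e \<cdot>\<^sub>m Z) = e \<cdot>\<^sub>m Z"
  proof -
    have "U * - V = - (U * V)" using U V by simp
    moreover have "dim_row U = t" "dim_col V = t" "dim_row Z = t" "dim_col Z = t" using assms by auto
    ultimately show ?thesis by (intro eq_matI) auto
  qed
  have "?L * ?R = ?B"
    using carr cancel by (subst mult_four_block_mat[where ?nr1.0 = r and ?n1.0 = r and ?n2.0 = t and ?nr2.0 = t and ?nc1.0 = r and ?nc2.0 = t]) auto
  moreover have "det (?L * ?R) = det ?L * det ?R" using carr by (intro det_mult[where n = "r + t"]) auto
  moreover have "det ?L = 1" using carr by (subst det_four_block_mat_upper_right_zero[where n = r and m = t]) auto
  moreover have "det ?R = det (U * V + e \<cdot>\<^sub>m Z)"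
    using carr by (subst det_four_block_mat_lower_left_zero[where n = r and m = t]) auto
  ultimately have B: "det ?B = det (U * V + e \<cdot>\<^sub>m Z)" by simp
  have "?B * ?S = four_block_mat (e \<cdot>\<^sub>m 1\<^sub>m r) (- V) (e \<cdot>\<^sub>m U) (e \<cdot>\<^sub>m Z)"
    using carr by (subst mult_four_block_mat[where ?nr1.0 = r and ?n1.0 = r and ?n2.0 = t and ?nr2.0 = t and ?nc1.0 = r and ?nc2.0 = t]) auto
  moreover have "e \<cdot>\<^sub>m 1\<^sub>m t * U = e \<cdot>\<^sub>m U" "e \<cdot>\<^sub>m 1\<^sub>m t * Z = e \<cdot>\<^sub>m Z"
    using U Z by (simp_all add: mult_smult_assoc_mat[of _ t t])
  then have "?T * ?W = four_block_mat (e \<cdot>\<^sub>m 1\<^sub>m r) (- V) (e \<cdot>\<^sub>m U) (e \<cdot>\<^sub>m Z)"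
    using carr by (subst mult_four_block_mat[where ?nr1.0 = r and ?n1.0 = r and ?n2.0 = t and ?nr2.0 = t and ?nc1.0 = r and ?nc2.0 = t]) (auto simp: uminus_zero_mat)
  ultimately have "det (?B * ?S) = det (?T * ?W)" by simp
  moreover have "det (?B * ?S) = det ?B * det ?S" using carr by (intro det_mult[where n = "r + t"]) auto
  moreover have "det (?T * ?W) = det ?T * det ?W" using carr by (intro det_mult[where n = "r + t"]) auto
  moreover have "det ?S = e ^ r"
    using carr by (subst det_four_block_mat_lower_left_zero[where n = r and m = t]) auto
  moreover have "det ?T = e ^ t"
    using carr by (subst det_four_block_mat_lower_left_zero[where n = r and m = t]) auto
  ultimately have "det (U * V + e \<cdot>\<^sub>m Z) * e ^ r = e ^ t * det ?W" using B by simp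
  then show ?thesis by blast
qed

lemma jet_var_expand:
  "(jet_var r (i, j) :: ('m option \<times> 'n option \<times> nat, 'k::comm_ring_1) mpoly poly) =
    (\<Sum>k<r. [:var (Some i, None, k):] * [:var (None, Some j, k):]) + [:0, 1:] * [:var (Some i, Some j, 0):]"
proof -
  have "{..r} = insert r {..<r}" by auto
  then have "(jet_var r (i, j) :: ('m option \<times> 'n option \<times> nat, 'k) mpoly poly) =
      (\<Sum>k<r. Polynomial.monom (Poly_Mapping.single (level_mono r k (i, j)) 1) 0) +
      Polynomial.monom (Poly_Mapping.single (level_mono r r (i, j)) 1) 1"
    by (simp add: jet_var_def add.commute)
  also have "(\<Sum>k<r. Polynomial.monom (Poly_Mapping.single (level_mono r k (i, j)) (1::'k)) 0) =
      (\<Sum>k<r. [:var (Some i, None, k):] * [:var (None, Some j, k):])"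
    by (intro sum.cong refl) (simp add: monom_0 level_mono_def var_def mult_single add.commute)
  also have "Polynomial.monom (Poly_Mapping.single (level_mono r r (i, j)) (1::'k)) 1 =
      [:0, 1:] * [:var (Some i, Some j, 0):]"
    by (simp add: level_mono_def var_def monom_altdef)
  finally show ?thesis .
qed

lemma minor_in_vanishing_ideal:
  fixes a :: "nat \<Rightarrow> 'm::linorder" and b :: "nat \<Rightarrow> 'n::linorder"
  assumes "r \<le> t"
  shows "minor (generic_matrix :: 'm \<Rightarrow> 'n \<Rightarrow> ('m \<times> 'n, 'k::idom) mpoly) t a b \<in> vanishing_ideal r (t - r)"
proof -
  let ?e = "[:0, 1:] :: ('m option \<times> 'n option \<times> nat, 'k) mpoly poly"
  let ?X = "generic_matrix :: 'm \<Rightarrow> 'n \<Rightarrow> ('m \<times> 'n, 'k) mpoly"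
  define U where "U = mat t r (\<lambda>(i, k). [:var (Some (a i), None, k) :: ('m option \<times> 'n option \<times> nat, 'k) mpoly:])"
  define V where "V = mat r t (\<lambda>(k, j). [:var (None, Some (b j), k) :: ('m option \<times> 'n option \<times> nat, 'k) mpoly:])"
  define Z where "Z = mat t t (\<lambda>(i, j). [:var (Some (a i), Some (b j), 0) :: ('m option \<times> 'n option \<times> nat, 'k) mpoly:])"
  have carr: "U \<in> carrier_mat t r" "V \<in> carrier_mat r t" "Z \<in> carrier_mat t t"
    by (auto simp: U_def V_def Z_def)
  have "jet r (minor ?X t a b) = minor (\<lambda>i j. jet_var r (i, j)) t a b"
    by (simp only: ring_map_minor[OF ring_map_jet] generic_matrix_def)
       (simp only: jet_def poly_eval_var[OF ring_map_pCons_const])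
  also have "\<dots> = det (U * V + ?e \<cdot>\<^sub>m Z)"
    unfolding minor_def
  proof (intro arg_cong[where f = det] eq_matI)
    fix i j assume "i < dim_row (U * V + ?e \<cdot>\<^sub>m Z)" "j < dim_col (U * V + ?e \<cdot>\<^sub>m Z)"
    then have ij: "i < t" "j < t" by (auto simp: Z_def)
    then show "mat t t (\<lambda>(i, j). jet_var r (a i, b j)) $$ (i, j) = (U * V + ?e \<cdot>\<^sub>m Z) $$ (i, j)"
      by (simp add: jet_var_expand U_def V_def Z_def scalar_prod_def atLeast0LessThan del: mult_pCons_left mult_pCons_right)
  qed (auto simp: Z_def)
  finally have "\<exists>d. jet r (minor ?X t a b) * ?e ^ r = ?e ^ t * d"
    using det_low_rank_perturbation[OF carr, of ?e] by simp
  then obtain d where "jet r (minor ?X t a b) * ?e ^ r = ?e ^ t * d" by blast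
  also have "?e ^ t * d = (?e ^ (t - r) * d) * ?e ^ r"
    using assms by (simp only: mult.assoc mult.commute[of d] power_add[symmetric] le_add_diff_inverse2)
      (simp only: mult.assoc[symmetric] power_add[symmetric] le_add_diff_inverse2)
  finally have "jet r (minor ?X t a b) = ?e ^ (t - r) * d" by simp
  then show ?thesis by (simp add: vanishing_ideal_def)
qed

lemma minor_productsE:
  assumes "g \<in> minor_products r s X"
  obtains l :: nat and f where "l \<ge> 1" "g = (\<Prod>i<l. f i)" "\<And>i. i < l \<Longrightarrow> f i \<in> minors_from (r + 1) X"
    "(\<Sum>i<l. int (total_degree (f i)) - int r) = int s"
proof -
  have "\<exists>(l::nat) f. g = (\<Prod>i<l. f i) \<and> l \<ge> 1 \<and> (\<forall>i<l. f i \<in> minors_from (r + 1) X) \<and>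
      (\<Sum>i<l. int (total_degree (f i)) - int r) = int s"
    using assms unfolding minor_products_def mem_Collect_eq .
  then show thesis
  proof (elim exE conjE)
    fix l :: nat and f
    assume "g = (\<Prod>i<l. f i)" "l \<ge> 1" "\<forall>i<l. f i \<in> minors_from (r + 1) X"
      "(\<Sum>i<l. int (total_degree (f i)) - int r) = int s"
    then show thesis by (intro that[of l f]) simp_all
  qed
qed

lemma minor_products_subset_vanishing_ideal:
  "minor_products r s (generic_matrix :: 'm::linorder \<Rightarrow> 'n::linorder \<Rightarrow> ('m \<times> 'n, 'k::idom) mpoly) \<subseteq> vanishing_ideal r s"
proof
  let ?X = "generic_matrix :: 'm \<Rightarrow> 'n \<Rightarrow> ('m \<times> 'n, 'k) mpoly"
  fix g assume "g \<in> minor_products r s ?X"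
  then obtain l :: nat and f where "l \<ge> 1" and g: "g = (\<Prod>i<l. f i)"
    and f: "\<And>i. i < l \<Longrightarrow> f i \<in> minors_from (r + 1) ?X"
    and sum: "(\<Sum>i<l. int (total_degree (f i)) - int r) = int s"
    by (rule minor_productsE) (rule that)
  have fi: "r \<le> total_degree (f i) \<and> f i \<in> vanishing_ideal r (total_degree (f i) - r)" if i: "i < l" for i
  proof -
    obtain t a b where t: "r + 1 \<le> t" "f i = minor ?X t a b" "strict_mono_on {..<t} a" "strict_mono_on {..<t} b"
      using f[OF i] by (auto simp: minors_from_def minors_def)
    then have "total_degree (f i) = t"
      by (simp add: total_degree_minor_generic strict_mono_on_imp_inj_on)
    then show ?thesis using t minor_in_vanishing_ideal[of r t a b] by simp
  qed
  have "int s = int (\<Sum>i<l. total_degree (f i) - r)"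
    unfolding sum[symmetric] of_nat_sum by (intro sum.cong refl) (use fi in \<open>simp add: of_nat_diff\<close>)
  then have s: "s = (\<Sum>i<l. total_degree (f i) - r)" by (simp only: of_nat_eq_iff)
  have "[:0, 1:] ^ s = (\<Prod>i<l. [:0, 1:] ^ (total_degree (f i) - r))"
    unfolding s by (rule power_sum)
  also have "\<dots> dvd (\<Prod>i<l. jet r (f i))"
    by (rule prod_dvd_prod) (use fi in \<open>auto simp: vanishing_ideal_def\<close>)
  also have "\<dots> = jet r g" unfolding g by (rule ring_map_prod[OF ring_map_jet, symmetric])
  finally show "g \<in> vanishing_ideal r s" by (simp add: vanishing_ideal_def)
qed

section \<open>Generators of the jet ideals\<close>

lemma is_ideal_vanishing_ideal: "is_ideal (vanishing_ideal r s)"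
  unfolding ring_module.subspace_def vanishing_ideal_def
  by (auto simp: ring_map_0[OF ring_map_jet] ring_map_add[OF ring_map_jet] ring_map_mult[OF ring_map_jet]
      intro: dvd_add dvd_mult)

lemma minors_fromE:
  assumes "f \<in> minors_from (r + 1) (generic_matrix :: 'm::linorder \<Rightarrow> 'n::linorder \<Rightarrow> ('m \<times> 'n, 'k::comm_ring_1) mpoly)"
  obtains t a b where "r < t" "strict_mono_on {..<t} a" "strict_mono_on {..<t} b"
    "f = minor (generic_matrix :: 'm \<Rightarrow> 'n \<Rightarrow> ('m \<times> 'n, 'k) mpoly) t a b" "total_degree f = t" "f \<noteq> 0"
proof -
  obtain t a b where t: "r + 1 \<le> t" "f = minor (generic_matrix :: 'm \<Rightarrow> 'n \<Rightarrow> ('m \<times> 'n, 'k) mpoly) t a b"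
    "strict_mono_on {..<t} a" "strict_mono_on {..<t} b"
    using assms by (auto simp: minors_from_def minors_def)
  have inj: "inj_on a {..<t}" "inj_on b {..<t}" using t(3,4) by (auto intro: strict_mono_on_imp_inj_on)
  show thesis
    by (rule that[of t a b]) (use t total_degree_minor_generic[OF inj, where 'k = 'k] minor_generic_nonzero[OF inj, where 'k = 'k] in auto)
qed

definition homogeneous :: "('v, 'k::zero) mpoly \<Rightarrow> bool" where
  "homogeneous p \<longleftrightarrow> (\<exists>d. \<forall>t\<in>Poly_Mapping.keys p. mdeg t = d)"

lemma homogeneous_mult:
  fixes p q :: "('v, 'k::comm_ring_1) mpoly"
  shows "homogeneous p \<Longrightarrow> homogeneous q \<Longrightarrow> homogeneous (p * q)"
  unfolding homogeneous_def
proof (elim exE)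
  fix d e
  assume "\<forall>t\<in>Poly_Mapping.keys p. mdeg t = d" "\<forall>t\<in>Poly_Mapping.keys q. mdeg t = e"
  then have "\<forall>t\<in>Poly_Mapping.keys (p * q). mdeg t = d + e"
    using keys_mult[of p q] by (auto simp: mdeg_add)
  then show "\<exists>d. \<forall>t\<in>Poly_Mapping.keys (p * q). mdeg t = d" by blast
qed

lemma homogeneous_prod:
  fixes f :: "'i \<Rightarrow> ('v, 'k::comm_ring_1) mpoly"
  shows "(\<And>x. x \<in> A \<Longrightarrow> homogeneous (f x)) \<Longrightarrow> homogeneous (prod f A)"
proof (induction A rule: infinite_finite_induct)
  case (insert x A)
  then show ?case by (simp add: homogeneous_mult)
qed (simp_all add: homogeneous_def)

lemma homogeneous_minor_products:
  fixes g :: "('m::linorder \<times> 'n::linorder, 'k::comm_ring_1) mpoly"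
  assumes "g \<in> minor_products r s (generic_matrix :: 'm \<Rightarrow> 'n \<Rightarrow> ('m \<times> 'n, 'k) mpoly)"
  shows "homogeneous g"
proof -
  obtain l :: nat and f where "l \<ge> 1" and g: "g = (\<Prod>i<l. f i)"
    and f: "\<And>i. i < l \<Longrightarrow> f i \<in> minors_from (r + 1) (generic_matrix :: 'm \<Rightarrow> 'n \<Rightarrow> ('m \<times> 'n, 'k) mpoly)"
    and "(\<Sum>i<l. int (total_degree (f i)) - int r) = int s"
    using assms by (rule minor_productsE) (rule that)
  show ?thesis unfolding g
  proof (rule homogeneous_prod)
    fix i assume "i \<in> {..<l}"
    then obtain t a b where "f i = minor (generic_matrix :: 'm \<Rightarrow> 'n \<Rightarrow> ('m \<times> 'n, 'k) mpoly) t a b"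
      using minors_fromE[OF f[of i]] by blast
    then show "homogeneous (f i)"
      unfolding homogeneous_def using mdeg_keys_minor_generic[where t = t and a = a and b = b and 'k = 'k] by auto
  qed
qed

text \<open>Division by homogeneous polynomials does not raise the degree, so it terminates because there
  are only finitely many monomials of bounded degree.\<close>

lemma mem_ideal_gen_by_reduction:
  fixes V G :: "('v::finite, 'k::field) mpoly set"
  assumes ord: "term_order ord" and V: "is_ideal V" and GV: "G \<subseteq> V"
    and lead: "\<And>f. f \<in> V \<Longrightarrow> f \<noteq> 0 \<Longrightarrow> \<exists>g\<in>G. \<exists>w. g \<noteq> 0 \<and> homogeneous g \<and> leading_monomial ord f = leading_monomial ord g + w"
    and "f \<in> V"
  shows "f \<in> ideal_gen G"
proof -
  define d where "d = Max (mdeg ` Poly_Mapping.keys f)"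
  have "f \<in> ideal_gen G"
    if "f \<in> V" "\<forall>u\<in>Poly_Mapping.keys f. mdeg u \<le> d" for f
    using that
  proof (induction "card {u. mdeg u \<le> d \<and> (u, leading_monomial ord f) \<in> ord}" arbitrary: f rule: less_induct)
    case less
    show ?case
    proof (cases "f = 0")
      case False
      let ?l = "leading_monomial ord f"
      obtain g w where g: "g \<in> G" "g \<noteq> 0" "homogeneous g" and lw: "?l = leading_monomial ord g + w"
        using lead[OF less.prems(1) False] by blast
      define c where "c = Poly_Mapping.lookup f ?l / Poly_Mapping.lookup g (leading_monomial ord g)"
      define q where "q = Poly_Mapping.single w c"
      have lf: "?l \<in> Poly_Mapping.keys f" using ord False by (rule leading_monomial_in_keys)
      have lg: "leading_monomial ord g \<in> Poly_Mapping.keys g" using ord g(2) by (rule leading_monomial_in_keys)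
      have c: "c \<noteq> 0" using lf lg by (auto simp: c_def in_keys_iff)
      have q0: "q \<noteq> 0" and kq: "Poly_Mapping.keys q = {w}" using c mpoly_keys_nonempty
        by (auto simp: q_def) (metis c lookup_single_eq lookup_zero)
      have lq: "leading_monomial ord q = w"
        by (rule leading_monomialI[OF ord]) (auto simp: kq term_order_refl[OF ord])
      have lqg: "leading_monomial ord (q * g) = ?l"
        using leading_monomial_mult[OF ord q0 g(2)] by (simp add: lq lw add.commute)
      have lookup_q: "Poly_Mapping.lookup q w = c" by (simp add: q_def)
      have "Poly_Mapping.lookup (q * g) ?l = c * Poly_Mapping.lookup g (leading_monomial ord g)"
        using lookup_mult_leading_monomials[OF ord q0 g(2), unfolded lq] lookup_q by (simp add: lw add.commute)
      also have "\<dots> = Poly_Mapping.lookup f ?l" using lg by (simp add: c_def in_keys_iff)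
      finally have eq: "Poly_Mapping.lookup (q * g) ?l = Poly_Mapping.lookup f ?l" .
      have qg0: "q * g \<noteq> 0" using ord q0 g(2) by (rule mpoly_mult_nonzero)
      define f' where "f' = f - q * g"
      have f'V: "f' \<in> V" unfolding f'_def
        using V less.prems(1) g(1) GV by (intro ring_module.subspace_diff ring_module.subspace_scale) auto
      have keys: "u \<in> Poly_Mapping.keys f \<or> u \<in> Poly_Mapping.keys (q * g)" if "u \<in> Poly_Mapping.keys f'" for u
        using that by (auto simp: f'_def in_keys_iff lookup_minus)
      have deg_qg: "mdeg u \<le> d" if u: "u \<in> Poly_Mapping.keys (q * g)" for u
      proof -
        obtain v where v: "v \<in> Poly_Mapping.keys g" "u = w + v" using u keys_mult[of q g] kq by auto
        have "mdeg v = mdeg (leading_monomial ord g)" using g(3) v(1) lg unfolding homogeneous_def by auto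
        then have "mdeg u = mdeg ?l" by (simp add: v(2) lw mdeg_add)
        then show ?thesis using less.prems(2) lf by simp
      qed
      have deg: "\<forall>u\<in>Poly_Mapping.keys f'. mdeg u \<le> d" using keys deg_qg less.prems(2) by blast
      have "f' \<in> ideal_gen G"
      proof (cases "f' = 0")
        case True
        then show ?thesis by (simp add: ring_module.span_zero)
      next
        case f'0: False
        let ?l' = "leading_monomial ord f'"
        have l': "?l' \<in> Poly_Mapping.keys f'" using ord f'0 by (rule leading_monomial_in_keys)
        have le: "(?l', ?l) \<in> ord"
          using keys[OF l'] leading_monomial_max[OF ord False] leading_monomial_max[OF ord qg0] lqg by auto
        have "Poly_Mapping.lookup f' ?l = 0" using eq by (simp add: f'_def lookup_minus)
        then have ne: "?l' \<noteq> ?l" using l' by (auto simp: in_keys_iff)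
        show ?thesis
        proof (rule less.hyps[OF _ f'V deg])
          have "{u. mdeg u \<le> d \<and> (u, ?l') \<in> ord} \<subset> {u. mdeg u \<le> d \<and> (u, ?l) \<in> ord}"
          proof (rule psubsetI)
            show "{u. mdeg u \<le> d \<and> (u, ?l') \<in> ord} \<subseteq> {u. mdeg u \<le> d \<and> (u, ?l) \<in> ord}"
            proof
              fix u assume "u \<in> {u. mdeg u \<le> d \<and> (u, ?l') \<in> ord}"
              then show "u \<in> {u. mdeg u \<le> d \<and> (u, ?l) \<in> ord}"
                using term_order_trans[OF ord, of u ?l' ?l] le by simp
            qed
            have "?l \<in> {u. mdeg u \<le> d \<and> (u, ?l) \<in> ord}"
              using less.prems(2) lf term_order_refl[OF ord] by simp
            moreover have "?l \<notin> {u. mdeg u \<le> d \<and> (u, ?l') \<in> ord}"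
              using term_order_antisym[OF ord, of ?l ?l'] le ne by auto
            ultimately show "{u. mdeg u \<le> d \<and> (u, ?l') \<in> ord} \<noteq> {u. mdeg u \<le> d \<and> (u, ?l) \<in> ord}" by metis
          qed
          then show "card {u. mdeg u \<le> d \<and> (u, ?l') \<in> ord} < card {u. mdeg u \<le> d \<and> (u, ?l) \<in> ord}"
            by (intro psubset_card_mono finite_subset[OF _ finite_mdeg_le[of d]]) auto
        qed
      qed
      moreover have "q * g \<in> ideal_gen G" using g(1) by (intro ring_module.span_scale ring_module.span_base)
      ultimately have "f' + q * g \<in> ideal_gen G" by (rule ring_module.span_add)
      then show ?thesis by (simp add: f'_def)
    qed (simp add: ring_module.span_zero)
  qed
  moreover have "\<forall>u\<in>Poly_Mapping.keys f. mdeg u \<le> d" unfolding d_def by simp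
  ultimately show ?thesis using \<open>f \<in> V\<close> by blast
qed

lemma vanishing_ideal_eq_ideal_gen:
  assumes "s \<ge> 1"
  shows "vanishing_ideal r s =
    ideal_gen (minor_products r s (generic_matrix :: 'm::{finite,linorder} \<Rightarrow> 'n::{finite,linorder} \<Rightarrow> ('m \<times> 'n, 'k::field) mpoly))"
    (is "?V = ideal_gen ?G")
proof (rule subset_antisym)
  show "ideal_gen ?G \<subseteq> ?V"
    by (rule ring_module.span_minimal[OF minor_products_subset_vanishing_ideal is_ideal_vanishing_ideal])
  show "?V \<subseteq> ideal_gen ?G"
  proof
    fix f :: "('m \<times> 'n, 'k) mpoly" assume f: "f \<in> ?V"
    show "f \<in> ideal_gen ?G"
    proof (rule mem_ideal_gen_by_reduction[OF lex_term_order is_ideal_vanishing_ideal minor_products_subset_vanishing_ideal _ f])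
      fix h :: "('m \<times> 'n, 'k) mpoly" assume h: "h \<in> ?V" "h \<noteq> 0"
      obtain g w where g: "g \<in> ?G" "g \<noteq> 0" "leading_monomial {(t, u). t \<le> u} h = leading_monomial {(t, u). t \<le> u} g + w"
        using lex_diagonal_term_order assms h by (rule leading_monomial_minor_products) (rule that)
      then show "\<exists>g\<in>?G. \<exists>w. g \<noteq> 0 \<and> homogeneous g \<and>
          leading_monomial {(t, u). t \<le> u} h = leading_monomial {(t, u). t \<le> u} g + w"
        using homogeneous_minor_products[OF g(1)] by blast
    qed
  qed
qed

lemma minor_products_1:
  "minor_products r 1 (generic_matrix :: 'm::linorder \<Rightarrow> 'n::linorder \<Rightarrow> ('m \<times> 'n, 'k::comm_ring_1) mpoly) =
    minors (r + 1) generic_matrix"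
proof (rule subset_antisym; rule subsetI)
  let ?X = "generic_matrix :: 'm::linorder \<Rightarrow> 'n::linorder \<Rightarrow> ('m \<times> 'n, 'k::comm_ring_1) mpoly"
  fix g assume "g \<in> minor_products r 1 ?X"
  then obtain l :: nat and f where l: "l \<ge> 1" and g: "g = (\<Prod>i<l. f i)"
    and f: "\<And>i. i < l \<Longrightarrow> f i \<in> minors_from (r + 1) ?X"
    and sum: "(\<Sum>i<l. int (total_degree (f i)) - int r) = int 1"
    by (rule minor_productsE) (rule that)
  have ge: "1 \<le> int (total_degree (f i)) - int r" if "i < l" for i
    by (rule minors_fromE[OF f[OF that]]) simp
  have "(\<Sum>i<l. 1) \<le> (\<Sum>i<l. int (total_degree (f i)) - int r)" by (rule sum_mono) (use ge in auto)
  then have l1: "l = 1" using sum l by simp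
  then have td: "total_degree (f 0) = r + 1" using sum by simp
  have "f 0 \<in> minors_from (r + 1) ?X" using f[of 0] l1 by simp
  then obtain t a b where "r < t" "strict_mono_on {..<t} a" "strict_mono_on {..<t} b" "f 0 = minor ?X t a b"
    "total_degree (f 0) = t" "f 0 \<noteq> 0"
    by (rule minors_fromE) (rule that)
  then show "g \<in> minors (r + 1) ?X" using td l1 unfolding g minors_def by auto
next
  let ?X = "generic_matrix :: 'm::linorder \<Rightarrow> 'n::linorder \<Rightarrow> ('m \<times> 'n, 'k::comm_ring_1) mpoly"
  fix g assume g: "g \<in> minors (r + 1) ?X"
  then obtain a b where ab: "g = minor ?X (r + 1) a b" "strict_mono_on {..<r+1} a" "strict_mono_on {..<r+1} b"
    by (auto simp: minors_def)
  have "total_degree g = r + 1"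
    unfolding ab(1) by (intro total_degree_minor_generic strict_mono_on_imp_inj_on ab)
  moreover have "g \<in> minors_from (r + 1) ?X" using g unfolding minors_from_def by auto
  ultimately show "g \<in> minor_products r 1 ?X"
    unfolding minor_products_def mem_Collect_eq by (intro exI[of _ "1::nat"] exI[of _ "\<lambda>_. g"]) simp
qed

corollary vanishing_ideal_1:
  "vanishing_ideal r 1 =
    ideal_gen (minors (r + 1) (generic_matrix :: 'm::{finite,linorder} \<Rightarrow> 'n::{finite,linorder} \<Rightarrow> ('m \<times> 'n, 'k::field) mpoly))"
  using vanishing_ideal_eq_ideal_gen[of 1 r] unfolding minor_products_1 by simp

lemma vanishing_ideal_1_iff: "f \<in> vanishing_ideal r 1 \<longleftrightarrow> poly (jet r f) 0 = 0"
  by (simp add: vanishing_ideal_def poly_eq_0_iff_dvd)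

lemma is_prime_ideal_vanishing_ideal_1:
  "is_prime_ideal (vanishing_ideal r 1 :: ('m::linorder \<times> 'n::linorder, 'k::idom) mpoly set)"
  unfolding is_prime_ideal_def
proof (intro conjI allI impI)
  have "(1 :: ('m \<times> 'n, 'k) mpoly) \<notin> vanishing_ideal r 1"
    unfolding vanishing_ideal_1_iff by (simp add: ring_map_1[OF ring_map_jet])
  then show "vanishing_ideal r 1 \<noteq> (UNIV :: ('m \<times> 'n, 'k) mpoly set)" by blast
  fix a b :: "('m \<times> 'n, 'k) mpoly"
  assume "a * b \<in> vanishing_ideal r 1"
  then show "a \<in> vanishing_ideal r 1 \<or> b \<in> vanishing_ideal r 1"
    unfolding vanishing_ideal_1_iff by (simp add: ring_map_mult[OF ring_map_jet])
qed (rule is_ideal_vanishing_ideal)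

section \<open>Groebner bases of the jet ideals\<close>

lemma finite_minors: "finite (minors t (X :: 'm::{finite,linorder} \<Rightarrow> 'n::{finite,linorder} \<Rightarrow> 'a::comm_ring_1))"
proof (rule finite_subset)
  let ?F = "\<lambda>A. PiE {..<t} (\<lambda>_. A)"
  show "minors t X \<subseteq> (\<lambda>(a, b). minor X t a b) ` (?F UNIV \<times> ?F UNIV)"
  proof
    fix g assume "g \<in> minors t X"
    then obtain a b where g: "g = minor X t a b" by (auto simp: minors_def)
    have "g = minor X t (restrict a {..<t}) (restrict b {..<t})" unfolding g by (rule minor_cong) auto
    then show "g \<in> (\<lambda>(a, b). minor X t a b) ` (?F UNIV \<times> ?F UNIV)"
      by (intro image_eqI[of _ _ "(restrict a {..<t}, restrict b {..<t})"]) auto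
  qed
  show "finite ((\<lambda>(a, b). minor X t a b) ` (?F UNIV \<times> ?F UNIV))"
    by (intro finite_imageI finite_cartesian_product finite_PiE) auto
qed

lemma finite_minors_from: "finite (minors_from t (X :: 'm::{finite,linorder} \<Rightarrow> 'n::{finite,linorder} \<Rightarrow> 'a::comm_ring_1))"
proof (rule finite_subset)
  show "minors_from t X \<subseteq> (\<Union>u\<in>{..card (UNIV :: 'm set)}. minors u X)"
  proof
    fix g assume "g \<in> minors_from t X"
    then obtain u a b where u: "g = minor X u a b" "strict_mono_on {..<u} a" "strict_mono_on {..<u} b"
      by (auto simp: minors_from_def minors_def)
    have "card {..<u} \<le> card (UNIV :: 'm set)"
      by (rule card_inj_on_le[of a]) (use u strict_mono_on_imp_inj_on in auto)
    then show "g \<in> (\<Union>u\<in>{..card (UNIV :: 'm set)}. minors u X)" using u unfolding minors_def by auto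
  qed
qed (use finite_minors in auto)

lemma finite_minor_products:
  "finite (minor_products r s (generic_matrix :: 'm::{finite,linorder} \<Rightarrow> 'n::{finite,linorder} \<Rightarrow> ('m \<times> 'n, 'k::comm_ring_1) mpoly))"
proof (rule finite_subset)
  let ?X = "generic_matrix :: 'm \<Rightarrow> 'n \<Rightarrow> ('m \<times> 'n, 'k) mpoly"
  let ?L = "{xs. set xs \<subseteq> minors_from (r + 1) ?X \<and> length xs \<le> s}"
  show "finite (prod_list ` ?L)" by (intro finite_imageI finite_lists_length_le finite_minors_from)
  show "minor_products r s ?X \<subseteq> prod_list ` ?L"
  proof
    fix g assume "g \<in> minor_products r s ?X"
    then obtain l :: nat and f where "l \<ge> 1" and g: "g = (\<Prod>i<l. f i)"
      and f: "\<And>i. i < l \<Longrightarrow> f i \<in> minors_from (r + 1) ?X"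
      and sum: "(\<Sum>i<l. int (total_degree (f i)) - int r) = int s"
      by (rule minor_productsE) (rule that)
    have ge: "1 \<le> int (total_degree (f i)) - int r" if "i < l" for i
      by (rule minors_fromE[OF f[OF that]]) simp
    have "(\<Sum>i<l. 1) \<le> (\<Sum>i<l. int (total_degree (f i)) - int r)" by (rule sum_mono) (use ge in auto)
    then have "l \<le> s" using sum by simp
    moreover have "g = prod_list (map f [0..<l])"
      unfolding g by (simp add: prod.list_conv_set_nth atLeast0LessThan)
    ultimately show "g \<in> prod_list ` ?L" using f by (intro image_eqI[of _ _ "map f [0..<l]"]) auto
  qed
qed

lemma is_groebner_basis_minor_products:
  assumes diag: "diagonal_term_order (generic_matrix :: 'm::{finite,linorder} \<Rightarrow> 'n::{finite,linorder} \<Rightarrow> ('m \<times> 'n, 'k::field) mpoly) ord"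
    and s: "s \<ge> 1"
  shows "is_groebner_basis ord (minor_products r s (generic_matrix :: 'm \<Rightarrow> 'n \<Rightarrow> ('m \<times> 'n, 'k) mpoly)) (vanishing_ideal r s)"
    (is "is_groebner_basis ord ?G ?V")
  unfolding is_groebner_basis_def
proof (intro conjI)
  show "finite ?G" by (rule finite_minor_products)
  show GV: "?G \<subseteq> ?V" by (rule minor_products_subset_vanishing_ideal)
  show "initial_ideal ord ?G = initial_ideal ord ?V"
  proof (rule subset_antisym)
    show "initial_ideal ord ?G \<subseteq> initial_ideal ord ?V"
      unfolding initial_ideal_def using GV by (intro ring_module.span_mono) blast
    show "initial_ideal ord ?V \<subseteq> initial_ideal ord ?G"
      unfolding initial_ideal_def
    proof (rule ring_module.span_minimal[OF _ ring_module.subspace_span], rule subsetI)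
      fix m assume "m \<in> {Poly_Mapping.single (leading_monomial ord f) (1::'k) | f. f \<in> ?V \<and> f \<noteq> 0}"
      then obtain f where f: "f \<in> ?V" "f \<noteq> 0" and m: "m = Poly_Mapping.single (leading_monomial ord f) 1"
        by blast
      obtain g w where g: "g \<in> ?G" "g \<noteq> 0" "leading_monomial ord f = leading_monomial ord g + w"
        using diag s f by (rule leading_monomial_minor_products) (rule that)
      have "m = Poly_Mapping.single w 1 * Poly_Mapping.single (leading_monomial ord g) 1"
        by (simp add: m g(3) mult_single add.commute)
      moreover have "Poly_Mapping.single (leading_monomial ord g) 1 \<in>
          {Poly_Mapping.single (leading_monomial ord f) (1::'k) | f. f \<in> ?G \<and> f \<noteq> 0}"
        using g(1,2) by blast
      ultimately show "m \<in> ideal_gen {Poly_Mapping.single (leading_monomial ord f) (1::'k) | f. f \<in> ?G \<and> f \<noteq> 0}"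
        by (simp only: ring_module.span_scale[OF ring_module.span_base])
    qed
  qed
qed

section \<open>Symbolic powers\<close>

lemma prod_in_ideal_power: "(\<And>i. i < n \<Longrightarrow> f i \<in> J) \<Longrightarrow> (\<Prod>i<n. f i) \<in> ideal_power J n"
  unfolding ideal_power_def by (intro ring_module.span_base) blast

lemma is_ideal_ideal_power: "is_ideal (ideal_power J n)"
  unfolding ideal_power_def by (rule ring_module.subspace_span)

lemma is_ideal_colon:
  assumes "is_ideal I"
  shows "is_ideal {b. a * b \<in> I}"
proof (rule ring_module.subspaceI)
  show "0 \<in> {b. a * b \<in> I}" using ring_module.subspace_0[OF assms] by simp
  show "x + y \<in> {b. a * b \<in> I}" if "x \<in> {b. a * b \<in> I}" "y \<in> {b. a * b \<in> I}" for x y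
    using ring_module.subspace_add[OF assms, of "a * x" "a * y"] that by (simp add: distrib_left)
  show "c * x \<in> {b. a * b \<in> I}" if "x \<in> {b. a * b \<in> I}" for c x
    using ring_module.subspace_scale[OF assms, of "a * x" c] that by (simp only: mem_Collect_eq mult.left_commute)
qed

lemma mult_in_ideal_power_Suc:
  assumes a: "a \<in> J" and b: "b \<in> ideal_power J n"
  shows "a * b \<in> ideal_power J (Suc n)"
proof -
  have "ideal_power J n \<subseteq> {b. a * b \<in> ideal_power J (Suc n)}"
    unfolding ideal_power_def[of J n]
  proof (rule ring_module.span_minimal)
    show "is_ideal {b. a * b \<in> ideal_power J (Suc n)}"
      by (rule is_ideal_colon[OF is_ideal_ideal_power])
    show "{(\<Prod>i<n. f i) | f. \<forall>i<n. f i \<in> J} \<subseteq> {b. a * b \<in> ideal_power J (Suc n)}"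
    proof
      fix b assume "b \<in> {(\<Prod>i<n. f i) | f. \<forall>i<n. f i \<in> J}"
      then obtain f where f: "b = (\<Prod>i<n. f i)" "\<forall>i<n. f i \<in> J" by blast
      have "a * b = (\<Prod>i<Suc n. case i of 0 \<Rightarrow> a | Suc j \<Rightarrow> f j)"
        unfolding prod.lessThan_Suc_shift by (simp add: f)
      also have "\<dots> \<in> ideal_power J (Suc n)"
        using a f(2) by (intro prod_in_ideal_power) (auto split: nat.splits)
      finally show "b \<in> {b. a * b \<in> ideal_power J (Suc n)}" by simp
    qed
  qed
  then show ?thesis using b by blast
qed

lemma mult_in_ideal_power:
  assumes a: "a \<in> ideal_power J m" and b: "b \<in> ideal_power J n"
  shows "a * b \<in> ideal_power J (m + n)"
proof -
  have "ideal_power J m \<subseteq> {a. a * b \<in> ideal_power J (m + n)}"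
    unfolding ideal_power_def[of J m]
  proof (rule ring_module.span_minimal)
    show "is_ideal {a. a * b \<in> ideal_power J (m + n)}"
      unfolding mult.commute[of _ b] by (rule is_ideal_colon[OF is_ideal_ideal_power])
    have "(\<Prod>i<m. f i) * b \<in> ideal_power J (m + n)" if "\<forall>i<m. f i \<in> J" for f m
      using that
    proof (induction m)
      case (Suc m)
      then have "f m * ((\<Prod>i<m. f i) * b) \<in> ideal_power J (Suc (m + n))"
        by (intro mult_in_ideal_power_Suc) auto
      then show ?case by (simp only: prod.lessThan_Suc add_Suc mult.assoc mult.left_commute mult.commute)
    qed (use b in simp)
    then show "{(\<Prod>i<m. f i) | f. \<forall>i<m. f i \<in> J} \<subseteq> {a. a * b \<in> ideal_power J (m + n)}" by blast
  qed
  then show ?thesis using a by blast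
qed

lemma prime_ideal_not_in_mult:
  "is_prime_ideal J \<Longrightarrow> a \<notin> J \<Longrightarrow> b \<notin> J \<Longrightarrow> a * b \<notin> J"
  unfolding is_prime_ideal_def by blast

lemma one_notin_prime_ideal: "is_prime_ideal J \<Longrightarrow> 1 \<notin> J"
proof
  assume J: "is_prime_ideal J" "1 \<in> J"
  then have "x * 1 \<in> J" for x
    unfolding is_prime_ideal_def using ring_module.subspace_scale[of J 1 x] by blast
  then show False using J(1) unfolding is_prime_ideal_def by auto
qed

lemma symbolic_power_prime_iff:
  assumes J: "is_prime_ideal J"
  shows "f \<in> symbolic_power J s \<longleftrightarrow> (\<exists>u. u \<notin> J \<and> f * u \<in> ideal_power J s)"
proof -
  have min: "minimal_primes J = {J}" unfolding minimal_primes_def using J by blast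
  have "0 \<in> J" using J unfolding is_prime_ideal_def by (blast intro: ring_module.subspace_0)
  then have eq: "Fract f 1 = Fract a u \<longleftrightarrow> f * u = a" if "u \<notin> J" for a u
    using that by (subst eq_fract) auto
  have "f \<in> symbolic_power J s \<longleftrightarrow> (\<exists>a u. Fract f 1 = Fract a u \<and> a \<in> ideal_power J s \<and> u \<notin> J)"
    unfolding symbolic_power_def min by simp
  also have "\<dots> \<longleftrightarrow> (\<exists>a u. f * u = a \<and> a \<in> ideal_power J s \<and> u \<notin> J)" using eq by blast
  finally show ?thesis by blast
qed

lemma is_ideal_symbolic_power:
  assumes J: "is_prime_ideal J"
  shows "is_ideal (symbolic_power J s)"
proof -
  note iff = symbolic_power_prime_iff[OF J]
  note pw = is_ideal_ideal_power[of J s]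
  show ?thesis unfolding ring_module.subspace_def
  proof (intro conjI ballI allI)
    show "0 \<in> symbolic_power J s"
      unfolding iff using one_notin_prime_ideal[OF J] ring_module.subspace_0[OF pw] by (intro exI[of _ 1]) simp
    fix f g assume "f \<in> symbolic_power J s" "g \<in> symbolic_power J s"
    then obtain u v where uv: "u \<notin> J" "f * u \<in> ideal_power J s" "v \<notin> J" "g * v \<in> ideal_power J s"
      unfolding iff by blast
    have "v * (f * u) + u * (g * v) \<in> ideal_power J s"
      by (intro ring_module.subspace_add[OF pw] ring_module.subspace_scale[OF pw] uv)
    moreover have "(f + g) * (u * v) = v * (f * u) + u * (g * v)" by (simp only: distrib_left distrib_right mult.assoc mult.left_commute mult.commute)
    ultimately have "(f + g) * (u * v) \<in> ideal_power J s" by (simp only:)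
    then show "f + g \<in> symbolic_power J s" unfolding iff using prime_ideal_not_in_mult[OF J uv(1,3)] by blast
  next
    fix c f assume "f \<in> symbolic_power J s"
    then obtain u where u: "u \<notin> J" "f * u \<in> ideal_power J s" unfolding iff by blast
    then have "c * f * u \<in> ideal_power J s"
      using ring_module.subspace_scale[OF pw u(2), of c] by (simp only: mult.assoc)
    then show "c * f \<in> symbolic_power J s" unfolding iff using u(1) by blast
  qed
qed

lemma prod_in_symbolic_power:
  assumes J: "is_prime_ideal J" and "finite A" "\<And>x. x \<in> A \<Longrightarrow> f x \<in> symbolic_power J (n x)"
  shows "(\<Prod>x\<in>A. f x) \<in> symbolic_power J (\<Sum>x\<in>A. n x)"
  using assms(2,3)
proof (induction A rule: finite_induct)
  case empty
  have "(\<Prod>i<0::nat. 1) \<in> ideal_power J 0" by (rule prod_in_ideal_power) simp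
  then show ?case
    unfolding symbolic_power_prime_iff[OF J] using one_notin_prime_ideal[OF J] by (intro exI[of _ 1]) simp
next
  case (insert x A)
  have "f x \<in> symbolic_power J (n x)" "prod f A \<in> symbolic_power J (sum n A)" using insert by auto
  then obtain u v where uv: "u \<notin> J" "f x * u \<in> ideal_power J (n x)" "v \<notin> J" "prod f A * v \<in> ideal_power J (sum n A)"
    unfolding symbolic_power_prime_iff[OF J] by blast
  have "(f x * prod f A) * (u * v) \<in> ideal_power J (n x + sum n A)"
    using mult_in_ideal_power[OF uv(2,4)] by (simp only: mult.assoc mult.left_commute mult.commute)
  then have "f x * prod f A \<in> symbolic_power J (n x + sum n A)"
    unfolding symbolic_power_prime_iff[OF J] using prime_ideal_not_in_mult[OF J uv(1,3)] by blast
  then show ?case using insert.hyps by simp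
qed

lemma pX_power_dvd_cancel:
  fixes p q :: "'a::idom poly"
  assumes "poly q 0 \<noteq> 0" "[:0, 1:] ^ s dvd p * q"
  shows "[:0, 1:] ^ s dvd p"
  using assms(2)
proof (induction s arbitrary: p)
  case (Suc s)
  have "[:0, 1:] dvd p * q" using Suc.prems by (rule dvd_trans[rotated]) (simp only: power_Suc dvd_triv_left)
  then have "poly p 0 = 0" using assms(1) by (simp add: dvd_iff_poly_eq_0)
  then have "[:0, 1:] dvd p" by (simp add: dvd_iff_poly_eq_0)
  then obtain p' where p': "p = [:0, 1:] * p'" by (rule dvdE)
  have "[:0, 1:] * [:0, 1:] ^ s dvd [:0, 1:] * (p' * q)"
    using Suc.prems unfolding p' by (simp only: power_Suc mult.assoc)
  then have "[:0, 1:] ^ s dvd p' * q" by (subst (asm) dvd_mult_cancel_left) simp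
  then have "[:0, 1:] ^ s dvd p'" by (rule Suc.IH)
  then show ?case unfolding p' power_Suc by (rule mult_dvd_mono[OF dvd_refl])
qed simp

lemma symbolic_power_subset_vanishing_ideal:
  "symbolic_power (vanishing_ideal r 1) s \<subseteq> (vanishing_ideal r s :: ('m::linorder \<times> 'n::linorder, 'k::idom) mpoly set)"
proof
  let ?J = "vanishing_ideal r 1 :: ('m \<times> 'n, 'k) mpoly set"
  fix f assume "f \<in> symbolic_power ?J s"
  then obtain u where u: "u \<notin> ?J" "f * u \<in> ideal_power ?J s"
    unfolding symbolic_power_prime_iff[OF is_prime_ideal_vanishing_ideal_1] by blast
  have "ideal_power ?J s \<subseteq> vanishing_ideal r s"
    unfolding ideal_power_def
  proof (rule ring_module.span_minimal[OF _ is_ideal_vanishing_ideal], rule subsetI)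
    fix g assume "g \<in> {(\<Prod>i<s. f i) | f. \<forall>i<s. f i \<in> ?J}"
    then obtain h where h: "g = (\<Prod>i<s. h i)" "\<forall>i<s. h i \<in> ?J" by blast
    have "(\<Prod>i<s. [:0, 1:]) dvd (\<Prod>i<s. jet r (h i))"
      using h(2) by (intro prod_dvd_prod) (auto simp: vanishing_ideal_def)
    then show "g \<in> vanishing_ideal r s"
      by (simp add: vanishing_ideal_def h(1) ring_map_prod[OF ring_map_jet])
  qed
  then have "[:0, 1:] ^ s dvd jet r f * jet r u"
    using u(2) by (auto simp: vanishing_ideal_def ring_map_mult[OF ring_map_jet])
  moreover have "poly (jet r u) 0 \<noteq> 0" using u(1) unfolding vanishing_ideal_1_iff .
  ultimately have "[:0, 1:] ^ s dvd jet r f" by (rule pX_power_dvd_cancel[rotated])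
  then show "f \<in> vanishing_ideal r s" by (simp add: vanishing_ideal_def)
qed

text \<open>Entries of the Schur complement of the upper left \<open>r \<times> r\<close> submatrix, cleared of denominators.\<close>

definition schur_entry :: "('m \<Rightarrow> 'n \<Rightarrow> 'a::comm_ring_1) \<Rightarrow> nat \<Rightarrow> (nat \<Rightarrow> 'm) \<Rightarrow> (nat \<Rightarrow> 'n) \<Rightarrow> 'm \<Rightarrow> 'n \<Rightarrow> 'a" where
  "schur_entry X r a b i j = minor X r a b * X i j -
     (\<Sum>p<r. X i (b p) * (\<Sum>q<r. adj_mat (mat r r (\<lambda>(i, j). X (a i) (b j))) $$ (p, q) * X (a q) j))"

lemma schur_minor:
  fixes X :: "'m \<Rightarrow> 'n \<Rightarrow> 'a::idom"
  shows "minor X r a b ^ k * minor X (r + k) a b =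
    minor X r a b * det (mat k k (\<lambda>(i, j). schur_entry X r a b (a (r + i)) (b (r + j))))"
proof -
  let ?A = "mat r r (\<lambda>(i, j). X (a i) (b j))"
  let ?B = "mat r k (\<lambda>(i, j). X (a i) (b (r + j)))"
  let ?C = "mat k r (\<lambda>(i, j). X (a (r + i)) (b j))"
  let ?D = "mat k k (\<lambda>(i, j). X (a (r + i)) (b (r + j)))"
  let ?E = "mat k k (\<lambda>(i, j). schur_entry X r a b (a (r + i)) (b (r + j)))"
  let ?d = "minor X r a b"
  let ?M = "mat (r + k) (r + k) (\<lambda>(i, j). X (a i) (b j))"
  define Adj where "Adj = adj_mat ?A"
  have A: "?A \<in> carrier_mat r r" by simp
  have Adj: "Adj \<in> carrier_mat r r" "Adj * ?A = ?d \<cdot>\<^sub>m 1\<^sub>m r"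
    using adj_mat[OF A] unfolding Adj_def minor_def by auto
  have M: "?M = four_block_mat ?A ?B ?C ?D"
    by (intro eq_matI) (auto simp: not_less)
  let ?L = "four_block_mat (1\<^sub>m r) (0\<^sub>m r k) (- (?C * Adj)) (?d \<cdot>\<^sub>m 1\<^sub>m k)"
  have dD: "?d \<cdot>\<^sub>m 1\<^sub>m k * ?D = ?d \<cdot>\<^sub>m ?D" "?d \<cdot>\<^sub>m 1\<^sub>m k * ?C = ?d \<cdot>\<^sub>m ?C"
    by (simp_all add: mult_smult_assoc_mat[of _ k k _ k] mult_smult_assoc_mat[of _ k k _ r])
  have "?C * Adj * ?A = ?C * (Adj * ?A)" using Adj(1) by (intro assoc_mult_mat) auto
  also have "\<dots> = ?d \<cdot>\<^sub>m ?C" unfolding Adj(2) by (subst mult_smult_distrib[of _ k r]) auto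
  finally have "- (?C * Adj) * ?A = - (?d \<cdot>\<^sub>m ?C)"
    using Adj(1) by (subst uminus_mult_left_mat[symmetric]) auto
  then have ll: "- (?C * Adj) * ?A + ?d \<cdot>\<^sub>m 1\<^sub>m k * ?C = 0\<^sub>m k r"
    unfolding dD by (intro eq_matI) auto
  have assoc: "?C * Adj * ?B = ?C * (Adj * ?B)" using Adj(1) by (intro assoc_mult_mat) auto
  have "- (?C * Adj) * ?B + ?d \<cdot>\<^sub>m 1\<^sub>m k * ?D = ?E"
  proof (intro eq_matI)
    fix i j assume "i < dim_row ?E" "j < dim_col ?E"
    then have ij: "i < k" "j < k" by auto
    have dims: "dim_row Adj = r" "dim_col Adj = r" using Adj(1) by auto
    have "(?C * (Adj * ?B)) $$ (i, j) =
        (\<Sum>p<r. X (a (r + i)) (b p) * (\<Sum>q<r. Adj $$ (p, q) * X (a q) (b (r + j))))"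
      using ij Adj(1) by (simp add: scalar_prod_def atLeast0LessThan dims)
    moreover have "- (?C * Adj) * ?B = - (?C * (Adj * ?B))"
      unfolding assoc[symmetric] using Adj(1) by (subst uminus_mult_left_mat[symmetric]) auto
    ultimately show "(- (?C * Adj) * ?B + ?d \<cdot>\<^sub>m 1\<^sub>m k * ?D) $$ (i, j) = ?E $$ (i, j)"
      unfolding dD using ij by (simp add: schur_entry_def Adj_def[symmetric] dims del: index_mult_mat(1))
  qed (use Adj in auto)
  with ll have prod: "?L * four_block_mat ?A ?B ?C ?D = four_block_mat ?A ?B (0\<^sub>m k r) ?E"
    using Adj(1) by (subst mult_four_block_mat[where ?nr1.0 = r and ?n1.0 = r and ?n2.0 = k and ?nr2.0 = k and ?nc1.0 = r and ?nc2.0 = k]) auto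
  have "det (?L * ?M) = det ?L * det ?M"
    unfolding M using Adj(1) by (intro det_mult[where n = "r + k"]) auto
  moreover have "det ?L = ?d ^ k"
    using Adj(1) by (subst det_four_block_mat_upper_right_zero[where n = r and m = k]) auto
  moreover have "det (?L * ?M) = det ?A * det ?E"
    unfolding M prod by (subst det_four_block_mat_lower_left_zero[where n = r and m = k]) auto
  ultimately show ?thesis by (simp add: minor_def)
qed

lemma minor_notin_vanishing_ideal:
  fixes a :: "nat \<Rightarrow> 'm::{finite,linorder}" and b :: "nat \<Rightarrow> 'n::{finite,linorder}"
  assumes mono: "strict_mono_on {..<r} a" "strict_mono_on {..<r} b"
  shows "minor (generic_matrix :: 'm \<Rightarrow> 'n \<Rightarrow> ('m \<times> 'n, 'k::idom) mpoly) r a b \<notin> vanishing_ideal r 1"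
    (is "?f \<notin> _")
proof
  assume f: "?f \<in> vanishing_ideal r 1"
  let ?ord = "{(t, u :: 'm \<times> 'n \<Rightarrow>\<^sub>0 nat). t \<le> u}"
  have diag: "diagonal_term_order (generic_matrix :: 'm \<Rightarrow> 'n \<Rightarrow> ('m \<times> 'n, 'k) mpoly) ?ord"
    by (rule lex_diagonal_term_order)
  have f0: "?f \<noteq> 0" using mono by (intro minor_generic_nonzero strict_mono_on_imp_inj_on)
  have lead: "diag_mono r a b = leading_monomial ?ord ?f" using leading_monomial_minor[OF diag mono] by simp
  define lev where "lev c = (LEAST i. i \<ge> r \<or> c = (a i, b i))" for c
  have lev: "lev c \<ge> r \<or> c = (a (lev c), b (lev c))" for c
    unfolding lev_def by (rule LeastI[of _ r]) simp
  have lev_le: "lev c \<le> r" for c unfolding lev_def by (rule Least_le) simp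
  have "1 \<le> (\<Sum>c\<in>Poly_Mapping.keys (diag_mono r a b). if lev c = r then Poly_Mapping.lookup (diag_mono r a b) c else 0)"
  proof (rule vanishing_leading_monomial[OF diag f f0 lead lev_le])
    fix c d :: "'m \<times> 'n" assume "fst c < fst d" "lev c = lev d"
    then show "lev c = r" using lev[of c] lev[of d] lev_le[of c] by (metis antisym less_irrefl)
  qed
  moreover have "lev c \<noteq> r" if "c \<in> Poly_Mapping.keys (diag_mono r a b)" for c
  proof -
    have "{i. i < r \<and> (a i, b i) = c} \<noteq> {}" using that by (auto simp: in_keys_iff lookup_diag_mono)
    then obtain i where i: "i < r" "c = (a i, b i)" by blast
    have "lev c \<le> i" unfolding lev_def by (rule Least_le) (simp add: i)
    then show ?thesis using i(1) by simp
  qed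
  ultimately show False by simp
qed

lemma minor_in_symbolic_power:
  fixes a :: "nat \<Rightarrow> 'm::{finite,linorder}" and b :: "nat \<Rightarrow> 'n::{finite,linorder}"
  assumes mono: "strict_mono_on {..<r + k} a" "strict_mono_on {..<r + k} b"
  shows "minor (generic_matrix :: 'm \<Rightarrow> 'n \<Rightarrow> ('m \<times> 'n, 'k::idom) mpoly) (r + k) a b \<in>
    symbolic_power (vanishing_ideal r 1) k"
proof -
  let ?X = "generic_matrix :: 'm \<Rightarrow> 'n \<Rightarrow> ('m \<times> 'n, 'k) mpoly"
  let ?J = "vanishing_ideal r 1 :: ('m \<times> 'n, 'k) mpoly set"
  let ?d = "minor ?X r a b"
  have prime: "is_prime_ideal ?J" by (rule is_prime_ideal_vanishing_ideal_1)
  have mono_r: "strict_mono_on {..<r} a" "strict_mono_on {..<r} b"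
    using mono by (auto simp: strict_mono_on_def)
  have d: "?d \<notin> ?J" using mono_r by (rule minor_notin_vanishing_ideal)
  have entry: "schur_entry ?X r a b i j \<in> ?J" for i j
  proof -
    have A: "mat r r (\<lambda>(p, q). ?X ((a(r := i)) p) ((b(r := j)) q)) = mat r r (\<lambda>(p, q). ?X (a p) (b q))"
      by (intro eq_matI) auto
    have dd: "minor ?X r (a(r := i)) (b(r := j)) = ?d" by (rule minor_cong) auto
    have E: "schur_entry ?X r (a(r := i)) (b(r := j)) i j = schur_entry ?X r a b i j"
      unfolding schur_entry_def A dd by simp
    have "?d ^ 1 * minor ?X (r + 1) (a(r := i)) (b(r := j)) = ?d * schur_entry ?X r a b i j"
      using schur_minor[of ?X r "a(r := i)" "b(r := j)" 1] unfolding dd by (simp add: det_single E)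
    moreover have "minor ?X (r + 1) (a(r := i)) (b(r := j)) \<in> ?J"
      using minor_in_vanishing_ideal[of r "r + 1" "a(r := i)" "b(r := j)", where 'k = 'k] by simp
    ultimately have "?d * schur_entry ?X r a b i j \<in> ?J"
      using ring_module.subspace_scale[OF is_ideal_vanishing_ideal] by (metis power_one_right)
    then show ?thesis using prime d unfolding is_prime_ideal_def by blast
  qed
  let ?e = "\<lambda>i j. schur_entry ?X r a b (a (r + i)) (b (r + j))"
  have pw: "is_ideal (ideal_power ?J k)" by (rule is_ideal_ideal_power)
  have "minor ?e k (\<lambda>i. i) (\<lambda>i. i) \<in> ideal_power ?J k"
    unfolding minor_expand
    by (intro ring_module.subspace_sum[OF pw] ring_module.subspace_scale[OF pw] prod_in_ideal_power entry)
  then have "?d ^ k * minor ?X (r + k) a b \<in> ideal_power ?J k"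
    unfolding schur_minor minor_def[of ?e] by (rule ring_module.subspace_scale[OF pw])
  moreover have "?d ^ k \<notin> ?J"
    by (induction k) (use d one_notin_prime_ideal[OF prime] prime_ideal_not_in_mult[OF prime] in auto)
  ultimately show ?thesis
    unfolding symbolic_power_prime_iff[OF prime] by (auto simp: mult.commute)
qed

theorem symbolic_power_vanishing_ideal:
  assumes "s \<ge> 1"
  shows "symbolic_power (vanishing_ideal r 1) s =
    (vanishing_ideal r s :: ('m::{finite,linorder} \<times> 'n::{finite,linorder}, 'k::field) mpoly set)"
proof (rule subset_antisym[OF symbolic_power_subset_vanishing_ideal])
  let ?X = "generic_matrix :: 'm \<Rightarrow> 'n \<Rightarrow> ('m \<times> 'n, 'k) mpoly"
  let ?J = "vanishing_ideal r 1 :: ('m \<times> 'n, 'k) mpoly set"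
  have prime: "is_prime_ideal ?J" by (rule is_prime_ideal_vanishing_ideal_1)
  have "minor_products r s ?X \<subseteq> symbolic_power ?J s"
  proof
    fix g assume "g \<in> minor_products r s ?X"
    then obtain l :: nat and f where "l \<ge> 1" and g: "g = (\<Prod>i<l. f i)"
      and f: "\<And>i. i < l \<Longrightarrow> f i \<in> minors_from (r + 1) ?X"
      and sum: "(\<Sum>i<l. int (total_degree (f i)) - int r) = int s"
      by (rule minor_productsE) (rule that)
    have fi: "r \<le> total_degree (f i) \<and> f i \<in> symbolic_power ?J (total_degree (f i) - r)" if i: "i < l" for i
    proof -
      obtain t a b where t: "r < t" "strict_mono_on {..<t} a" "strict_mono_on {..<t} b" "f i = minor ?X t a b"
        "total_degree (f i) = t" "f i \<noteq> 0"
        using f[OF i] by (rule minors_fromE) (rule that)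
      then show ?thesis using minor_in_symbolic_power[of r "t - r" a b, where 'k = 'k] by simp
    qed
    have "int s = int (\<Sum>i<l. total_degree (f i) - r)"
      unfolding sum[symmetric] of_nat_sum by (intro sum.cong refl) (use fi in \<open>simp add: of_nat_diff\<close>)
    then have s: "s = (\<Sum>i<l. total_degree (f i) - r)" by (simp only: of_nat_eq_iff)
    show "g \<in> symbolic_power ?J s"
      unfolding g s by (rule prod_in_symbolic_power[OF prime]) (use fi in auto)
  qed
  then show "vanishing_ideal r s \<subseteq> symbolic_power ?J s"
    unfolding vanishing_ideal_eq_ideal_gen[OF assms]
    by (rule ring_module.span_minimal[OF _ is_ideal_symbolic_power[OF prime]])
qed

section \<open>Secant ideals\<close>

lemma ring_map_rename_vars: "ring_map (rename_vars f :: ('v, 'k::comm_ring_1) mpoly \<Rightarrow> ('w, 'k) mpoly)"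
  unfolding rename_vars_def poly_subst_eq_poly_eval by (rule ring_map_poly_eval[OF ring_map_const])

lemma poly_eval_rename_vars:
  fixes p :: "('v, 'k::comm_ring_1) mpoly" and \<sigma> :: "'w \<Rightarrow> 'a::comm_ring_1"
  assumes h: "ring_map h"
  shows "poly_eval h \<sigma> (rename_vars f p) = poly_eval h (\<lambda>v. \<sigma> (f v)) p"
proof -
  show ?thesis
  proof (rule ring_map_eqI[where g' = "poly_eval h (\<lambda>v. \<sigma> (f v))"])
    show "ring_map (\<lambda>p :: ('v, 'k) mpoly. poly_eval h \<sigma> (rename_vars f p))"
      by (rule ring_map_comp[OF ring_map_poly_eval[OF h] ring_map_rename_vars])
    show "ring_map (poly_eval h (\<lambda>v. \<sigma> (f v)))" by (rule ring_map_poly_eval[OF h])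
  qed (simp_all add: rename_vars_def poly_subst_eq_poly_eval poly_eval_const[OF ring_map_const]
      poly_eval_const[OF h] poly_eval_var[OF ring_map_const] poly_eval_var[OF h])
qed

definition rank_eval :: "nat \<Rightarrow> ('m \<times> 'n, 'k::comm_ring_1) mpoly \<Rightarrow> ('m option \<times> 'n option \<times> nat, 'k) mpoly" where
  "rank_eval k = poly_eval (Poly_Mapping.single 0) (\<lambda>(i, j). \<Sum>l<k. var (Some i, None, l) * var (None, Some j, l))"

lemma ring_map_rank_eval: "ring_map (rank_eval k)"
  unfolding rank_eval_def by (rule ring_map_poly_eval[OF ring_map_const])

lemma poly_jet_0: "poly (jet k f) 0 = rank_eval k f"
proof (rule ring_map_eqI[where g = "\<lambda>f. poly (jet k f) 0" and g' = "rank_eval k"])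
  show "ring_map (\<lambda>f. poly (jet k f) 0)"
    by (rule ring_mapI) (simp_all add: ring_map_1[OF ring_map_jet] ring_map_add[OF ring_map_jet] ring_map_mult[OF ring_map_jet])
  show "poly (jet k (var v)) 0 = rank_eval k (var v)" for v
    by (cases v) (simp add: jet_def rank_eval_def poly_eval_var[OF ring_map_pCons_const]
        poly_eval_var[OF ring_map_const] jet_var_expand poly_sum mult.commute)
  show "poly (jet k (Poly_Mapping.single 0 a)) 0 = rank_eval k (Poly_Mapping.single 0 a)" for a
    by (simp add: jet_def rank_eval_def poly_eval_const[OF ring_map_pCons_const] poly_eval_const[OF ring_map_const])
qed (rule ring_map_rank_eval)

lemma vanishing_ideal_1_iff_rank_eval: "f \<in> vanishing_ideal k 1 \<longleftrightarrow> rank_eval k f = 0"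
  for f :: "('m::linorder \<times> 'n::linorder, 'k::idom) mpoly"
  by (simp only: vanishing_ideal_1_iff poly_jet_0)

lemma rank_eval_universal:
  fixes U :: "nat \<Rightarrow> 'm \<Rightarrow> 'a::comm_ring_1" and V :: "nat \<Rightarrow> 'n \<Rightarrow> 'a"
    and f :: "('m \<times> 'n, 'k::comm_ring_1) mpoly"
  assumes h: "ring_map h" and f: "rank_eval k f = 0"
  shows "poly_eval h (\<lambda>(i, j). \<Sum>l<k. U l i * V l j) f = 0"
proof -
  define \<sigma> where "\<sigma> x = (case x of (Some i, _, l) \<Rightarrow> U l i | (None, Some j, l) \<Rightarrow> V l j | (None, None, l) \<Rightarrow> 0)"
    for x :: "'m option \<times> 'n option \<times> nat"
  have \<sigma>: "\<sigma> (Some i, None, l) = U l i" "\<sigma> (None, Some j, l) = V l j" for i j l by (simp_all add: \<sigma>_def)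
  note ev = ring_map_poly_eval[OF h, of \<sigma>]
  have "poly_eval h \<sigma> (rank_eval k f) = poly_eval h (\<lambda>(i, j). \<Sum>l<k. U l i * V l j) f"
  proof (rule ring_map_eqI[where g = "\<lambda>f. poly_eval h \<sigma> (rank_eval k f)"])
    show "ring_map (\<lambda>f :: ('m \<times> 'n, 'k) mpoly. poly_eval h \<sigma> (rank_eval k f))"
      by (rule ring_map_comp[OF ev ring_map_rank_eval])
    show "ring_map (poly_eval h (\<lambda>(i, j). \<Sum>l<k. U l i * V l j))" by (rule ring_map_poly_eval[OF h])
    show "poly_eval h \<sigma> (rank_eval k (var v)) = poly_eval h (\<lambda>(i, j). \<Sum>l<k. U l i * V l j) (var v)" for v
      by (cases v) (simp add: rank_eval_def poly_eval_var[OF ring_map_const] poly_eval_var[OF h]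
          ring_map_sum[OF ev] ring_map_mult[OF ev] \<sigma>)
  qed (simp add: rank_eval_def poly_eval_const[OF ring_map_const] poly_eval_const[OF h])
  then show ?thesis using f by simp
qed

lemma join_vanishing_subset:
  "join_ideal (vanishing_ideal 1 1) (vanishing_ideal k 1) \<subseteq>
    (vanishing_ideal (Suc k) 1 :: ('m::linorder \<times> 'n::linorder, 'k::idom) mpoly set)"
proof
  let ?V = "\<lambda>k. vanishing_ideal k 1 :: ('m \<times> 'n, 'k) mpoly set"
  fix p assume "p \<in> join_ideal (?V 1) (?V k)"
  then have p: "rename_vars XV p \<in> ideal_gen (rename_vars YV ` ?V 1 \<union> rename_vars ZV ` ?V k \<union>
      {var (XV a) - var (YV a) - var (ZV a) | a. True})" (is "_ \<in> ideal_gen ?S")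
    by (simp add: join_ideal_def)
  define u where "u l i = (var (Some i, None, l) :: ('m option \<times> 'n option \<times> nat, 'k) mpoly)" for l i
  define v where "v l j = (var (None, Some j, l) :: ('m option \<times> 'n option \<times> nat, 'k) mpoly)" for l j
  define \<tau> where "\<tau> x = (case x of XV (i, j) \<Rightarrow> \<Sum>l<Suc k. u l i * v l j
      | YV (i, j) \<Rightarrow> \<Sum>l<1. u (k + l) i * v (k + l) j | ZV (i, j) \<Rightarrow> \<Sum>l<k. u l i * v l j)" for x
  let ?\<Psi> = "poly_eval (Poly_Mapping.single 0) \<tau>"
  have hom: "ring_map ?\<Psi>" by (rule ring_map_poly_eval[OF ring_map_const])
  have "ideal_gen ?S \<subseteq> {q. ?\<Psi> q = 0}"
  proof (rule ring_module.span_minimal)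
    show "is_ideal {q. ?\<Psi> q = 0}"
      by (rule ring_module.subspaceI) (simp_all add: ring_map_add[OF hom] ring_map_mult[OF hom])
    have "?\<Psi> (rename_vars YV f) = 0" if "f \<in> ?V 1" for f
    proof -
      have "?\<Psi> (rename_vars YV f) = poly_eval (Poly_Mapping.single 0) (\<lambda>(i, j). \<Sum>l<1. u (k + l) i * v (k + l) j) f"
        by (simp add: poly_eval_rename_vars[OF ring_map_const] \<tau>_def case_prod_beta')
      also have "\<dots> = 0"
        using that unfolding vanishing_ideal_1_iff_rank_eval by (rule rank_eval_universal[OF ring_map_const])
      finally show ?thesis .
    qed
    moreover have "?\<Psi> (rename_vars ZV f) = 0" if "f \<in> ?V k" for f
    proof -
      have "?\<Psi> (rename_vars ZV f) = poly_eval (Poly_Mapping.single 0) (\<lambda>(i, j). \<Sum>l<k. u l i * v l j) f"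
        by (simp add: poly_eval_rename_vars[OF ring_map_const] \<tau>_def case_prod_beta')
      also have "\<dots> = 0"
        using that unfolding vanishing_ideal_1_iff_rank_eval by (rule rank_eval_universal[OF ring_map_const])
      finally show ?thesis .
    qed
    moreover have "?\<Psi> (var (XV a) - var (YV a) - var (ZV a)) = 0" for a
      by (cases a) (simp add: ring_map_diff[OF hom] poly_eval_var[OF ring_map_const] \<tau>_def)
    ultimately show "?S \<subseteq> {q. ?\<Psi> q = 0}" by blast
  qed
  then have "?\<Psi> (rename_vars XV p) = 0" using p by blast
  moreover have "?\<Psi> (rename_vars XV p) = rank_eval (Suc k) p"
    by (simp only: poly_eval_rename_vars[OF ring_map_const] rank_eval_def \<tau>_def jvar.case case_prod_beta' prod.collapse u_def v_def)
  ultimately show "p \<in> ?V (Suc k)" unfolding vanishing_ideal_1_iff_rank_eval by simp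
qed

lemma ideal_cong_mult:
  assumes I: "is_ideal I" and "a - a' \<in> I" "b - b' \<in> I"
  shows "a * b - a' * b' \<in> I"
proof -
  have "b * (a - a') + a' * (b - b') \<in> I"
    using assms by (intro ring_module.subspace_add[OF I] ring_module.subspace_scale[OF I])
  moreover have "b * (a - a') + a' * (b - b') = a * b - a' * b'"
    by (simp only: right_diff_distrib mult.commute) simp
  ultimately show ?thesis by simp
qed

lemma ideal_cong_poly_eval:
  assumes I: "is_ideal I" and "\<And>v. \<sigma> v - \<sigma>' v \<in> I"
  shows "poly_eval h \<sigma> p - poly_eval h \<sigma>' p \<in> I"
proof -
  have z: "0 \<in> I" using I by (rule ring_module.subspace_0)
  have pow: "\<sigma> v ^ n - \<sigma>' v ^ n \<in> I" for v n
  proof (induction n)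
    case (Suc n)
    show ?case unfolding power_Suc by (rule ideal_cong_mult[OF I assms(2) Suc.IH])
  qed (simp add: z)
  have mono: "(\<Prod>v\<in>A. \<sigma> v ^ n v) - (\<Prod>v\<in>A. \<sigma>' v ^ n v) \<in> I" for A n
  proof (induction A rule: infinite_finite_induct)
    case (insert x A)
    then show ?case using ideal_cong_mult[OF I pow] by simp
  qed (simp_all add: z)
  have "poly_eval h \<sigma> p - poly_eval h \<sigma>' p =
      (\<Sum>t\<in>Poly_Mapping.keys p. h (Poly_Mapping.lookup p t) * (mono_eval \<sigma> t - mono_eval \<sigma>' t))"
    by (simp only: poly_eval_def sum_subtractf right_diff_distrib)
  also have "\<dots> \<in> I"
    unfolding mono_eval_def
    by (intro ring_module.subspace_sum[OF I] ring_module.subspace_scale[OF I] mono)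
  finally show ?thesis .
qed

text \<open>The exponent vector of the value of a monomial at a generic matrix of rank one.\<close>

definition rank_one_mono :: "('m \<times> 'n \<Rightarrow>\<^sub>0 nat) \<Rightarrow> ('m + 'n \<Rightarrow>\<^sub>0 nat)" where
  "rank_one_mono e = (\<Sum>c\<in>Poly_Mapping.keys e.
     Poly_Mapping.single (Inl (fst c)) (Poly_Mapping.lookup e c) + Poly_Mapping.single (Inr (snd c)) (Poly_Mapping.lookup e c))"

lemma mono_eval_rank_one:
  "mono_eval (\<lambda>(i, j). u i * v j) e = mono_eval (case_sum u v) (rank_one_mono e)"
  unfolding rank_one_mono_def mono_eval_sum mono_eval_add mono_eval_single
  by (simp add: mono_eval_def power_mult_distrib case_prod_beta)

text \<open>Expand \<open>p (y + z)\<close> in the monomials \<open>y\<^sup>e\<close>. Modulo the ideal of rank one, \<open>y\<^sup>e\<close> only depends on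
  \<open>rank_one_mono e\<close>, and the coefficients that are collected in this way vanish on matrices of rank
  \<open>k\<close>.\<close>

lemma vanishing_subset_join:
  "(vanishing_ideal (Suc k) 1 :: ('m::linorder \<times> 'n::linorder, 'k::idom) mpoly set) \<subseteq>
    join_ideal (vanishing_ideal 1 1) (vanishing_ideal k 1)"
proof
  let ?V = "\<lambda>k. vanishing_ideal k 1 :: ('m \<times> 'n, 'k) mpoly set"
  let ?S = "rename_vars YV ` ?V 1 \<union> rename_vars ZV ` ?V k \<union> {var (XV a) - var (YV a) - var (ZV a) | a. True}"
  let ?J = "ideal_gen ?S"
  note J = ring_module.subspace_span[of ?S]
  fix p assume p: "p \<in> ?V (Suc k)"
  define T where "T = poly_eval (\<lambda>a. Poly_Mapping.single 0 (Poly_Mapping.single 0 a))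
    (\<lambda>c. var c + Poly_Mapping.single 0 (var c)) p"
  define P where "P e = Poly_Mapping.lookup T e" for e
  define K where "K = Poly_Mapping.keys T"
  define Q where "Q M = (\<Sum>e\<in>{e\<in>K. rank_one_mono e = M}. P e)" for M
  have coeff_hom: "ring_map (\<lambda>a::'k. Poly_Mapping.single 0 (Poly_Mapping.single 0 a) :: ('w, ('x, 'k) mpoly) mpoly)"
    by (rule ring_map_comp[OF ring_map_const ring_map_const])
  have Q: "Q M \<in> ?V k" for M
  proof -
    let ?h = "\<lambda>q :: ('m \<times> 'n, 'k) mpoly. Poly_Mapping.single 0 (rank_eval k q) ::
      ('m + 'n, ('m option \<times> 'n option \<times> nat, 'k) mpoly) mpoly"
    let ?s = "\<lambda>(i, j). var (Inl i) * var (Inr j) :: ('m + 'n, ('m option \<times> 'n option \<times> nat, 'k) mpoly) mpoly"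
    define u where "u l i = (if l < k then Poly_Mapping.single 0 (var (Some i, None, l)) else var (Inl i) ::
      ('m + 'n, ('m option \<times> 'n option \<times> nat, 'k) mpoly) mpoly)" for l i
    define v where "v l j = (if l < k then Poly_Mapping.single 0 (var (None, Some j, l)) else var (Inr j) ::
      ('m + 'n, ('m option \<times> 'n option \<times> nat, 'k) mpoly) mpoly)" for l j
    have h: "ring_map ?h" by (rule ring_map_comp[OF ring_map_const ring_map_rank_eval])
    note hom = ring_map_poly_eval[OF h, of ?s]
    have "poly_eval ?h ?s T = poly_eval (\<lambda>a. Poly_Mapping.single 0 (Poly_Mapping.single 0 a))
        (\<lambda>(i, j). \<Sum>l<Suc k. u l i * v l j) p"
      unfolding T_def
    proof (rule ring_map_eqI[where g = "\<lambda>p. poly_eval ?h ?s (poly_eval (\<lambda>a. Poly_Mapping.single 0 (Poly_Mapping.single 0 a))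
        (\<lambda>c. var c + Poly_Mapping.single 0 (var c)) p)"])
      show "ring_map (\<lambda>p. poly_eval ?h ?s (poly_eval (\<lambda>a::'k. Poly_Mapping.single 0 (Poly_Mapping.single 0 a))
          (\<lambda>c. var c + Poly_Mapping.single 0 (var c)) p))"
        by (rule ring_map_comp[OF hom ring_map_poly_eval[OF coeff_hom]])
      show "ring_map (poly_eval (\<lambda>a::'k. Poly_Mapping.single 0 (Poly_Mapping.single 0 a)) (\<lambda>(i, j). \<Sum>l<Suc k. u l i * v l j))"
        by (rule ring_map_poly_eval[OF coeff_hom])
      fix a :: 'k
      have "rank_eval k (Poly_Mapping.single 0 a :: ('m \<times> 'n, 'k) mpoly) = Poly_Mapping.single 0 a"
        by (simp add: rank_eval_def poly_eval_const[OF ring_map_const])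
      then show "poly_eval ?h ?s (poly_eval (\<lambda>a. Poly_Mapping.single 0 (Poly_Mapping.single 0 a))
          (\<lambda>c. var c + Poly_Mapping.single 0 (var c)) (Poly_Mapping.single 0 a)) =
        poly_eval (\<lambda>a. Poly_Mapping.single 0 (Poly_Mapping.single 0 a)) (\<lambda>(i, j). \<Sum>l<Suc k. u l i * v l j) (Poly_Mapping.single 0 a)"
        by (simp only: poly_eval_const[OF coeff_hom] poly_eval_const[OF h])
    next
      fix c :: "'m \<times> 'n"
      obtain i j where c: "c = (i, j)" by (cases c)
      have "poly_eval ?h ?s (poly_eval (\<lambda>a. Poly_Mapping.single 0 (Poly_Mapping.single 0 a))
          (\<lambda>c. var c + Poly_Mapping.single 0 (var c)) (var c)) = ?s c + ?h (var c)"
        by (simp only: poly_eval_var[OF coeff_hom] ring_map_add[OF hom] poly_eval_var[OF h] poly_eval_const[OF h])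
      also have "?h (var c) = (\<Sum>l<k. u l i * v l j)"
        by (simp add: c rank_eval_def poly_eval_var[OF ring_map_const] ring_map_sum[OF ring_map_const]
            ring_map_mult[OF ring_map_const] u_def v_def)
      also have "?s c + (\<Sum>l<k. u l i * v l j) = (\<Sum>l<Suc k. u l i * v l j)"
        by (simp add: c u_def v_def)
      also have "\<dots> = poly_eval (\<lambda>a. Poly_Mapping.single 0 (Poly_Mapping.single 0 a)) (\<lambda>(i, j). \<Sum>l<Suc k. u l i * v l j) (var c)"
        by (simp only: poly_eval_var[OF coeff_hom] c prod.case)
      finally show "poly_eval ?h ?s (poly_eval (\<lambda>a. Poly_Mapping.single 0 (Poly_Mapping.single 0 a))
          (\<lambda>c. var c + Poly_Mapping.single 0 (var c)) (var c)) =
        poly_eval (\<lambda>a. Poly_Mapping.single 0 (Poly_Mapping.single 0 a)) (\<lambda>(i, j). \<Sum>l<Suc k. u l i * v l j) (var c)" .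
    qed
    also have "\<dots> = 0"
      using p unfolding vanishing_ideal_1_iff_rank_eval by (rule rank_eval_universal[OF coeff_hom])
    finally have "0 = Poly_Mapping.lookup (poly_eval ?h ?s T) M" by simp
    also have "poly_eval ?h ?s T = (\<Sum>e\<in>K. Poly_Mapping.single (rank_one_mono e) (rank_eval k (P e)))"
    proof -
      have "mono_eval ?s e = mono_eval var (rank_one_mono e)" for e
      proof -
        have "case_sum (\<lambda>i. var (Inl i)) (\<lambda>j. var (Inr j)) =
            (var :: 'm + 'n \<Rightarrow> ('m + 'n, ('m option \<times> 'n option \<times> nat, 'k) mpoly) mpoly)"
          by (rule ext) (simp split: sum.splits)
        then show ?thesis unfolding mono_eval_rank_one by simp
      qed
      then show ?thesis
        by (simp only: poly_eval_def K_def P_def single_eq_const_mult_mono_eval[symmetric])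
    qed
    also have "Poly_Mapping.lookup \<dots> M = (\<Sum>e\<in>K. if rank_one_mono e = M then rank_eval k (P e) else 0)"
      by (simp only: lookup_sum lookup_single when_def)
    also have "\<dots> = (\<Sum>e\<in>{e\<in>K. rank_one_mono e = M}. rank_eval k (P e))"
      by (rule sum.inter_filter[symmetric]) (simp add: K_def)
    also have "\<dots> = rank_eval k (Q M)" by (simp only: Q_def ring_map_sum[OF ring_map_rank_eval])
    finally show ?thesis unfolding vanishing_ideal_1_iff_rank_eval by simp
  qed
  have rank_one: "mono_eval (\<lambda>c. var (YV c)) e - mono_eval (\<lambda>c. var (YV c)) e' \<in> ?J"
    if "rank_one_mono e = rank_one_mono e'" for e e' :: "'m \<times> 'n \<Rightarrow>\<^sub>0 nat"
  proof -
    let ?f = "Poly_Mapping.single e 1 - Poly_Mapping.single e' 1 :: ('m \<times> 'n, 'k) mpoly"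
    have re: "rank_eval 1 (Poly_Mapping.single e (1::'k)) =
        mono_eval (case_sum (\<lambda>i. var (Some i, None, 0)) (\<lambda>j. var (None, Some j, 0))) (rank_one_mono e)"
      for e :: "'m \<times> 'n \<Rightarrow>\<^sub>0 nat"
      unfolding mono_eval_rank_one[symmetric]
      by (simp add: rank_eval_def poly_eval_single[OF ring_map_const] ring_map_1[OF ring_map_const])
    have "rank_eval 1 ?f = 0" by (simp only: ring_map_diff[OF ring_map_rank_eval] re that diff_self)
    then have "?f \<in> ?V 1" unfolding vanishing_ideal_1_iff_rank_eval .
    then have "rename_vars YV ?f \<in> ?J" by (intro ring_module.span_base) blast
    moreover have "rename_vars YV (Poly_Mapping.single e (1::'k)) = mono_eval (\<lambda>c. var (YV c)) e"
      for e :: "'m \<times> 'n \<Rightarrow>\<^sub>0 nat"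
      by (simp add: rename_vars_def poly_subst_eq_poly_eval poly_eval_single[OF ring_map_const])
    ultimately show ?thesis by (simp only: ring_map_diff[OF ring_map_rename_vars])
  qed
  let ?y = "\<lambda>e :: 'm \<times> 'n \<Rightarrow>\<^sub>0 nat. mono_eval (\<lambda>c. var (YV c)) e :: (('m \<times> 'n) jvar, 'k) mpoly"
  define rep where "rep M = (SOME e :: 'm \<times> 'n \<Rightarrow>\<^sub>0 nat. rank_one_mono e = M)" for M
  have rep: "rank_one_mono (rep (rank_one_mono e)) = rank_one_mono e" for e
    unfolding rep_def by (rule someI) (rule refl)
  have "(\<Sum>e\<in>K. rename_vars ZV (P e) * ?y (rep (rank_one_mono e))) \<in> ?J"
  proof -
    have "(\<Sum>e\<in>K. rename_vars ZV (P e) * ?y (rep (rank_one_mono e))) =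
        (\<Sum>M\<in>rank_one_mono ` K. \<Sum>e\<in>{e\<in>K. rank_one_mono e = M}. rename_vars ZV (P e) * ?y (rep (rank_one_mono e)))"
      by (rule sum.group[symmetric]) (auto simp: K_def)
    also have "\<dots> = (\<Sum>M\<in>rank_one_mono ` K. \<Sum>e\<in>{e\<in>K. rank_one_mono e = M}. rename_vars ZV (P e) * ?y (rep M))"
      by (intro sum.cong refl) simp
    also have "\<dots> = (\<Sum>M\<in>rank_one_mono ` K. ?y (rep M) * rename_vars ZV (Q M))"
      by (simp only: Q_def ring_map_sum[OF ring_map_rename_vars] sum_distrib_left mult.commute)
    also have "\<dots> \<in> ?J"
      by (intro ring_module.subspace_sum[OF J] ring_module.span_scale ring_module.span_base) (use Q in blast)
    finally show ?thesis .
  qed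
  moreover have "(\<Sum>e\<in>K. rename_vars ZV (P e) * (?y e - ?y (rep (rank_one_mono e)))) \<in> ?J"
    by (intro ring_module.subspace_sum[OF J] ring_module.span_scale rank_one rep[symmetric])
  ultimately have "(\<Sum>e\<in>K. rename_vars ZV (P e) * (?y e - ?y (rep (rank_one_mono e)))) +
      (\<Sum>e\<in>K. rename_vars ZV (P e) * ?y (rep (rank_one_mono e))) \<in> ?J"
    by (intro ring_module.span_add)
  also have "(\<Sum>e\<in>K. rename_vars ZV (P e) * (?y e - ?y (rep (rank_one_mono e)))) +
      (\<Sum>e\<in>K. rename_vars ZV (P e) * ?y (rep (rank_one_mono e))) = poly_eval (rename_vars ZV) (\<lambda>c. var (YV c)) T"
    by (simp only: poly_eval_def K_def P_def sum.distrib[symmetric] distrib_left[symmetric] diff_add_cancel)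
  also have "\<dots> = poly_eval (Poly_Mapping.single 0) (\<lambda>c. var (YV c) + var (ZV c)) p"
    unfolding T_def
  proof (rule ring_map_eqI[where g = "\<lambda>p. poly_eval (rename_vars ZV) (\<lambda>c. var (YV c))
      (poly_eval (\<lambda>a. Poly_Mapping.single 0 (Poly_Mapping.single 0 a)) (\<lambda>c. var c + Poly_Mapping.single 0 (var c)) p)"])
    note hom = ring_map_poly_eval[OF ring_map_rename_vars]
    show "ring_map (\<lambda>p :: ('m \<times> 'n, 'k) mpoly. poly_eval (rename_vars ZV) (\<lambda>c. var (YV c))
      (poly_eval (\<lambda>a. Poly_Mapping.single 0 (Poly_Mapping.single 0 a)) (\<lambda>c. var c + Poly_Mapping.single 0 (var c)) p))"
      by (rule ring_map_comp[OF hom ring_map_poly_eval[OF coeff_hom]])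
    show "ring_map (poly_eval (Poly_Mapping.single 0) (\<lambda>c. var (YV c) + var (ZV c)))"
      by (rule ring_map_poly_eval[OF ring_map_const])
    have ZV: "rename_vars ZV (Poly_Mapping.single 0 a) = Poly_Mapping.single 0 a"
      "rename_vars ZV (var c) = var (ZV c)" for a :: 'k and c :: "'m \<times> 'n"
      by (simp_all add: rename_vars_def poly_subst_eq_poly_eval poly_eval_const[OF ring_map_const] poly_eval_var[OF ring_map_const])
    show "poly_eval (rename_vars ZV) (\<lambda>c. var (YV c)) (poly_eval (\<lambda>a. Poly_Mapping.single 0 (Poly_Mapping.single 0 a))
        (\<lambda>c. var c + Poly_Mapping.single 0 (var c)) (Poly_Mapping.single 0 a)) =
      poly_eval (Poly_Mapping.single 0) (\<lambda>c. var (YV c) + var (ZV c)) (Poly_Mapping.single 0 a)" for a :: 'k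
      by (simp only: poly_eval_const[OF coeff_hom] poly_eval_const[OF ring_map_rename_vars] poly_eval_const[OF ring_map_const] ZV)
    show "poly_eval (rename_vars ZV) (\<lambda>c. var (YV c)) (poly_eval (\<lambda>a. Poly_Mapping.single 0 (Poly_Mapping.single 0 a))
        (\<lambda>c. var c + Poly_Mapping.single 0 (var c)) (var c)) =
      poly_eval (Poly_Mapping.single 0) (\<lambda>c. var (YV c) + var (ZV c)) (var c :: ('m \<times> 'n, 'k) mpoly)" for c
      by (simp only: poly_eval_var[OF coeff_hom] ring_map_add[OF hom] poly_eval_var[OF ring_map_rename_vars]
          poly_eval_const[OF ring_map_rename_vars] poly_eval_var[OF ring_map_const] ZV)
  qed
  finally have yz: "poly_eval (Poly_Mapping.single 0) (\<lambda>c. var (YV c) + var (ZV c)) p \<in> ?J" .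
  have "poly_eval (Poly_Mapping.single 0) (\<lambda>c. var (XV c)) p -
      poly_eval (Poly_Mapping.single 0) (\<lambda>c. var (YV c) + var (ZV c)) p \<in> ?J"
  proof (rule ideal_cong_poly_eval[OF J])
    fix c :: "'m \<times> 'n"
    have "var (XV c) - var (YV c) - var (ZV c) \<in> ?J" by (rule ring_module.span_base) blast
    then show "var (XV c) - (var (YV c) + var (ZV c)) \<in> ?J" by (simp only: diff_diff_add)
  qed
  then have "rename_vars XV p \<in> ?J"
    using ring_module.span_add[OF _ yz] unfolding rename_vars_def poly_subst_eq_poly_eval by fastforce
  then show "p \<in> join_ideal (?V 1) (?V k)" by (simp add: join_ideal_def)
qed

theorem secant_ideal_vanishing_ideal:
  assumes "r \<ge> 1"
  shows "secant_ideal (vanishing_ideal 1 1) r = (vanishing_ideal r 1 :: ('m::linorder \<times> 'n::linorder, 'k::idom) mpoly set)"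
proof -
  let ?V = "\<lambda>k. vanishing_ideal k 1 :: ('m \<times> 'n, 'k) mpoly set"
  have "(join_ideal (?V 1) ^^ n) (?V 1) = ?V (Suc n)" for n
  proof (induction n)
    case (Suc n)
    have "join_ideal (?V 1) (?V (Suc n)) = ?V (Suc (Suc n))"
      by (rule subset_antisym[OF join_vanishing_subset vanishing_subset_join])
    then show ?case by (simp only: funpow.simps o_apply Suc.IH)
  qed simp
  from this[of "r - 1"] show ?thesis using assms by (simp add: secant_ideal_def)
qed

theorem corollary5p7:
  fixes X :: "'m::{finite,linorder} \<Rightarrow> 'n::{finite,linorder} \<Rightarrow> ('m \<times> 'n, 'k::alg_closed_field) mpoly"
    and I :: "('m \<times> 'n, 'k) mpoly set"
    and r s :: nat
  assumes X: "X = generic_matrix"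
    and I: "I = ideal_gen (minors 2 X)"
    and r: "r \<ge> 1"
    and s: "s \<ge> 1"
  shows "secant_ideal I r = ideal_gen (minors (r + 1) X) \<and>
    symbolic_power (secant_ideal I r) s = ideal_gen (minor_products r s X) \<and>
    (\<forall>ord. diagonal_term_order X ord \<longrightarrow>
       is_groebner_basis ord (minor_products r s X) (symbolic_power (secant_ideal I r) s))"
proof -
  have "I = vanishing_ideal 1 1"
    unfolding I X vanishing_ideal_1 by (simp only: one_add_one)
  then have sec: "secant_ideal I r = vanishing_ideal r 1"
    using secant_ideal_vanishing_ideal[OF r] by simp
  have sym: "symbolic_power (secant_ideal I r) s = vanishing_ideal r s"
    unfolding sec by (rule symbolic_power_vanishing_ideal[OF s])
  show ?thesis
    unfolding sym unfolding sec X
    using vanishing_ideal_1[where 'm = 'm and 'n = 'n and 'k = 'k, of r]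
      vanishing_ideal_eq_ideal_gen[OF s, where 'm = 'm and 'n = 'n and 'k = 'k, of r]
      is_groebner_basis_minor_products[OF _ s, where 'm = 'm and 'n = 'n and 'k = 'k and r = r] by blast
qed

end
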